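(* Let $\mathcal{A}$ be an abelian Bénabou cosmos and let $\mathcal{C}$ be a small $\mathcal{A}$-category. Assume that $\mathcal{A}$ has enough injectives. Then $\mathrm{Mod}(\mathcal{C})$ has enough injectives. Moreover, a $\mathcal{C}$-module is injective if and only if it is a direct summand of a module $\mathrm{CoFr}(i_* )$ such that $i_c$ is an injective object of $\mathcal{A}$ for any object $c$ of $\mathcal{C}$.
   Context: A Bénabou cosmos is a complete and cocomplete symmetric closed monoidal category. A Bénabou cosmos $\mathcal{A}$ is called abelian if its underlying category is an abelian category satisfying (AB4) and (AB4* ), i.e. small coproducts, resp. products, of short exact sequences are short exact. The inner hom is $\mathcal{A}(-,-)$. A $\mathcal{C}$-module is an $\mathcal{A}$-functor $\mathcal{C}\to\mathcal{A}$; $\mathrm{Mod}(\mathcal{C})$ is the (abelian) ordinary category of $\mathcal{C}$-modules and $\mathcal{A}$-natural transformations. "Injective object" is meant in the ordinary sense in the underlying abelian categories. For a family $a_*=(a_c)_{c\in\mathrm{Ob}(\mathcal{C})}$ of objects of $\mathcal{A}$, the cofree module is $\mathrm{CoFr}(a_* )=\prod_{c}\mathcal{A}(\mathcal{C}(-,c),a_c)$; $\mathrm{CoFr}$ is the right adjoint of the forgetful functor $\mathrm{Forg}$ sending a $\mathcal{C}$-module $M$ to the family $(Mc)_{c\in\mathrm{Ob}(\mathcal{C})}$. *)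

theory Defs
  imports "HOL-Algebra.Group"
begin

section \<open>Smallness\<close>

text \<open>
  ``Small'' is relative to a family of small subsets of a type, closed under the usual set
  operations. The subsets of cardinality below a fixed Grothendieck universe are an instance; so are
  all subsets of an infinite type.  Closure under power sets is not required.
\<close>

locale smallness =
  fixes small :: "'s set \<Rightarrow> bool"
  assumes small_subset: "small X \<Longrightarrow> Y \<subseteq> X \<Longrightarrow> small Y"
    and small_image: "small X \<Longrightarrow> small (h ` X)"
    and small_Union: "small X \<Longrightarrow> (\<And>x. x \<in> X \<Longrightarrow> small (Z x)) \<Longrightarrow> small (\<Union>x\<in>X. Z x)"
    and small_infinite: "\<exists>X. small X \<and> infinite X"

section \<open>Categories\<close>

record ('o, 'm) precat =
  Obj :: "'o set"
  Arr :: "'m set"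
  Dom :: "'m \<Rightarrow> 'o"
  Cod :: "'m \<Rightarrow> 'o"
  Ident :: "'o \<Rightarrow> 'm"
  Comp :: "'m \<Rightarrow> 'm \<Rightarrow> 'm"  (infixr "\<cdot>\<index>" 55)

definition Hom :: "('o, 'm, 'z) precat_scheme \<Rightarrow> 'o \<Rightarrow> 'o \<Rightarrow> 'm set" where
  "Hom C x y = {f \<in> Arr C. Dom C f = x \<and> Cod C f = y}"

locale category =
  fixes C :: "('o, 'm, 'z) precat_scheme" (structure)
  assumes Dom_Obj: "f \<in> Arr C \<Longrightarrow> Dom C f \<in> Obj C"
    and Cod_Obj: "f \<in> Arr C \<Longrightarrow> Cod C f \<in> Obj C"
    and Ident_Hom: "x \<in> Obj C \<Longrightarrow> Ident C x \<in> Hom C x x"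
    and Comp_Hom: "f \<in> Hom C x y \<Longrightarrow> g \<in> Hom C y z \<Longrightarrow> g \<cdot> f \<in> Hom C x z"
    and Ident_left: "f \<in> Hom C x y \<Longrightarrow> Ident C y \<cdot> f = f"
    and Ident_right: "f \<in> Hom C x y \<Longrightarrow> f \<cdot> Ident C x = f"
    and Comp_assoc: "f \<in> Hom C w x \<Longrightarrow> g \<in> Hom C x y \<Longrightarrow> h \<in> Hom C y z
      \<Longrightarrow> (h \<cdot> g) \<cdot> f = h \<cdot> (g \<cdot> f)"

definition op_cat :: "('o, 'm, 'z) precat_scheme \<Rightarrow> ('o, 'm) precat" where
  "op_cat C = \<lparr>Obj = Obj C, Arr = Arr C, Dom = Cod C, Cod = Dom C, Ident = Ident C,
     Comp = (\<lambda>g f. Comp C f g)\<rparr>"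

definition inverse_arrows :: "('o, 'm, 'z) precat_scheme \<Rightarrow> 'm \<Rightarrow> 'm \<Rightarrow> bool" where
  "inverse_arrows C f g \<longleftrightarrow> f \<in> Arr C \<and> g \<in> Hom C (Cod C f) (Dom C f) \<and>
     g \<cdot>\<^bsub>C\<^esub> f = Ident C (Dom C f) \<and> f \<cdot>\<^bsub>C\<^esub> g = Ident C (Cod C f)"

definition is_iso :: "('o, 'm, 'z) precat_scheme \<Rightarrow> 'm \<Rightarrow> bool" where
  "is_iso C f \<longleftrightarrow> (\<exists>g. inverse_arrows C f g)"

definition inverse_arrow :: "('o, 'm, 'z) precat_scheme \<Rightarrow> 'm \<Rightarrow> 'm" where
  "inverse_arrow C f = (THE g. inverse_arrows C f g)"

definition monic :: "('o, 'm, 'z) precat_scheme \<Rightarrow> 'm \<Rightarrow> bool" where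
  "monic C f \<longleftrightarrow> f \<in> Arr C \<and>
     (\<forall>g\<in>Arr C. \<forall>h\<in>Arr C. Dom C g = Dom C h \<and> Cod C g = Dom C f \<and> Cod C h = Dom C f \<and>
        f \<cdot>\<^bsub>C\<^esub> g = f \<cdot>\<^bsub>C\<^esub> h \<longrightarrow> g = h)"

subsection \<open>Limits\<close>

definition is_functor ::
  "('a, 'b, 'y) precat_scheme \<Rightarrow> ('o, 'm, 'z) precat_scheme \<Rightarrow> ('a \<Rightarrow> 'o) \<Rightarrow> ('b \<Rightarrow> 'm) \<Rightarrow> bool" where
  "is_functor J C F\<^sub>0 F\<^sub>1 \<longleftrightarrow>
     (\<forall>j\<in>Obj J. F\<^sub>0 j \<in> Obj C \<and> F\<^sub>1 (Ident J j) = Ident C (F\<^sub>0 j)) \<and>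
     (\<forall>u\<in>Arr J. F\<^sub>1 u \<in> Hom C (F\<^sub>0 (Dom J u)) (F\<^sub>0 (Cod J u))) \<and>
     (\<forall>u\<in>Arr J. \<forall>v\<in>Arr J. Cod J u = Dom J v \<longrightarrow> F\<^sub>1 (v \<cdot>\<^bsub>J\<^esub> u) = F\<^sub>1 v \<cdot>\<^bsub>C\<^esub> F\<^sub>1 u)"

definition is_cone ::
  "('a, 'b, 'y) precat_scheme \<Rightarrow> ('o, 'm, 'z) precat_scheme \<Rightarrow> ('a \<Rightarrow> 'o) \<Rightarrow> ('b \<Rightarrow> 'm)
     \<Rightarrow> 'o \<Rightarrow> ('a \<Rightarrow> 'm) \<Rightarrow> bool" where
  "is_cone J C F\<^sub>0 F\<^sub>1 L p \<longleftrightarrow> L \<in> Obj C \<and> (\<forall>j\<in>Obj J. p j \<in> Hom C L (F\<^sub>0 j)) \<and>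
     (\<forall>u\<in>Arr J. F\<^sub>1 u \<cdot>\<^bsub>C\<^esub> p (Dom J u) = p (Cod J u))"

definition is_limit ::
  "('a, 'b, 'y) precat_scheme \<Rightarrow> ('o, 'm, 'z) precat_scheme \<Rightarrow> ('a \<Rightarrow> 'o) \<Rightarrow> ('b \<Rightarrow> 'm)
     \<Rightarrow> 'o \<Rightarrow> ('a \<Rightarrow> 'm) \<Rightarrow> bool" where
  "is_limit J C F\<^sub>0 F\<^sub>1 L p \<longleftrightarrow> is_cone J C F\<^sub>0 F\<^sub>1 L p \<and>
     (\<forall>L' p'. is_cone J C F\<^sub>0 F\<^sub>1 L' p' \<longrightarrow>
        (\<exists>!h. h \<in> Hom C L' L \<and> (\<forall>j\<in>Obj J. p j \<cdot>\<^bsub>C\<^esub> h = p' j)))"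

definition small_complete :: "('s set \<Rightarrow> bool) \<Rightarrow> ('o, 'm, 'z) precat_scheme \<Rightarrow> bool" where
  "small_complete small C \<longleftrightarrow>
     (\<forall>(J :: ('s, 's) precat) F\<^sub>0 F\<^sub>1.
        category J \<and> small (Obj J) \<and> small (Arr J) \<and> is_functor J C F\<^sub>0 F\<^sub>1 \<longrightarrow>
        (\<exists>L p. is_limit J C F\<^sub>0 F\<^sub>1 L p))"

definition small_cocomplete :: "('s set \<Rightarrow> bool) \<Rightarrow> ('o, 'm, 'z) precat_scheme \<Rightarrow> bool" where
  "small_cocomplete small C \<longleftrightarrow> small_complete small (op_cat C)"

definition is_product ::
  "('o, 'm, 'z) precat_scheme \<Rightarrow> 'i set \<Rightarrow> ('i \<Rightarrow> 'o) \<Rightarrow> 'o \<Rightarrow> ('i \<Rightarrow> 'm) \<Rightarrow> bool" where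
  "is_product C I X P p \<longleftrightarrow> P \<in> Obj C \<and> (\<forall>i\<in>I. X i \<in> Obj C \<and> p i \<in> Hom C P (X i)) \<and>
     (\<forall>Q\<in>Obj C. \<forall>q. (\<forall>i\<in>I. q i \<in> Hom C Q (X i)) \<longrightarrow>
        (\<exists>!h. h \<in> Hom C Q P \<and> (\<forall>i\<in>I. p i \<cdot>\<^bsub>C\<^esub> h = q i)))"

definition is_coproduct ::
  "('o, 'm, 'z) precat_scheme \<Rightarrow> 'i set \<Rightarrow> ('i \<Rightarrow> 'o) \<Rightarrow> 'o \<Rightarrow> ('i \<Rightarrow> 'm) \<Rightarrow> bool" where
  "is_coproduct C I X P p \<longleftrightarrow> is_product (op_cat C) I X P p"

subsection \<open>Abelian categories\<close>

definition zero_object :: "('o, 'm, 'z) precat_scheme \<Rightarrow> 'o \<Rightarrow> bool" where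
  "zero_object C z \<longleftrightarrow> z \<in> Obj C \<and>
     (\<forall>x\<in>Obj C. (\<exists>!f. f \<in> Hom C x z) \<and> (\<exists>!f. f \<in> Hom C z x))"

definition zero_arrow :: "('o, 'm, 'z) precat_scheme \<Rightarrow> 'm \<Rightarrow> bool" where
  "zero_arrow C f \<longleftrightarrow>
     (\<exists>z g h. zero_object C z \<and> g \<in> Hom C (Dom C f) z \<and> h \<in> Hom C z (Cod C f) \<and> f = h \<cdot>\<^bsub>C\<^esub> g)"

definition is_kernel :: "('o, 'm, 'z) precat_scheme \<Rightarrow> 'm \<Rightarrow> 'm \<Rightarrow> bool" where
  "is_kernel C k f \<longleftrightarrow> k \<in> Arr C \<and> f \<in> Arr C \<and> Cod C k = Dom C f \<and> zero_arrow C (f \<cdot>\<^bsub>C\<^esub> k) \<and>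
     (\<forall>g\<in>Arr C. Cod C g = Dom C f \<and> zero_arrow C (f \<cdot>\<^bsub>C\<^esub> g) \<longrightarrow>
        (\<exists>!h. h \<in> Hom C (Dom C g) (Dom C k) \<and> k \<cdot>\<^bsub>C\<^esub> h = g))"

definition is_cokernel :: "('o, 'm, 'z) precat_scheme \<Rightarrow> 'm \<Rightarrow> 'm \<Rightarrow> bool" where
  "is_cokernel C k f \<longleftrightarrow> is_kernel (op_cat C) k f"

definition short_exact :: "('o, 'm, 'z) precat_scheme \<Rightarrow> 'm \<Rightarrow> 'm \<Rightarrow> bool" where
  "short_exact C f g \<longleftrightarrow> is_kernel C f g \<and> is_cokernel C g f"

locale preadditive = category +
  fixes add :: "'b \<Rightarrow> 'b \<Rightarrow> 'b" and zero :: "'a \<Rightarrow> 'a \<Rightarrow> 'b"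
  assumes Hom_comm_group: "x \<in> Obj C \<Longrightarrow> y \<in> Obj C
      \<Longrightarrow> comm_group \<lparr>carrier = Hom C x y, mult = add, one = zero x y\<rparr>"
    and Comp_add_right: "f \<in> Hom C x y \<Longrightarrow> f' \<in> Hom C x y \<Longrightarrow> g \<in> Hom C y z
      \<Longrightarrow> g \<cdot> add f f' = add (g \<cdot> f) (g \<cdot> f')"
    and Comp_add_left: "f \<in> Hom C x y \<Longrightarrow> g \<in> Hom C y z \<Longrightarrow> g' \<in> Hom C y z
      \<Longrightarrow> add g g' \<cdot> f = add (g \<cdot> f) (g' \<cdot> f)"

definition is_biproduct ::
  "('o, 'm, 'z) precat_scheme \<Rightarrow> ('m \<Rightarrow> 'm \<Rightarrow> 'm) \<Rightarrow> 'o \<Rightarrow> 'o \<Rightarrow> 'o \<Rightarrow> 'm \<Rightarrow> 'm \<Rightarrow> 'm \<Rightarrow> 'm \<Rightarrow> bool" where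
  "is_biproduct C add x y b i\<^sub>1 i\<^sub>2 p\<^sub>1 p\<^sub>2 \<longleftrightarrow>
     i\<^sub>1 \<in> Hom C x b \<and> i\<^sub>2 \<in> Hom C y b \<and> p\<^sub>1 \<in> Hom C b x \<and> p\<^sub>2 \<in> Hom C b y \<and>
     p\<^sub>1 \<cdot>\<^bsub>C\<^esub> i\<^sub>1 = Ident C x \<and> p\<^sub>2 \<cdot>\<^bsub>C\<^esub> i\<^sub>2 = Ident C y \<and>
     add (i\<^sub>1 \<cdot>\<^bsub>C\<^esub> p\<^sub>1) (i\<^sub>2 \<cdot>\<^bsub>C\<^esub> p\<^sub>2) = Ident C b"

locale abelian_category = category +
  assumes zero_object_exists: "\<exists>z. zero_object C z"
    and additive: "\<exists>add zero. preadditive C add zero \<and>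
      (\<forall>x\<in>Obj C. \<forall>y\<in>Obj C. \<exists>b i\<^sub>1 i\<^sub>2 p\<^sub>1 p\<^sub>2. is_biproduct C add x y b i\<^sub>1 i\<^sub>2 p\<^sub>1 p\<^sub>2)"
    and kernel_exists: "f \<in> Arr C \<Longrightarrow> \<exists>k. is_kernel C k f"
    and cokernel_exists: "f \<in> Arr C \<Longrightarrow> \<exists>k. is_cokernel C k f"
    and mono_is_kernel: "monic C f \<Longrightarrow> \<exists>g. is_kernel C f g"
    and epi_is_cokernel: "monic (op_cat C) f \<Longrightarrow> \<exists>g. is_cokernel C f g"

text \<open>Small products of short exact sequences are short exact: \<open>F\<close> and \<open>G\<close> are the arrows induced by
  the families \<open>f\<close> and \<open>g\<close> between arbitrary products of the three families of objects.\<close>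

definition AB4_star :: "('s set \<Rightarrow> bool) \<Rightarrow> ('o, 'm, 'z) precat_scheme \<Rightarrow> bool" where
  "AB4_star small C \<longleftrightarrow>
     (\<forall>I f g P p Q q R r F G.
        small I \<and> (\<forall>i\<in>I. short_exact C (f i) (g i)) \<and>
        is_product C I (\<lambda>i. Dom C (f i)) P p \<and>
        is_product C I (\<lambda>i. Cod C (f i)) Q q \<and>
        is_product C I (\<lambda>i. Cod C (g i)) R r \<and>
        F \<in> Hom C P Q \<and> (\<forall>i\<in>I. q i \<cdot>\<^bsub>C\<^esub> F = f i \<cdot>\<^bsub>C\<^esub> p i) \<and>
        G \<in> Hom C Q R \<and> (\<forall>i\<in>I. r i \<cdot>\<^bsub>C\<^esub> G = g i \<cdot>\<^bsub>C\<^esub> q i) \<longrightarrow>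
        short_exact C F G)"

definition AB4 :: "('s set \<Rightarrow> bool) \<Rightarrow> ('o, 'm, 'z) precat_scheme \<Rightarrow> bool" where
  "AB4 small C \<longleftrightarrow> AB4_star small (op_cat C)"

subsection \<open>Injective objects and direct summands\<close>

definition injective :: "('o, 'm, 'z) precat_scheme \<Rightarrow> 'o \<Rightarrow> bool" where
  "injective C i \<longleftrightarrow> i \<in> Obj C \<and>
     (\<forall>f g. monic C f \<and> g \<in> Hom C (Dom C f) i \<longrightarrow> (\<exists>h \<in> Hom C (Cod C f) i. h \<cdot>\<^bsub>C\<^esub> f = g))"

definition enough_injectives :: "('o, 'm, 'z) precat_scheme \<Rightarrow> bool" where
  "enough_injectives C \<longleftrightarrow> (\<forall>x\<in>Obj C. \<exists>i f. injective C i \<and> f \<in> Hom C x i \<and> monic C f)"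

text \<open>\<open>x\<close> is a direct summand of \<open>y\<close> if \<open>y\<close> is a direct sum of \<open>x\<close> and some object \<open>z\<close>.\<close>

definition direct_summand :: "('o, 'm, 'z) precat_scheme \<Rightarrow> 'o \<Rightarrow> 'o \<Rightarrow> bool" where
  "direct_summand C x y \<longleftrightarrow>
     (\<exists>z \<iota>. is_coproduct C (UNIV :: bool set) (\<lambda>b. if b then x else z) y \<iota>)"

section \<open>Abelian Benabou cosmoi\<close>

text \<open>\<open>Assoc x y z\<close> goes from \<open>(x \<boxtimes> y) \<boxtimes> z\<close> to \<open>x \<boxtimes> (y \<boxtimes> z)\<close>; the inner hom \<open>IHom x y\<close> comes with its
  evaluation \<open>IHom x y \<boxtimes> x \<rightarrow> y\<close>, the counit of the adjunction between \<open>- \<boxtimes> x\<close> and \<open>IHom x\<close>.\<close>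

record ('o, 'm) precosmos = "('o, 'm) precat" +
  TObj :: "'o \<Rightarrow> 'o \<Rightarrow> 'o"  (infixl "\<boxtimes>\<index>" 70)
  TArr :: "'m \<Rightarrow> 'm \<Rightarrow> 'm"  (infixl "\<boxdot>\<index>" 70)
  TUnit :: 'o
  Assoc :: "'o \<Rightarrow> 'o \<Rightarrow> 'o \<Rightarrow> 'm"
  LUnit :: "'o \<Rightarrow> 'm"
  RUnit :: "'o \<Rightarrow> 'm"
  Sym :: "'o \<Rightarrow> 'o \<Rightarrow> 'm"
  IHom :: "'o \<Rightarrow> 'o \<Rightarrow> 'o"
  Eval :: "'o \<Rightarrow> 'o \<Rightarrow> 'm"

locale monoidal_category = category V
  for V :: "('o, 'm, 'z) precosmos_scheme" (structure) +
  assumes TUnit_Obj: "TUnit V \<in> Obj V"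
    and TObj_Obj: "x \<in> Obj V \<Longrightarrow> y \<in> Obj V \<Longrightarrow> x \<boxtimes> y \<in> Obj V"
    and TArr_Hom: "f \<in> Hom V x x' \<Longrightarrow> g \<in> Hom V y y' \<Longrightarrow> f \<boxdot> g \<in> Hom V (x \<boxtimes> y) (x' \<boxtimes> y')"
    and TArr_Ident: "x \<in> Obj V \<Longrightarrow> y \<in> Obj V \<Longrightarrow> Ident V x \<boxdot> Ident V y = Ident V (x \<boxtimes> y)"
    and TArr_Comp: "f \<in> Hom V x x' \<Longrightarrow> f' \<in> Hom V x' x'' \<Longrightarrow> g \<in> Hom V y y' \<Longrightarrow> g' \<in> Hom V y' y''
      \<Longrightarrow> (f' \<cdot> f) \<boxdot> (g' \<cdot> g) = (f' \<boxdot> g') \<cdot> (f \<boxdot> g)"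
    and Assoc_Hom: "x \<in> Obj V \<Longrightarrow> y \<in> Obj V \<Longrightarrow> z \<in> Obj V
      \<Longrightarrow> Assoc V x y z \<in> Hom V ((x \<boxtimes> y) \<boxtimes> z) (x \<boxtimes> (y \<boxtimes> z))"
    and Assoc_iso: "x \<in> Obj V \<Longrightarrow> y \<in> Obj V \<Longrightarrow> z \<in> Obj V \<Longrightarrow> is_iso V (Assoc V x y z)"
    and Assoc_natural: "f \<in> Hom V x x' \<Longrightarrow> g \<in> Hom V y y' \<Longrightarrow> h \<in> Hom V z z'
      \<Longrightarrow> Assoc V x' y' z' \<cdot> ((f \<boxdot> g) \<boxdot> h) = (f \<boxdot> (g \<boxdot> h)) \<cdot> Assoc V x y z"
    and LUnit_Hom: "x \<in> Obj V \<Longrightarrow> LUnit V x \<in> Hom V (TUnit V \<boxtimes> x) x"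
    and LUnit_iso: "x \<in> Obj V \<Longrightarrow> is_iso V (LUnit V x)"
    and LUnit_natural: "f \<in> Hom V x x' \<Longrightarrow> LUnit V x' \<cdot> (Ident V (TUnit V) \<boxdot> f) = f \<cdot> LUnit V x"
    and RUnit_Hom: "x \<in> Obj V \<Longrightarrow> RUnit V x \<in> Hom V (x \<boxtimes> TUnit V) x"
    and RUnit_iso: "x \<in> Obj V \<Longrightarrow> is_iso V (RUnit V x)"
    and RUnit_natural: "f \<in> Hom V x x' \<Longrightarrow> RUnit V x' \<cdot> (f \<boxdot> Ident V (TUnit V)) = f \<cdot> RUnit V x"
    and pentagon: "w \<in> Obj V \<Longrightarrow> x \<in> Obj V \<Longrightarrow> y \<in> Obj V \<Longrightarrow> z \<in> Obj V
      \<Longrightarrow> Assoc V w x (y \<boxtimes> z) \<cdot> Assoc V (w \<boxtimes> x) y z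
        = (Ident V w \<boxdot> Assoc V x y z) \<cdot> Assoc V w (x \<boxtimes> y) z \<cdot> (Assoc V w x y \<boxdot> Ident V z)"
    and triangle: "x \<in> Obj V \<Longrightarrow> y \<in> Obj V
      \<Longrightarrow> (Ident V x \<boxdot> LUnit V y) \<cdot> Assoc V x (TUnit V) y = RUnit V x \<boxdot> Ident V y"

locale symmetric_monoidal_category = monoidal_category +
  assumes Sym_Hom: "x \<in> Obj V \<Longrightarrow> y \<in> Obj V \<Longrightarrow> Sym V x y \<in> Hom V (x \<boxtimes> y) (y \<boxtimes> x)"
    and Sym_natural: "f \<in> Hom V x x' \<Longrightarrow> g \<in> Hom V y y'
      \<Longrightarrow> Sym V x' y' \<cdot> (f \<boxdot> g) = (g \<boxdot> f) \<cdot> Sym V x y"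
    and Sym_Sym: "x \<in> Obj V \<Longrightarrow> y \<in> Obj V \<Longrightarrow> Sym V y x \<cdot> Sym V x y = Ident V (x \<boxtimes> y)"
    and Sym_unit: "x \<in> Obj V \<Longrightarrow> LUnit V x \<cdot> Sym V x (TUnit V) = RUnit V x"
    and hexagon: "x \<in> Obj V \<Longrightarrow> y \<in> Obj V \<Longrightarrow> z \<in> Obj V
      \<Longrightarrow> Assoc V y z x \<cdot> Sym V x (y \<boxtimes> z) \<cdot> Assoc V x y z
        = (Ident V y \<boxdot> Sym V x z) \<cdot> Assoc V y x z \<cdot> (Sym V x y \<boxdot> Ident V z)"

locale symmetric_closed_monoidal_category = symmetric_monoidal_category +
  assumes IHom_Obj: "x \<in> Obj V \<Longrightarrow> y \<in> Obj V \<Longrightarrow> IHom V x y \<in> Obj V"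
    and Eval_Hom: "x \<in> Obj V \<Longrightarrow> y \<in> Obj V \<Longrightarrow> Eval V x y \<in> Hom V (IHom V x y \<boxtimes> x) y"
    and Eval_universal: "x \<in> Obj V \<Longrightarrow> y \<in> Obj V \<Longrightarrow> z \<in> Obj V \<Longrightarrow> f \<in> Hom V (z \<boxtimes> x) y
      \<Longrightarrow> \<exists>!g. g \<in> Hom V z (IHom V x y) \<and> Eval V x y \<cdot> (g \<boxdot> Ident V x) = f"

locale cosmos = symmetric_closed_monoidal_category +
  fixes small :: "'s set \<Rightarrow> bool"
  assumes complete: "small_complete small V"
    and cocomplete: "small_cocomplete small V"

locale abelian_cosmos = cosmos V small + abelian_category V
  for V :: "('o, 'm, 'z) precosmos_scheme" (structure) and small :: "'s set \<Rightarrow> bool" +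
  assumes AB4_holds: "AB4 small V"
    and AB4_star_holds: "AB4_star small V"

definition curry_arrow ::
  "('o, 'm, 'z) precosmos_scheme \<Rightarrow> 'o \<Rightarrow> 'o \<Rightarrow> 'o \<Rightarrow> 'm \<Rightarrow> 'm" where
  "curry_arrow V z x y f =
     (THE g. g \<in> Hom V z (IHom V x y) \<and> Eval V x y \<cdot>\<^bsub>V\<^esub> (g \<boxdot>\<^bsub>V\<^esub> Ident V x) = f)"

definition uncurry_arrow :: "('o, 'm, 'z) precosmos_scheme \<Rightarrow> 'o \<Rightarrow> 'o \<Rightarrow> 'm \<Rightarrow> 'm" where
  "uncurry_arrow V x y g = Eval V x y \<cdot>\<^bsub>V\<^esub> (g \<boxdot>\<^bsub>V\<^esub> Ident V x)"

section \<open>Enriched categories\<close>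

record ('c, 'o, 'm) ecat =
  EObj :: "'c set"
  EHom :: "'c \<Rightarrow> 'c \<Rightarrow> 'o"
  EComp :: "'c \<Rightarrow> 'c \<Rightarrow> 'c \<Rightarrow> 'm"
  EId :: "'c \<Rightarrow> 'm"

locale enriched_category =
  fixes V :: "('o, 'm, 'z) precosmos_scheme" (structure) and C :: "('c, 'o, 'm) ecat"
  assumes EHom_Obj: "x \<in> EObj C \<Longrightarrow> y \<in> EObj C \<Longrightarrow> EHom C x y \<in> Obj V"
    and EComp_Hom: "x \<in> EObj C \<Longrightarrow> y \<in> EObj C \<Longrightarrow> z \<in> EObj C
      \<Longrightarrow> EComp C x y z \<in> Hom V (EHom C y z \<boxtimes> EHom C x y) (EHom C x z)"
    and EId_Hom: "x \<in> EObj C \<Longrightarrow> EId C x \<in> Hom V (TUnit V) (EHom C x x)"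
    and EComp_assoc: "w \<in> EObj C \<Longrightarrow> x \<in> EObj C \<Longrightarrow> y \<in> EObj C \<Longrightarrow> z \<in> EObj C
      \<Longrightarrow> EComp C w x z \<cdot> (EComp C x y z \<boxdot> Ident V (EHom C w x))
        = EComp C w y z \<cdot> (Ident V (EHom C y z) \<boxdot> EComp C w x y)
            \<cdot> Assoc V (EHom C y z) (EHom C x y) (EHom C w x)"
    and EId_left: "x \<in> EObj C \<Longrightarrow> y \<in> EObj C
      \<Longrightarrow> EComp C x y y \<cdot> (EId C y \<boxdot> Ident V (EHom C x y)) = LUnit V (EHom C x y)"
    and EId_right: "x \<in> EObj C \<Longrightarrow> y \<in> EObj C
      \<Longrightarrow> EComp C x x y \<cdot> (Ident V (EHom C x y) \<boxdot> EId C x) = RUnit V (EHom C x y)"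

definition self_enriched :: "('o, 'm, 'z) precosmos_scheme \<Rightarrow> ('o, 'o, 'm) ecat" where
  "self_enriched V = \<lparr>
     EObj = Obj V,
     EHom = IHom V,
     EComp = (\<lambda>x y z. curry_arrow V (IHom V y z \<boxtimes>\<^bsub>V\<^esub> IHom V x y) x z
       (Eval V y z \<cdot>\<^bsub>V\<^esub> (Ident V (IHom V y z) \<boxdot>\<^bsub>V\<^esub> Eval V x y)
          \<cdot>\<^bsub>V\<^esub> Assoc V (IHom V y z) (IHom V x y) x)),
     EId = (\<lambda>x. curry_arrow V (TUnit V) x x (LUnit V x))\<rparr>"

text \<open>Enriched functors and natural transformations are required to be undefined outside the objects
  of the source, so that equality in HOL is equality of functors and transformations.\<close>

record ('c, 'd, 'm) efun =
  FObj :: "'c \<Rightarrow> 'd"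
  FMap :: "'c \<Rightarrow> 'c \<Rightarrow> 'm"

locale enriched_functor =
  fixes V :: "('o, 'm, 'z) precosmos_scheme" (structure)
    and C :: "('c, 'o, 'm) ecat" and D :: "('d, 'o, 'm) ecat" and F :: "('c, 'd, 'm) efun"
  assumes FObj_EObj: "FObj F \<in> EObj C \<rightarrow>\<^sub>E EObj D"
    and FMap_Arr: "FMap F \<in> EObj C \<rightarrow>\<^sub>E (EObj C \<rightarrow>\<^sub>E Arr V)"
    and FMap_Hom: "x \<in> EObj C \<Longrightarrow> y \<in> EObj C
      \<Longrightarrow> FMap F x y \<in> Hom V (EHom C x y) (EHom D (FObj F x) (FObj F y))"
    and FMap_EComp: "x \<in> EObj C \<Longrightarrow> y \<in> EObj C \<Longrightarrow> z \<in> EObj C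
      \<Longrightarrow> FMap F x z \<cdot> EComp C x y z
        = EComp D (FObj F x) (FObj F y) (FObj F z) \<cdot> (FMap F y z \<boxdot> FMap F x y)"
    and FMap_EId: "x \<in> EObj C \<Longrightarrow> FMap F x x \<cdot> EId C x = EId D (FObj F x)"

record ('c, 'd, 'm) enat =
  Source :: "('c, 'd, 'm) efun"
  Target :: "('c, 'd, 'm) efun"
  Component :: "'c \<Rightarrow> 'm"

locale enriched_natural =
  fixes V :: "('o, 'm, 'z) precosmos_scheme" (structure)
    and C :: "('c, 'o, 'm) ecat" and D :: "('d, 'o, 'm) ecat" and t :: "('c, 'd, 'm) enat"
  assumes Source_functor: "enriched_functor V C D (Source t)"
    and Target_functor: "enriched_functor V C D (Target t)"
    and Component_Arr: "Component t \<in> EObj C \<rightarrow>\<^sub>E Arr V"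
    and Component_Hom: "x \<in> EObj C
      \<Longrightarrow> Component t x \<in> Hom V (TUnit V) (EHom D (FObj (Source t) x) (FObj (Target t) x))"
    and Component_natural: "x \<in> EObj C \<Longrightarrow> y \<in> EObj C
      \<Longrightarrow> EComp D (FObj (Source t) x) (FObj (Source t) y) (FObj (Target t) y)
            \<cdot> (Component t y \<boxdot> FMap (Source t) x y) \<cdot> inverse_arrow V (LUnit V (EHom C x y))
        = EComp D (FObj (Source t) x) (FObj (Target t) x) (FObj (Target t) y)
            \<cdot> (FMap (Target t) x y \<boxdot> Component t x) \<cdot> inverse_arrow V (RUnit V (EHom C x y))"

definition enriched_functor_category ::
  "('o, 'm, 'z) precosmos_scheme \<Rightarrow> ('c, 'o, 'm) ecat \<Rightarrow> ('d, 'o, 'm) ecat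
     \<Rightarrow> (('c, 'd, 'm) efun, ('c, 'd, 'm) enat) precat" where
  "enriched_functor_category V C D = \<lparr>
     Obj = {F. enriched_functor V C D F},
     Arr = {t. enriched_natural V C D t},
     Dom = Source,
     Cod = Target,
     Ident = (\<lambda>F. \<lparr>Source = F, Target = F, Component = (\<lambda>x\<in>EObj C. EId D (FObj F x))\<rparr>),
     Comp = (\<lambda>t s. \<lparr>Source = Source s, Target = Target t,
       Component = (\<lambda>x\<in>EObj C.
         EComp D (FObj (Source s) x) (FObj (Target s) x) (FObj (Target t) x)
           \<cdot>\<^bsub>V\<^esub> (Component t x \<boxdot>\<^bsub>V\<^esub> Component s x) \<cdot>\<^bsub>V\<^esub> inverse_arrow V (LUnit V (TUnit V)))\<rparr>)\<rparr>"

definition Mod ::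
  "('o, 'm, 'z) precosmos_scheme \<Rightarrow> ('c, 'o, 'm) ecat
     \<Rightarrow> (('c, 'o, 'm) efun, ('c, 'o, 'm) enat) precat" where
  "Mod V C = enriched_functor_category V C (self_enriched V)"

section \<open>Cofree modules\<close>

definition chosen_product ::
  "('o, 'm, 'z) precat_scheme \<Rightarrow> 'i set \<Rightarrow> ('i \<Rightarrow> 'o) \<Rightarrow> 'o \<times> ('i \<Rightarrow> 'm)" where
  "chosen_product C I X = (SOME (P, p). is_product C I X P p)"

abbreviation Prod :: "('o, 'm, 'z) precat_scheme \<Rightarrow> 'i set \<Rightarrow> ('i \<Rightarrow> 'o) \<Rightarrow> 'o" where
  "Prod C I X \<equiv> fst (chosen_product C I X)"

abbreviation Proj :: "('o, 'm, 'z) precat_scheme \<Rightarrow> 'i set \<Rightarrow> ('i \<Rightarrow> 'o) \<Rightarrow> 'i \<Rightarrow> 'm" where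
  "Proj C I X \<equiv> snd (chosen_product C I X)"

definition tuple_arrow ::
  "('o, 'm, 'z) precat_scheme \<Rightarrow> 'i set \<Rightarrow> ('i \<Rightarrow> 'o) \<Rightarrow> 'o \<Rightarrow> ('i \<Rightarrow> 'm) \<Rightarrow> 'm" where
  "tuple_arrow C I X Q q =
     (THE h. h \<in> Hom C Q (Prod C I X) \<and> (\<forall>i\<in>I. Proj C I X i \<cdot>\<^bsub>C\<^esub> h = q i))"

text \<open>The module \<open>\<A>(\<C>(-,c),a)\<close>. Its action \<open>\<C>(x,y) \<rightarrow> \<A>(\<A>(\<C>(x,c),a), \<A>(\<C>(y,c),a))\<close> is the double
  transpose of \<open>(\<C>(x,y) \<otimes> \<A>(\<C>(x,c),a)) \<otimes> \<C>(y,c) \<cong> \<A>(\<C>(x,c),a) \<otimes> (\<C>(y,c) \<otimes> \<C>(x,y))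
  \<rightarrow> \<A>(\<C>(x,c),a) \<otimes> \<C>(x,c) \<rightarrow> a\<close>.\<close>

definition hom_module ::
  "('o, 'm, 'z) precosmos_scheme \<Rightarrow> ('c, 'o, 'm) ecat \<Rightarrow> 'c \<Rightarrow> 'o \<Rightarrow> ('c, 'o, 'm) efun" where
  "hom_module V C c a = \<lparr>
     FObj = (\<lambda>x\<in>EObj C. IHom V (EHom C x c) a),
     FMap = (\<lambda>x\<in>EObj C. \<lambda>y\<in>EObj C.
       let U = EHom C x y; W = EHom C y c; H = IHom V (EHom C x c) a in
       curry_arrow V U H (IHom V W a) (curry_arrow V (U \<boxtimes>\<^bsub>V\<^esub> H) W a
         (Eval V (EHom C x c) a
            \<cdot>\<^bsub>V\<^esub> (Ident V H \<boxdot>\<^bsub>V\<^esub> EComp C x y c)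
            \<cdot>\<^bsub>V\<^esub> (Ident V H \<boxdot>\<^bsub>V\<^esub> Sym V U W)
            \<cdot>\<^bsub>V\<^esub> Assoc V H U W
            \<cdot>\<^bsub>V\<^esub> (Sym V U H \<boxdot>\<^bsub>V\<^esub> Ident V W))))\<rparr>"

text \<open>The pointwise product of a family of modules, with the action induced componentwise.\<close>

definition product_module ::
  "('o, 'm, 'z) precosmos_scheme \<Rightarrow> ('c, 'o, 'm) ecat \<Rightarrow> 'i set \<Rightarrow> ('i \<Rightarrow> ('c, 'o, 'm) efun)
     \<Rightarrow> ('c, 'o, 'm) efun" where
  "product_module V C I M = \<lparr>
     FObj = (\<lambda>x\<in>EObj C. Prod V I (\<lambda>i. FObj (M i) x)),
     FMap = (\<lambda>x\<in>EObj C. \<lambda>y\<in>EObj C.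
       let U = EHom C x y; P = Prod V I (\<lambda>i. FObj (M i) x); Q = Prod V I (\<lambda>i. FObj (M i) y) in
       curry_arrow V U P Q (tuple_arrow V I (\<lambda>i. FObj (M i) y) (U \<boxtimes>\<^bsub>V\<^esub> P)
         (\<lambda>i. uncurry_arrow V (FObj (M i) x) (FObj (M i) y) (FMap (M i) x y)
            \<cdot>\<^bsub>V\<^esub> (Ident V U \<boxdot>\<^bsub>V\<^esub> Proj V I (\<lambda>i. FObj (M i) x) i))))\<rparr>"

definition CoFr ::
  "('o, 'm, 'z) precosmos_scheme \<Rightarrow> ('c, 'o, 'm) ecat \<Rightarrow> ('c \<Rightarrow> 'o) \<Rightarrow> ('c, 'o, 'm) efun" where
  "CoFr V C a = product_module V C (EObj C) (\<lambda>c. hom_module V C c (a c))"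

end

theory Submission
  imports Defs
begin

text \<open>
  A module is a family of objects \<open>M x\<close> with an associative unital action \<open>\<C>(x,y) \<otimes> M x \<rightarrow> M y\<close>, and a
  module map is an equivariant family of arrows.  Equivariant maps \<open>M \<rightarrow> \<A>(\<C>(-,c),a)\<close> correspond to
  arrows \<open>M c \<rightarrow> a\<close>.  Kernels of module maps are computed pointwise, so a monomorphism of modules is
  pointwise monic; hence \<open>\<A>(\<C>(-,c),i)\<close> is injective for injective \<open>i\<close>, and so are the product
  \<open>CoFr\<close> of such modules and its direct summands.  Conversely, monomorphisms \<open>M c \<rightarrow> i c\<close> induce a
  monomorphism \<open>M \<rightarrow> CoFr i\<close>; if \<open>M\<close> is injective it splits, and the pointwise kernel of the retraction
  is a complement of \<open>M\<close>.
\<close>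

section \<open>Arrows in (symmetric) monoidal categories\<close>

text \<open>Two obstacles shape the development. Functor actions and components of transformations
  are arrows into inner homs, so every axiom carries a currying and an inverse unit constraint. Both
  are removed once, by uncurrying: equations into an inner hom are only ever compared after
  transposition, where they become equations between ordinary arrows. The second obstacle is the
  side. Modules carry left actions, but \<open>\<C>\<close> acts on \<open>\<A>(\<C>(-,c),a)\<close>
  by precomposition, whose left form is cluttered with symmetries. Read as a right action for the
  reversed composition, it is just evaluation after composing in \<open>\<C>\<close>, and its laws
  reduce to the pentagon, the triangle and the laws of \<open>\<C>\<close>. The left and right
  associativity laws are therefore proved equivalent in general and transported. Exactness is
  handled in \<open>\<A>\<close> one object at a time. What makes pointwise constructions into
  modules is that \<open>u \<otimes> -\<close> has a right adjoint: it preserves zero arrows, which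
  yields the action on a kernel, and jointly epic families, which makes a pointwise chosen map out
  of a split object equivariant.\<close>

lemma in_Hom: "f \<in> Hom C x y \<longleftrightarrow> f \<in> Arr C \<and> Dom C f = x \<and> Cod C f = y"
  by (auto simp: Hom_def)

context category
begin

lemma Ident_simps [simp]:
  assumes "x \<in> Obj C"
  shows "Ident C x \<in> Arr C" "Dom C (Ident C x) = x" "Cod C (Ident C x) = x"
  using Ident_Hom[OF assms] by (auto simp: in_Hom)

lemma Comp_simps [simp]:
  assumes "f \<in> Arr C" "g \<in> Arr C" "Dom C g = Cod C f"
  shows "g \<cdot> f \<in> Arr C" "Dom C (g \<cdot> f) = Dom C f" "Cod C (g \<cdot> f) = Cod C g"
  using Comp_Hom[of f "Dom C f" "Cod C f" g "Cod C g"] assms by (auto simp: in_Hom)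

lemma Comp_assoc_Arr [simp]:
  assumes "f \<in> Arr C" "g \<in> Arr C" "h \<in> Arr C" "Dom C g = Cod C f" "Dom C h = Cod C g"
  shows "(h \<cdot> g) \<cdot> f = h \<cdot> g \<cdot> f"
  using Comp_assoc[of f "Dom C f" "Cod C f" g "Cod C g" h "Cod C h"] assms by (auto simp: in_Hom)

lemma Comp_Ident_left [simp]: "f \<in> Arr C \<Longrightarrow> Cod C f = y \<Longrightarrow> Ident C y \<cdot> f = f"
  using Ident_left[of f "Dom C f" y] by (auto simp: in_Hom)

lemma Comp_Ident_right [simp]: "f \<in> Arr C \<Longrightarrow> Dom C f = x \<Longrightarrow> f \<cdot> Ident C x = f"
  using Ident_right[of f x "Cod C f"] by (auto simp: in_Hom)

declare Dom_Obj [simp] Cod_Obj [simp]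

text \<open>Composites are normalised to the right, and there \<open>g \<cdot> f\<close> is no
  longer a subterm once something precedes \<open>f\<close>. This is the form in which an equation
  \<open>g \<cdot> f = k\<close> can still be applied.\<close>

lemma Comp_reassoc:
  assumes "g \<cdot> f = k" "f \<in> Arr C" "g \<in> Arr C" "Dom C g = Cod C f" "h \<in> Arr C" "Dom C f = Cod C h"
  shows "g \<cdot> f \<cdot> h = k \<cdot> h"
  using Comp_assoc_Arr[of h f g] assms by simp

lemma is_isoE:
  assumes "is_iso C f"
  obtains g where "f \<in> Arr C" "g \<in> Arr C" "Dom C g = Cod C f" "Cod C g = Dom C f"
    "g \<cdot> f = Ident C (Dom C f)" "f \<cdot> g = Ident C (Cod C f)"
  using assms by (auto simp: is_iso_def inverse_arrows_def in_Hom)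

lemma is_isoI:
  assumes "f \<in> Arr C" "g \<in> Arr C" "Dom C g = Cod C f" "Cod C g = Dom C f"
    "g \<cdot> f = Ident C (Dom C f)" "f \<cdot> g = Ident C (Cod C f)"
  shows "is_iso C f"
  using assms by (auto simp: is_iso_def inverse_arrows_def in_Hom)

lemma inverse_arrow:
  assumes "is_iso C f"
  shows "inverse_arrow C f \<in> Arr C" "Dom C (inverse_arrow C f) = Cod C f"
    "Cod C (inverse_arrow C f) = Dom C f"
    "inverse_arrow C f \<cdot> f = Ident C (Dom C f)" "f \<cdot> inverse_arrow C f = Ident C (Cod C f)"
proof -
  obtain g where g: "f \<in> Arr C" "g \<in> Arr C" "Dom C g = Cod C f" "Cod C g = Dom C f"
    "g \<cdot> f = Ident C (Dom C f)" "f \<cdot> g = Ident C (Cod C f)"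
    using assms by (rule is_isoE)
  have "h = g" if "inverse_arrows C f h" for h
  proof -
    from that have h: "h \<in> Arr C" "Dom C h = Cod C f" "Cod C h = Dom C f" "h \<cdot> f = Ident C (Dom C f)"
      by (auto simp: inverse_arrows_def in_Hom)
    have "h = h \<cdot> f \<cdot> g" using g h by simp
    also have "\<dots> = g" using Comp_reassoc[OF h(4), of g] g h by simp
    finally show ?thesis .
  qed
  moreover have "inverse_arrows C f g" using g by (simp add: inverse_arrows_def in_Hom)
  ultimately have "inverse_arrows C f (inverse_arrow C f)"
    unfolding inverse_arrow_def by (metis theI)
  then show "inverse_arrow C f \<in> Arr C" "Dom C (inverse_arrow C f) = Cod C f"
    "Cod C (inverse_arrow C f) = Dom C f"
    "inverse_arrow C f \<cdot> f = Ident C (Dom C f)" "f \<cdot> inverse_arrow C f = Ident C (Cod C f)"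
    by (auto simp: inverse_arrows_def in_Hom)
qed

lemma is_iso_Comp:
  assumes "is_iso C f" "is_iso C g" "Dom C g = Cod C f"
  shows "is_iso C (g \<cdot> f)"
proof -
  obtain f' where f: "f \<in> Arr C" "f' \<in> Arr C" "Dom C f' = Cod C f" "Cod C f' = Dom C f"
    "f' \<cdot> f = Ident C (Dom C f)" "f \<cdot> f' = Ident C (Cod C f)"
    using assms(1) by (rule is_isoE)
  obtain g' where g: "g \<in> Arr C" "g' \<in> Arr C" "Dom C g' = Cod C g" "Cod C g' = Dom C g"
    "g' \<cdot> g = Ident C (Dom C g)" "g \<cdot> g' = Ident C (Cod C g)"
    using assms(2) by (rule is_isoE)
  have "g' \<cdot> g \<cdot> f = f" "f \<cdot> f' \<cdot> g' = g'"
    using Comp_reassoc[OF g(5), of f] Comp_reassoc[OF f(6), of g'] f g assms(3) by simp_all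
  then show ?thesis
    by (intro is_isoI[of _ "f' \<cdot> g'"]) (use f g assms(3) in simp_all)
qed

lemma iso_cancel_right:
  assumes "is_iso C e" "f \<cdot> e = g \<cdot> e" "f \<in> Arr C" "g \<in> Arr C" "Dom C f = Cod C e" "Dom C g = Cod C e"
  shows "f = g"
proof -
  obtain e' where e: "e \<in> Arr C" "e' \<in> Arr C" "Dom C e' = Cod C e" "Cod C e' = Dom C e"
    "e \<cdot> e' = Ident C (Cod C e)"
    using assms(1) by (rule is_isoE)
  have "f \<cdot> e \<cdot> e' = g \<cdot> e \<cdot> e'"
    using Comp_reassoc[OF assms(2), of e'] e assms by simp
  then show ?thesis using e assms by simp
qed

lemma iso_cancel_left:
  assumes "is_iso C e" "e \<cdot> f = e \<cdot> g" "f \<in> Arr C" "g \<in> Arr C" "Cod C f = Dom C e" "Cod C g = Dom C e"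
  shows "f = g"
proof -
  obtain e' where e: "e \<in> Arr C" "e' \<in> Arr C" "Dom C e' = Cod C e" "Cod C e' = Dom C e"
    "e' \<cdot> e = Ident C (Dom C e)"
    using assms(1) by (rule is_isoE)
  have "f = e' \<cdot> e \<cdot> f" "g = e' \<cdot> e \<cdot> g"
    using Comp_reassoc[OF e(5), of f] Comp_reassoc[OF e(5), of g] e assms(1,3-6) by simp_all
  then show ?thesis unfolding assms(2) by (rule trans[OF _ sym])
qed

end

section \<open>Monoidal categories: interchange, naturality and coherence of the units\<close>

context monoidal_category
begin

declare TUnit_Obj [simp] TObj_Obj [simp] TArr_Ident [simp]

lemma TArr_simps [simp]:
  assumes "f \<in> Arr V" "g \<in> Arr V"
  shows "f \<boxdot> g \<in> Arr V" "Dom V (f \<boxdot> g) = Dom V f \<boxtimes> Dom V g" "Cod V (f \<boxdot> g) = Cod V f \<boxtimes> Cod V g"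
  using TArr_Hom[of f "Dom V f" "Cod V f" g "Dom V g" "Cod V g"] assms by (auto simp: in_Hom)

lemma TArr_interchange:
  assumes "f \<in> Arr V" "f' \<in> Arr V" "Dom V f' = Cod V f" "g \<in> Arr V" "g' \<in> Arr V" "Dom V g' = Cod V g"
  shows "(f' \<boxdot> g') \<cdot> (f \<boxdot> g) = (f' \<cdot> f) \<boxdot> (g' \<cdot> g)"
  using TArr_Comp[of f "Dom V f" "Cod V f" f' "Cod V f'" g "Dom V g" "Cod V g" g' "Cod V g'"] assms
  by (auto simp: in_Hom)

lemma whisker_right_Comp:
  assumes "f \<in> Arr V" "f' \<in> Arr V" "Dom V f' = Cod V f" "x \<in> Obj V"
  shows "(f' \<cdot> f) \<boxdot> Ident V x = (f' \<boxdot> Ident V x) \<cdot> (f \<boxdot> Ident V x)"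
  using assms by (simp add: TArr_interchange)

lemma whisker_left_Comp:
  assumes "f \<in> Arr V" "f' \<in> Arr V" "Dom V f' = Cod V f" "x \<in> Obj V"
  shows "Ident V x \<boxdot> (f' \<cdot> f) = (Ident V x \<boxdot> f') \<cdot> (Ident V x \<boxdot> f)"
  using assms by (simp add: TArr_interchange)

text \<open>Both composites are \<open>f \<boxdot> g\<close>. Used to move two arrows past each
  other when they act on different tensor factors.\<close>

lemma whisker_exchange:
  assumes "f \<in> Arr V" "g \<in> Arr V" "Dom V f = x" "Cod V f = x'" "Dom V g = y" "Cod V g = y'"
  shows "(Ident V x' \<boxdot> g) \<cdot> (f \<boxdot> Ident V y) = (f \<boxdot> Ident V y') \<cdot> (Ident V x \<boxdot> g)"
proof -
  have "x \<in> Obj V" "x' \<in> Obj V" "y \<in> Obj V" "y' \<in> Obj V" using assms by auto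
  then show ?thesis using assms by (simp add: TArr_interchange)
qed

lemma Assoc_simps [simp]:
  assumes "x \<in> Obj V" "y \<in> Obj V" "z \<in> Obj V"
  shows "Assoc V x y z \<in> Arr V" "Dom V (Assoc V x y z) = (x \<boxtimes> y) \<boxtimes> z"
    "Cod V (Assoc V x y z) = x \<boxtimes> (y \<boxtimes> z)"
  using Assoc_Hom[OF assms] by (auto simp: in_Hom)

lemma LUnit_simps [simp]:
  assumes "x \<in> Obj V"
  shows "LUnit V x \<in> Arr V" "Dom V (LUnit V x) = TUnit V \<boxtimes> x" "Cod V (LUnit V x) = x"
  using LUnit_Hom[OF assms] by (auto simp: in_Hom)

lemma RUnit_simps [simp]:
  assumes "x \<in> Obj V"
  shows "RUnit V x \<in> Arr V" "Dom V (RUnit V x) = x \<boxtimes> TUnit V" "Cod V (RUnit V x) = x"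
  using RUnit_Hom[OF assms] by (auto simp: in_Hom)

lemma is_iso_TArr:
  assumes "is_iso V f" "is_iso V g"
  shows "is_iso V (f \<boxdot> g)"
proof -
  obtain f' where f: "f \<in> Arr V" "f' \<in> Arr V" "Dom V f' = Cod V f" "Cod V f' = Dom V f"
    "f' \<cdot> f = Ident V (Dom V f)" "f \<cdot> f' = Ident V (Cod V f)"
    using assms(1) by (rule is_isoE)
  obtain g' where g: "g \<in> Arr V" "g' \<in> Arr V" "Dom V g' = Cod V g" "Cod V g' = Dom V g"
    "g' \<cdot> g = Ident V (Dom V g)" "g \<cdot> g' = Ident V (Cod V g)"
    using assms(2) by (rule is_isoE)
  show ?thesis
    by (rule is_isoI[of _ "f' \<boxdot> g'"]) (use f g in \<open>simp_all add: TArr_interchange\<close>)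
qed

lemma is_iso_Ident: "x \<in> Obj V \<Longrightarrow> is_iso V (Ident V x)"
  by (rule is_isoI[of _ "Ident V x"]) auto

lemmas iso_intros = is_iso_TArr is_iso_Ident is_iso_Comp Assoc_iso LUnit_iso RUnit_iso

lemma Assoc_nat:
  assumes "f \<in> Arr V" "g \<in> Arr V" "h \<in> Arr V" "Cod V f = x'" "Cod V g = y'" "Cod V h = z'"
  shows "Assoc V x' y' z' \<cdot> ((f \<boxdot> g) \<boxdot> h) = (f \<boxdot> (g \<boxdot> h)) \<cdot> Assoc V (Dom V f) (Dom V g) (Dom V h)"
  using Assoc_natural[of f "Dom V f" x' g "Dom V g" y' h "Dom V h" z'] assms by (auto simp: in_Hom)

lemma Assoc_nat':
  assumes "f \<in> Arr V" "g \<in> Arr V" "h \<in> Arr V" "Cod V f = x'" "Cod V g = y'" "Cod V h = z'"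
    "k \<in> Arr V" "Cod V k = (Dom V f \<boxtimes> Dom V g) \<boxtimes> Dom V h"
  shows "Assoc V x' y' z' \<cdot> ((f \<boxdot> g) \<boxdot> h) \<cdot> k
    = (f \<boxdot> (g \<boxdot> h)) \<cdot> Assoc V (Dom V f) (Dom V g) (Dom V h) \<cdot> k"
proof -
  have "x' \<in> Obj V" "y' \<in> Obj V" "z' \<in> Obj V" using assms by auto
  then show ?thesis using Comp_reassoc[OF Assoc_nat[OF assms(1-6)], of k] assms by simp
qed

lemma Assoc_nat_Ident:
  assumes "x \<in> Obj V" "y \<in> Obj V" "h \<in> Arr V" "Cod V h = z'"
  shows "Assoc V x y z' \<cdot> (Ident V (x \<boxtimes> y) \<boxdot> h)
    = (Ident V x \<boxdot> (Ident V y \<boxdot> h)) \<cdot> Assoc V x y (Dom V h)"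
  using Assoc_nat[of "Ident V x" "Ident V y" h x y z'] assms by simp

lemma Assoc_nat_Ident':
  assumes "x \<in> Obj V" "y \<in> Obj V" "h \<in> Arr V" "Cod V h = z'"
    "k \<in> Arr V" "Cod V k = (x \<boxtimes> y) \<boxtimes> Dom V h"
  shows "Assoc V x y z' \<cdot> (Ident V (x \<boxtimes> y) \<boxdot> h) \<cdot> k
    = (Ident V x \<boxdot> (Ident V y \<boxdot> h)) \<cdot> Assoc V x y (Dom V h) \<cdot> k"
  using Assoc_nat'[of "Ident V x" "Ident V y" h x y z' k] assms by simp

lemma LUnit_nat:
  assumes "f \<in> Arr V" "Cod V f = x'"
  shows "LUnit V x' \<cdot> (Ident V (TUnit V) \<boxdot> f) = f \<cdot> LUnit V (Dom V f)"
  using LUnit_natural[of f "Dom V f" x'] assms by (auto simp: in_Hom)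

lemma RUnit_nat:
  assumes "f \<in> Arr V" "Cod V f = x'"
  shows "RUnit V x' \<cdot> (f \<boxdot> Ident V (TUnit V)) = f \<cdot> RUnit V (Dom V f)"
  using RUnit_natural[of f "Dom V f" x'] assms by (auto simp: in_Hom)

text \<open>\<open>LUnit\<close> is a natural isomorphism from tensoring with the unit to the
  identity, so equations may be checked after tensoring with the unit. This makes room for the
  triangle axiom in the next coherence proof.\<close>

lemma TUnit_whisker_left_faithful:
  assumes "Ident V (TUnit V) \<boxdot> f = Ident V (TUnit V) \<boxdot> g" "f \<in> Arr V" "g \<in> Arr V"
    "Dom V f = Dom V g" "Cod V f = Cod V g"
  shows "f = g"
proof -
  have "f \<cdot> LUnit V (Dom V f) = g \<cdot> LUnit V (Dom V f)"
    using LUnit_nat[of f] LUnit_nat[of g] assms by simp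
  then show ?thesis by (rule iso_cancel_right[OF LUnit_iso, rotated]) (use assms in simp_all)
qed

lemma TUnit_whisker_right_faithful:
  assumes "f \<boxdot> Ident V (TUnit V) = g \<boxdot> Ident V (TUnit V)" "f \<in> Arr V" "g \<in> Arr V"
    "Dom V f = Dom V g" "Cod V f = Cod V g"
  shows "f = g"
proof -
  have "f \<cdot> RUnit V (Dom V f) = g \<cdot> RUnit V (Dom V f)"
    using RUnit_nat[of f] RUnit_nat[of g] assms by simp
  then show ?thesis by (rule iso_cancel_right[OF RUnit_iso, rotated]) (use assms in simp_all)
qed

text \<open>Kelly's argument that this coherence law follows from pentagon and triangle: after
  tensoring with the unit on the left, the isomorphism \<open>?e\<close> completes one side to a
  pentagon, and the triangle axiom applies at both of its ends.\<close>

lemma LUnit_tensor: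
  assumes [simp]: "x \<in> Obj V" "y \<in> Obj V"
  shows "LUnit V (x \<boxtimes> y) \<cdot> Assoc V (TUnit V) x y = LUnit V x \<boxdot> Ident V y"
proof -
  let ?I = "TUnit V"
  let ?e = "Assoc V ?I (?I \<boxtimes> x) y \<cdot> (Assoc V ?I ?I x \<boxdot> Ident V y)"
  have "(Ident V ?I \<boxdot> (LUnit V (x \<boxtimes> y) \<cdot> Assoc V ?I x y)) \<cdot> ?e
      = (Ident V ?I \<boxdot> LUnit V (x \<boxtimes> y)) \<cdot> Assoc V ?I ?I (x \<boxtimes> y) \<cdot> Assoc V (?I \<boxtimes> ?I) x y"
    by (simp add: whisker_left_Comp pentagon)
  also have "\<dots> = (RUnit V ?I \<boxdot> Ident V (x \<boxtimes> y)) \<cdot> Assoc V (?I \<boxtimes> ?I) x y"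
    using Comp_reassoc[OF triangle[of ?I "x \<boxtimes> y"], of "Assoc V (?I \<boxtimes> ?I) x y"] by simp
  also have "\<dots> = Assoc V ?I x y \<cdot> ((RUnit V ?I \<boxdot> Ident V x) \<boxdot> Ident V y)"
    by (simp add: Assoc_nat)
  also have "\<dots> = Assoc V ?I x y \<cdot> ((Ident V ?I \<boxdot> LUnit V x) \<boxdot> Ident V y) \<cdot> (Assoc V ?I ?I x \<boxdot> Ident V y)"
    by (simp add: whisker_right_Comp flip: triangle)
  also have "\<dots> = (Ident V ?I \<boxdot> (LUnit V x \<boxdot> Ident V y)) \<cdot> ?e"
    by (simp add: Assoc_nat')
  finally have "Ident V ?I \<boxdot> (LUnit V (x \<boxtimes> y) \<cdot> Assoc V ?I x y) = Ident V ?I \<boxdot> (LUnit V x \<boxdot> Ident V y)"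
    by (rule iso_cancel_right[rotated]) (auto intro!: iso_intros)
  then show ?thesis by (rule TUnit_whisker_left_faithful) simp_all
qed

text \<open>The mirror image of Kelly's argument: tensor with the unit on the right and cancel an
  associator on the left instead of the right.\<close>

lemma RUnit_tensor:
  assumes [simp]: "x \<in> Obj V" "y \<in> Obj V"
  shows "(Ident V x \<boxdot> RUnit V y) \<cdot> Assoc V x y (TUnit V) = RUnit V (x \<boxtimes> y)"
proof -
  let ?I = "TUnit V"
  have "Assoc V x y ?I \<cdot> (((Ident V x \<boxdot> RUnit V y) \<cdot> Assoc V x y ?I) \<boxdot> Ident V ?I)
      = Assoc V x y ?I \<cdot> ((Ident V x \<boxdot> RUnit V y) \<boxdot> Ident V ?I) \<cdot> (Assoc V x y ?I \<boxdot> Ident V ?I)"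
    by (simp add: whisker_right_Comp)
  also have "\<dots> = (Ident V x \<boxdot> (RUnit V y \<boxdot> Ident V ?I)) \<cdot> Assoc V x (y \<boxtimes> ?I) ?I \<cdot> (Assoc V x y ?I \<boxdot> Ident V ?I)"
    by (simp add: Assoc_nat')
  also have "\<dots> = (Ident V x \<boxdot> (Ident V y \<boxdot> LUnit V ?I)) \<cdot> (Ident V x \<boxdot> Assoc V y ?I ?I)
       \<cdot> Assoc V x (y \<boxtimes> ?I) ?I \<cdot> (Assoc V x y ?I \<boxdot> Ident V ?I)"
    by (simp add: whisker_left_Comp flip: triangle)
  also have "\<dots> = (Ident V x \<boxdot> (Ident V y \<boxdot> LUnit V ?I)) \<cdot> Assoc V x y (?I \<boxtimes> ?I) \<cdot> Assoc V (x \<boxtimes> y) ?I ?I"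
    by (simp add: pentagon)
  also have "\<dots> = Assoc V x y ?I \<cdot> (Ident V (x \<boxtimes> y) \<boxdot> LUnit V ?I) \<cdot> Assoc V (x \<boxtimes> y) ?I ?I"
    by (simp add: Assoc_nat_Ident')
  also have "\<dots> = Assoc V x y ?I \<cdot> (RUnit V (x \<boxtimes> y) \<boxdot> Ident V ?I)"
    by (simp add: triangle)
  finally have "((Ident V x \<boxdot> RUnit V y) \<cdot> Assoc V x y ?I) \<boxdot> Ident V ?I = RUnit V (x \<boxtimes> y) \<boxdot> Ident V ?I"
    by (rule iso_cancel_left[rotated]) (auto intro!: iso_intros)
  then show ?thesis by (rule TUnit_whisker_right_faithful) simp_all
qed

end

section \<open>Symmetries and the passage between left and right actions\<close>

context symmetric_monoidal_category
begin

lemma Sym_simps [simp]: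
  assumes "x \<in> Obj V" "y \<in> Obj V"
  shows "Sym V x y \<in> Arr V" "Dom V (Sym V x y) = x \<boxtimes> y" "Cod V (Sym V x y) = y \<boxtimes> x"
  using Sym_Hom[OF assms] by (auto simp: in_Hom)

declare Sym_Sym [simp]

lemma Sym_iso: "x \<in> Obj V \<Longrightarrow> y \<in> Obj V \<Longrightarrow> is_iso V (Sym V x y)"
  by (rule is_isoI[of _ "Sym V y x"]) auto

lemma Sym_nat:
  assumes "f \<in> Arr V" "g \<in> Arr V" "Cod V f = x'" "Cod V g = y'"
  shows "Sym V x' y' \<cdot> (f \<boxdot> g) = (g \<boxdot> f) \<cdot> Sym V (Dom V f) (Dom V g)"
  using Sym_natural[of f "Dom V f" x' g "Dom V g" y'] assms by (auto simp: in_Hom)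

lemma Sym_nat':
  assumes "f \<in> Arr V" "g \<in> Arr V" "Cod V f = x'" "Cod V g = y'"
    "k \<in> Arr V" "Cod V k = Dom V f \<boxtimes> Dom V g"
  shows "Sym V x' y' \<cdot> (f \<boxdot> g) \<cdot> k = (g \<boxdot> f) \<cdot> Sym V (Dom V f) (Dom V g) \<cdot> k"
proof -
  have "x' \<in> Obj V" "y' \<in> Obj V" using assms by auto
  then show ?thesis using Comp_reassoc[OF Sym_nat[OF assms(1-4)], of k] assms by simp
qed

lemma Sym_cancel [simp]:
  assumes "x \<in> Obj V" "y \<in> Obj V" "f \<in> Arr V" "Cod V f = x \<boxtimes> y"
  shows "Sym V y x \<cdot> Sym V x y \<cdot> f = f"
  using Comp_reassoc[OF Sym_Sym[of x y], of f] assms by simp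

lemma RUnit_Sym: "x \<in> Obj V \<Longrightarrow> RUnit V x \<cdot> Sym V (TUnit V) x = LUnit V x"
  by (simp flip: Sym_unit)

text \<open>Describes how \<open>z\<close> moves past a tensor product standing on its left, while
  the axiom moves a factor past one on its right. The axiom is used twice, for the triples
  \<open>z, x, y\<close> and \<open>x, z, y\<close>; \<open>Sym_Sym\<close> removes the surplus
  symmetries.\<close>

lemma hexagon_transposed:
  assumes [simp]: "x \<in> Obj V" "y \<in> Obj V" "z \<in> Obj V"
  shows "(Ident V z \<boxdot> Sym V x y) \<cdot> Sym V (x \<boxtimes> y) z
    = Assoc V z y x \<cdot> Sym V x (z \<boxtimes> y) \<cdot> (Ident V x \<boxdot> Sym V y z) \<cdot> Assoc V x y z"
proof -
  let ?R = "Assoc V z y x \<cdot> Sym V x (z \<boxtimes> y) \<cdot> (Ident V x \<boxdot> Sym V y z) \<cdot> Assoc V x y z"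
  let ?e = "Assoc V z x y \<cdot> (Sym V x z \<boxdot> Ident V y)"
  have 1: "(Ident V x \<boxdot> Sym V y z) \<cdot> (Ident V x \<boxdot> Sym V z y) = Ident V (x \<boxtimes> (z \<boxtimes> y))"
    "(Sym V z x \<boxdot> Ident V y) \<cdot> (Sym V x z \<boxdot> Ident V y) = Ident V ((x \<boxtimes> z) \<boxtimes> y)"
    by (simp_all flip: whisker_left_Comp whisker_right_Comp)
  have "(?R \<cdot> Sym V z (x \<boxtimes> y)) \<cdot> ?e = Assoc V z y x \<cdot> Sym V x (z \<boxtimes> y) \<cdot> (Ident V x \<boxdot> Sym V y z)
     \<cdot> (Assoc V x y z \<cdot> Sym V z (x \<boxtimes> y) \<cdot> Assoc V z x y) \<cdot> (Sym V x z \<boxdot> Ident V y)"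
    by simp
  \<comment> \<open>Reassociation is switched off at first, so that the bracketed group still
    matches the left side of \<open>hexagon\<close>.\<close>
  also have "\<dots> = Assoc V z y x \<cdot> Sym V x (z \<boxtimes> y) \<cdot> Assoc V x z y"
    by (simp add: hexagon 1 Comp_reassoc[OF 1(1)] del: Comp_assoc_Arr)
       (simp add: hexagon 1 Comp_reassoc[OF 1(1)])
  also have "\<dots> = (Ident V z \<boxdot> Sym V x y) \<cdot> ?e" by (simp add: hexagon)
  finally have "?R \<cdot> Sym V z (x \<boxtimes> y) = Ident V z \<boxdot> Sym V x y"
    by (rule iso_cancel_right[rotated]) (auto intro!: iso_intros Sym_iso)
  then have "(?R \<cdot> Sym V z (x \<boxtimes> y)) \<cdot> Sym V (x \<boxtimes> y) z = (Ident V z \<boxdot> Sym V x y) \<cdot> Sym V (x \<boxtimes> y) z"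
    by simp
  then show ?thesis by simp
qed

text \<open>With \<open>m, n, l\<close> the components of a left action and \<open>k\<close> a composition of \<open>\<C>\<close>: left modules over \<open>\<C>\<close>
  are right modules over the opposite category.\<close>

lemma left_assoc_iff_right_assoc:
  assumes [simp]: "x \<in> Obj V" "u \<in> Obj V" "w \<in> Obj V"
    and m: "m \<in> Hom V (u \<boxtimes> x) y" "n \<in> Hom V (w \<boxtimes> y) z" "k \<in> Hom V (w \<boxtimes> u) t" "l \<in> Hom V (t \<boxtimes> x) z"
  shows "l \<cdot> (k \<boxdot> Ident V x) = n \<cdot> (Ident V w \<boxdot> m) \<cdot> Assoc V w u x \<longleftrightarrow>
    (n \<cdot> Sym V y w) \<cdot> ((m \<cdot> Sym V x u) \<boxdot> Ident V w)
      = (l \<cdot> Sym V x t) \<cdot> (Ident V x \<boxdot> (k \<cdot> Sym V u w)) \<cdot> Assoc V x u w" (is "?L \<longleftrightarrow> ?R")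
proof -
  have m' [simp]: "m \<in> Arr V" "n \<in> Arr V" "k \<in> Arr V" "l \<in> Arr V" "Dom V m = u \<boxtimes> x" "Cod V m = y"
    "Dom V n = w \<boxtimes> y" "Cod V n = z" "Dom V k = w \<boxtimes> u" "Cod V k = t" "Dom V l = t \<boxtimes> x" "Cod V l = z"
    using m by (auto simp: in_Hom)
  have [simp]: "y \<in> Obj V" "z \<in> Obj V" "t \<in> Obj V"
    using Cod_Obj[of m] Cod_Obj[of n] Cod_Obj[of k] by simp_all
  \<comment> \<open>\<open>?e\<close> is the isomorphism reversing the order of the three factors.
    Each side of the right law is the corresponding side of the left law composed with
    \<open>?e\<close>, so the two laws differ by a cancellable factor.\<close>
  let ?e = "Sym V x (w \<boxtimes> u) \<cdot> (Ident V x \<boxdot> Sym V u w) \<cdot> Assoc V x u w"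
  have "(n \<cdot> Sym V y w) \<cdot> ((m \<cdot> Sym V x u) \<boxdot> Ident V w)
      = n \<cdot> (Ident V w \<boxdot> m) \<cdot> (Ident V w \<boxdot> Sym V x u) \<cdot> Sym V (x \<boxtimes> u) w"
    by (simp add: Sym_nat whisker_left_Comp)
  also have "\<dots> = (n \<cdot> (Ident V w \<boxdot> m) \<cdot> Assoc V w u x) \<cdot> ?e"
    by (simp add: hexagon_transposed)
  finally have 1: "(n \<cdot> Sym V y w) \<cdot> ((m \<cdot> Sym V x u) \<boxdot> Ident V w)
    = (n \<cdot> (Ident V w \<boxdot> m) \<cdot> Assoc V w u x) \<cdot> ?e" .
  have "(l \<cdot> Sym V x t) \<cdot> (Ident V x \<boxdot> (k \<cdot> Sym V u w)) \<cdot> Assoc V x u w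
      = l \<cdot> (Sym V x t \<cdot> (Ident V x \<boxdot> k)) \<cdot> (Ident V x \<boxdot> Sym V u w) \<cdot> Assoc V x u w"
    by (simp add: whisker_left_Comp)
  also have "\<dots> = (l \<cdot> (k \<boxdot> Ident V x)) \<cdot> ?e" by (simp add: Sym_nat Sym_nat')
  finally have 2: "(l \<cdot> Sym V x t) \<cdot> (Ident V x \<boxdot> (k \<cdot> Sym V u w)) \<cdot> Assoc V x u w
    = (l \<cdot> (k \<boxdot> Ident V x)) \<cdot> ?e" .
  have e: "is_iso V ?e" by (auto intro!: iso_intros Sym_iso)
  show ?thesis
  proof
    assume ?L
    then show ?R unfolding 1 2 by simp
  next
    assume ?R
    then have "(l \<cdot> (k \<boxdot> Ident V x)) \<cdot> ?e = (n \<cdot> (Ident V w \<boxdot> m) \<cdot> Assoc V w u x) \<cdot> ?e"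
      unfolding 1 2 by (rule sym)
    then show ?L by (rule iso_cancel_right[OF e]) simp_all
  qed
qed

end

section \<open>Modules as objects with an action\<close>

context monoidal_category
begin

text \<open>Enriched naturality and enriched composition contain inverse unit constraints, which
  uncurrying leaves whiskered. This lemma and \<open>triangle_inverse\<close> erase them.\<close>

lemma LUnit_tensor_inverse:
  assumes [simp]: "x \<in> Obj V" "y \<in> Obj V"
  shows "LUnit V (x \<boxtimes> y) \<cdot> Assoc V (TUnit V) x y \<cdot> (inverse_arrow V (LUnit V x) \<boxdot> Ident V y) = Ident V (x \<boxtimes> y)"
proof -
  note [simp] = inverse_arrow[OF LUnit_iso[OF assms(1)]]
  have "LUnit V (x \<boxtimes> y) \<cdot> Assoc V (TUnit V) x y \<cdot> (inverse_arrow V (LUnit V x) \<boxdot> Ident V y)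
    = (LUnit V x \<boxdot> Ident V y) \<cdot> (inverse_arrow V (LUnit V x) \<boxdot> Ident V y)"
    by (rule Comp_reassoc[OF LUnit_tensor]) simp_all
  then show ?thesis by (simp flip: whisker_right_Comp)
qed

lemma triangle_inverse:
  assumes [simp]: "x \<in> Obj V" "y \<in> Obj V"
  shows "(Ident V x \<boxdot> LUnit V y) \<cdot> Assoc V x (TUnit V) y \<cdot> (inverse_arrow V (RUnit V x) \<boxdot> Ident V y)
    = Ident V (x \<boxtimes> y)"
proof -
  note [simp] = inverse_arrow[OF RUnit_iso[OF assms(1)]]
  have "(Ident V x \<boxdot> LUnit V y) \<cdot> Assoc V x (TUnit V) y \<cdot> (inverse_arrow V (RUnit V x) \<boxdot> Ident V y)
    = (RUnit V x \<boxdot> Ident V y) \<cdot> (inverse_arrow V (RUnit V x) \<boxdot> Ident V y)"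
    by (rule Comp_reassoc[OF triangle]) simp_all
  then show ?thesis by (simp flip: whisker_right_Comp)
qed

end

section \<open>Transposition across the tensor-hom adjunction and the self-enrichment\<close>

context symmetric_closed_monoidal_category
begin

declare IHom_Obj [simp]

lemma Eval_simps [simp]:
  assumes "x \<in> Obj V" "y \<in> Obj V"
  shows "Eval V x y \<in> Arr V" "Dom V (Eval V x y) = IHom V x y \<boxtimes> x" "Cod V (Eval V x y) = y"
  using Eval_Hom[OF assms] by (auto simp: in_Hom)

lemma uncurry_simps [simp]:
  assumes "x \<in> Obj V" "y \<in> Obj V" "g \<in> Arr V" "Cod V g = IHom V x y"
  shows "uncurry_arrow V x y g \<in> Arr V" "Dom V (uncurry_arrow V x y g) = Dom V g \<boxtimes> x"
    "Cod V (uncurry_arrow V x y g) = y"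
  using assms by (simp_all add: uncurry_arrow_def)

lemma curry_simps [simp]:
  assumes "x \<in> Obj V" "z \<in> Obj V" "f \<in> Arr V" "Dom V f = z \<boxtimes> x" "Cod V f = y"
  shows "curry_arrow V z x y f \<in> Arr V" "Dom V (curry_arrow V z x y f) = z"
    "Cod V (curry_arrow V z x y f) = IHom V x y"
    "uncurry_arrow V x y (curry_arrow V z x y f) = f"
proof -
  have "\<exists>!g. g \<in> Hom V z (IHom V x y) \<and> Eval V x y \<cdot> (g \<boxdot> Ident V x) = f"
    using assms by (intro Eval_universal) (auto simp: in_Hom)
  from theI'[OF this] show "curry_arrow V z x y f \<in> Arr V" "Dom V (curry_arrow V z x y f) = z"
    "Cod V (curry_arrow V z x y f) = IHom V x y"
    "uncurry_arrow V x y (curry_arrow V z x y f) = f"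
    by (simp_all add: curry_arrow_def uncurry_arrow_def in_Hom)
qed

text \<open>The uniqueness half of \<open>Eval_universal\<close>: the tool by which equations
  between arrows into inner homs are reduced to ordinary ones.\<close>

lemma uncurry_inject:
  assumes "uncurry_arrow V x y f = uncurry_arrow V x y g" "x \<in> Obj V" "y \<in> Obj V"
    "f \<in> Arr V" "g \<in> Arr V" "Cod V f = IHom V x y" "Cod V g = IHom V x y" "Dom V f = Dom V g"
  shows "f = g"
proof -
  have "\<exists>!h. h \<in> Hom V (Dom V f) (IHom V x y) \<and> Eval V x y \<cdot> (h \<boxdot> Ident V x) = uncurry_arrow V x y f"
    using assms(2-) by (intro Eval_universal) (auto simp: in_Hom)
  then show ?thesis using assms by (auto simp: in_Hom uncurry_arrow_def)
qed

lemma uncurry_Comp: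
  assumes "x \<in> Obj V" "y \<in> Obj V" "f \<in> Arr V" "g \<in> Arr V" "Cod V g = IHom V x y" "Dom V g = Cod V f"
  shows "uncurry_arrow V x y (g \<cdot> f) = uncurry_arrow V x y g \<cdot> (f \<boxdot> Ident V x)"
  using assms by (simp add: uncurry_arrow_def whisker_right_Comp)

lemma self_enriched_simps [simp]:
  "EObj (self_enriched V) = Obj V" "EHom (self_enriched V) = IHom V"
  by (simp_all add: self_enriched_def)

lemma self_EComp_simps [simp]:
  assumes "x \<in> Obj V" "y \<in> Obj V" "z \<in> Obj V"
  shows "EComp (self_enriched V) x y z \<in> Arr V"
    "Dom V (EComp (self_enriched V) x y z) = IHom V y z \<boxtimes> IHom V x y"
    "Cod V (EComp (self_enriched V) x y z) = IHom V x z"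
    "uncurry_arrow V x z (EComp (self_enriched V) x y z)
      = Eval V y z \<cdot> (Ident V (IHom V y z) \<boxdot> Eval V x y) \<cdot> Assoc V (IHom V y z) (IHom V x y) x"
  using assms by (simp_all add: self_enriched_def)

lemma self_EId_simps [simp]:
  assumes "x \<in> Obj V"
  shows "EId (self_enriched V) x \<in> Arr V" "Dom V (EId (self_enriched V) x) = TUnit V"
    "Cod V (EId (self_enriched V) x) = IHom V x x"
    "uncurry_arrow V x x (EId (self_enriched V) x) = LUnit V x"
  using assms by (simp_all add: self_enriched_def)

text \<open>Composition in the self-enrichment is evaluation carried out twice; naturality of the
  associator and interchange bring \<open>f\<close> and \<open>g\<close> next to the evaluation that
  consumes them. This turns functoriality into associativity of an action.\<close>

lemma uncurry_self_EComp:
  assumes [simp]: "x \<in> Obj V" "y \<in> Obj V" "z \<in> Obj V" "f \<in> Arr V" "g \<in> Arr V"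
    "Cod V f = IHom V y z" "Cod V g = IHom V x y"
  shows "uncurry_arrow V x z (EComp (self_enriched V) x y z \<cdot> (f \<boxdot> g))
    = uncurry_arrow V y z f \<cdot> (Ident V (Dom V f) \<boxdot> uncurry_arrow V x y g) \<cdot> Assoc V (Dom V f) (Dom V g) x"
proof -
  have "uncurry_arrow V x z (EComp (self_enriched V) x y z \<cdot> (f \<boxdot> g))
      = Eval V y z \<cdot> (Ident V (IHom V y z) \<boxdot> Eval V x y) \<cdot> (f \<boxdot> (g \<boxdot> Ident V x)) \<cdot> Assoc V (Dom V f) (Dom V g) x"
    by (simp add: uncurry_Comp Assoc_nat)
  also have "\<dots> = Eval V y z \<cdot> ((Ident V (IHom V y z) \<boxdot> Eval V x y) \<cdot> (f \<boxdot> (g \<boxdot> Ident V x)))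
      \<cdot> Assoc V (Dom V f) (Dom V g) x"
    by simp
  also have "(Ident V (IHom V y z) \<boxdot> Eval V x y) \<cdot> (f \<boxdot> (g \<boxdot> Ident V x))
      = (f \<boxdot> Ident V y) \<cdot> (Ident V (Dom V f) \<boxdot> uncurry_arrow V x y g)"
    by (simp add: TArr_interchange) (simp add: uncurry_arrow_def)
  finally show ?thesis by (simp add: uncurry_arrow_def)
qed

end

section \<open>Modules and module maps in uncurried form\<close>

locale enriched_over_closed =
  symmetric_closed_monoidal_category V + enriched_category V C
  for V :: "('o, 'm, 'z) precosmos_scheme" (structure) and C :: "('c, 'o, 'm) ecat"
begin

declare EHom_Obj [simp]

lemma EComp_simps [simp]:
  assumes "x \<in> EObj C" "y \<in> EObj C" "z \<in> EObj C"
  shows "EComp C x y z \<in> Arr V" "Dom V (EComp C x y z) = EHom C y z \<boxtimes> EHom C x y"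
    "Cod V (EComp C x y z) = EHom C x z"
  using EComp_Hom[OF assms] by (auto simp: in_Hom)

lemma EId_simps [simp]:
  assumes "x \<in> EObj C"
  shows "EId C x \<in> Arr V" "Dom V (EId C x) = TUnit V" "Cod V (EId C x) = EHom C x x"
  using EId_Hom[OF assms] by (auto simp: in_Hom)

text \<open>The functor axioms after uncurrying. Values outside \<open>EObj C\<close> are left
  arbitrary; \<open>action_module\<close> restricts them, as equality of enriched functors
  demands.\<close>

definition is_action :: "('c \<Rightarrow> 'o) \<Rightarrow> ('c \<Rightarrow> 'c \<Rightarrow> 'm) \<Rightarrow> bool" where
  "is_action X \<mu> \<longleftrightarrow> (\<forall>x\<in>EObj C. X x \<in> Obj V) \<and>
     (\<forall>x\<in>EObj C. \<forall>y\<in>EObj C. \<mu> x y \<in> Hom V (EHom C x y \<boxtimes> X x) (X y)) \<and>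
     (\<forall>x\<in>EObj C. \<forall>y\<in>EObj C. \<forall>z\<in>EObj C. \<mu> x z \<cdot> (EComp C x y z \<boxdot> Ident V (X x))
        = \<mu> y z \<cdot> (Ident V (EHom C y z) \<boxdot> \<mu> x y) \<cdot> Assoc V (EHom C y z) (EHom C x y) (X x)) \<and>
     (\<forall>x\<in>EObj C. \<mu> x x \<cdot> (EId C x \<boxdot> Ident V (X x)) = LUnit V (X x))"

lemma is_actionD:
  assumes "is_action X \<mu>" "x \<in> EObj C"
  shows "X x \<in> Obj V" "\<mu> x x \<cdot> (EId C x \<boxdot> Ident V (X x)) = LUnit V (X x)"
    "\<And>y. y \<in> EObj C \<Longrightarrow> \<mu> x y \<in> Arr V"
    "\<And>y. y \<in> EObj C \<Longrightarrow> Dom V (\<mu> x y) = EHom C x y \<boxtimes> X x"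
    "\<And>y. y \<in> EObj C \<Longrightarrow> Cod V (\<mu> x y) = X y"
    "\<And>y z. y \<in> EObj C \<Longrightarrow> z \<in> EObj C \<Longrightarrow> \<mu> x z \<cdot> (EComp C x y z \<boxdot> Ident V (X x))
        = \<mu> y z \<cdot> (Ident V (EHom C y z) \<boxdot> \<mu> x y) \<cdot> Assoc V (EHom C y z) (EHom C x y) (X x)"
  using assms unfolding is_action_def in_Hom by auto

definition act :: "('c, 'o, 'm) efun \<Rightarrow> 'c \<Rightarrow> 'c \<Rightarrow> 'm" where
  "act M x y = uncurry_arrow V (FObj M x) (FObj M y) (FMap M x y)"

definition action_module :: "('c \<Rightarrow> 'o) \<Rightarrow> ('c \<Rightarrow> 'c \<Rightarrow> 'm) \<Rightarrow> ('c, 'o, 'm) efun" where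
  "action_module X \<mu> = \<lparr>FObj = (\<lambda>x\<in>EObj C. X x),
     FMap = (\<lambda>x\<in>EObj C. \<lambda>y\<in>EObj C. curry_arrow V (EHom C x y) (X x) (X y) (\<mu> x y))\<rparr>"

lemma Mod_simps [simp]:
  "Obj (Mod V C) = {M. enriched_functor V C (self_enriched V) M}"
  "Arr (Mod V C) = {t. enriched_natural V C (self_enriched V) t}"
  "Dom (Mod V C) = Source" "Cod (Mod V C) = Target"
  by (simp_all add: Mod_def enriched_functor_category_def)

text \<open>Uncurrying \<open>FMap_EComp\<close> gives the associativity law and uncurrying
  \<open>FMap_EId\<close> the unit law.\<close>

lemma module_action:
  assumes "M \<in> Obj (Mod V C)"
  shows "is_action (FObj M) (act M)"
proof -
  interpret F: enriched_functor V C "self_enriched V" M using assms by simp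
  have X [simp]: "FObj M x \<in> Obj V" if "x \<in> EObj C" for x using F.FObj_EObj that by auto
  have F [simp]: "FMap M x y \<in> Arr V" "Dom V (FMap M x y) = EHom C x y"
    "Cod V (FMap M x y) = IHom V (FObj M x) (FObj M y)" if "x \<in> EObj C" "y \<in> EObj C" for x y
    using F.FMap_Hom[OF that] by (auto simp: in_Hom)
  have "act M x z \<cdot> (EComp C x y z \<boxdot> Ident V (FObj M x))
        = act M y z \<cdot> (Ident V (EHom C y z) \<boxdot> act M x y) \<cdot> Assoc V (EHom C y z) (EHom C x y) (FObj M x)"
    if [simp]: "x \<in> EObj C" "y \<in> EObj C" "z \<in> EObj C" for x y z
    using arg_cong[OF F.FMap_EComp[OF that], of "uncurry_arrow V (FObj M x) (FObj M z)"]
    by (simp add: uncurry_Comp[where f="EComp C x y z"] uncurry_self_EComp act_def)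
  moreover have "act M x x \<cdot> (EId C x \<boxdot> Ident V (FObj M x)) = LUnit V (FObj M x)"
    if [simp]: "x \<in> EObj C" for x
    using arg_cong[OF F.FMap_EId[OF that], of "uncurry_arrow V (FObj M x) (FObj M x)"]
    by (simp add: uncurry_Comp act_def)
  ultimately show ?thesis
    unfolding is_action_def by (auto simp: act_def in_Hom)
qed

lemma module_simps [simp]:
  assumes "enriched_functor V C (self_enriched V) M" "x \<in> EObj C"
  shows "FObj M x \<in> Obj V" "\<And>y. y \<in> EObj C \<Longrightarrow> act M x y \<in> Arr V"
    "\<And>y. y \<in> EObj C \<Longrightarrow> Dom V (act M x y) = EHom C x y \<boxtimes> FObj M x"
    "\<And>y. y \<in> EObj C \<Longrightarrow> Cod V (act M x y) = FObj M y"
  using module_action[of M] assms by (auto simp: is_actionD)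

lemma action_module_simps [simp]:
  assumes "x \<in> EObj C"
  shows "FObj (action_module X \<mu>) x = X x"
    "\<And>y. is_action X \<mu> \<Longrightarrow> y \<in> EObj C \<Longrightarrow> act (action_module X \<mu>) x y = \<mu> x y"
  using assms by (simp_all add: action_module_def act_def is_actionD)

lemma action_module_Mod:
  assumes "is_action X \<mu>"
  shows "enriched_functor V C (self_enriched V) (action_module X \<mu>)"
proof (rule enriched_functor.intro)
  note [simp] = is_actionD[OF assms]
  let ?M = "action_module X \<mu>"
  have F [simp]: "FObj ?M x = X x" "\<And>y. y \<in> EObj C \<Longrightarrow> FMap ?M x y = curry_arrow V (EHom C x y) (X x) (X y) (\<mu> x y)"
    if "x \<in> EObj C" for x
    using that by (simp_all add: action_module_def)
  show "FObj ?M \<in> EObj C \<rightarrow>\<^sub>E EObj (self_enriched V)"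
    by (auto simp: action_module_def)
  show "FMap ?M \<in> EObj C \<rightarrow>\<^sub>E (EObj C \<rightarrow>\<^sub>E Arr V)"
    by (auto simp: action_module_def)
  show "FMap ?M x y \<in> Hom V (EHom C x y) (EHom (self_enriched V) (FObj ?M x) (FObj ?M y))"
    if "x \<in> EObj C" "y \<in> EObj C" for x y
    using that by (auto simp: in_Hom)
  show "FMap ?M x z \<cdot> EComp C x y z = EComp (self_enriched V) (FObj ?M x) (FObj ?M y) (FObj ?M z)
      \<cdot> (FMap ?M y z \<boxdot> FMap ?M x y)" if [simp]: "x \<in> EObj C" "y \<in> EObj C" "z \<in> EObj C" for x y z
    by (rule uncurry_inject[of "X x" "X z"]) (simp_all add: uncurry_Comp[where f="EComp C x y z"] uncurry_self_EComp)
  show "FMap ?M x x \<cdot> EId C x = EId (self_enriched V) (FObj ?M x)" if [simp]: "x \<in> EObj C" for x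
    by (rule uncurry_inject[of "X x" "X x"]) (simp_all add: uncurry_Comp)
qed

definition equivariant ::
  "('c, 'o, 'm) efun \<Rightarrow> ('c, 'o, 'm) efun \<Rightarrow> ('c \<Rightarrow> 'm) \<Rightarrow> bool" where
  "equivariant M N \<tau> \<longleftrightarrow> (\<forall>x\<in>EObj C. \<tau> x \<in> Hom V (FObj M x) (FObj N x)) \<and>
     (\<forall>x\<in>EObj C. \<forall>y\<in>EObj C. \<tau> y \<cdot> act M x y = act N x y \<cdot> (Ident V (EHom C x y) \<boxdot> \<tau> x))"

text \<open>A component of an enriched transformation is an element
  \<open>I \<rightarrow> \<A>(M x, N x)\<close>; this is the ordinary arrow
  \<open>M x \<rightarrow> N x\<close> that it names. \<open>family_nat\<close> goes back.\<close>

definition cmp :: "('c, 'o, 'm) enat \<Rightarrow> 'c \<Rightarrow> 'm" where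
  "cmp t x = uncurry_arrow V (FObj (Source t) x) (FObj (Target t) x) (Component t x)
     \<cdot> inverse_arrow V (LUnit V (FObj (Source t) x))"

definition family_nat ::
  "('c, 'o, 'm) efun \<Rightarrow> ('c, 'o, 'm) efun \<Rightarrow> ('c \<Rightarrow> 'm) \<Rightarrow> ('c, 'o, 'm) enat" where
  "family_nat M N \<tau> = \<lparr>Source = M, Target = N, Component = (\<lambda>x\<in>EObj C.
     curry_arrow V (TUnit V) (FObj M x) (FObj N x) (\<tau> x \<cdot> LUnit V (FObj M x)))\<rparr>"

text \<open>After uncurrying, the inverse unit constraints of the two sides cancel by
  \<open>LUnit_tensor_inverse\<close> and \<open>triangle_inverse\<close> respectively, and
  uncurrying is injective. The families \<open>c\<close> and \<open>\<tau>\<close> are linked only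
  by \<open>u\<close>, so that one equivalence serves both directions: from a transformation to an
  equivariant family and back.\<close>

lemma natural_iff_equivariant:
  assumes M [simp]: "enriched_functor V C (self_enriched V) M"
    and N [simp]: "enriched_functor V C (self_enriched V) N"
    and x [simp]: "x \<in> EObj C" and y [simp]: "y \<in> EObj C"
    and \<tau>: "\<And>x. x \<in> EObj C \<Longrightarrow> \<tau> x \<in> Hom V (FObj M x) (FObj N x)"
    and c: "\<And>x. x \<in> EObj C \<Longrightarrow> c x \<in> Hom V (TUnit V) (IHom V (FObj M x) (FObj N x))"
    and u: "\<And>x. x \<in> EObj C \<Longrightarrow> uncurry_arrow V (FObj M x) (FObj N x) (c x) = \<tau> x \<cdot> LUnit V (FObj M x)"
  shows "EComp (self_enriched V) (FObj M x) (FObj M y) (FObj N y)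
            \<cdot> (c y \<boxdot> FMap M x y) \<cdot> inverse_arrow V (LUnit V (EHom C x y))
        = EComp (self_enriched V) (FObj M x) (FObj N x) (FObj N y)
            \<cdot> (FMap N x y \<boxdot> c x) \<cdot> inverse_arrow V (RUnit V (EHom C x y))
     \<longleftrightarrow> \<tau> y \<cdot> act M x y = act N x y \<cdot> (Ident V (EHom C x y) \<boxdot> \<tau> x)" (is "?l = ?r \<longleftrightarrow> _")
proof -
  let ?u = "uncurry_arrow V (FObj M x) (FObj N y)" and ?U = "EHom C x y"
  have [simp]: "\<tau> x \<in> Arr V" "Dom V (\<tau> x) = FObj M x" "Cod V (\<tau> x) = FObj N x"
    "\<tau> y \<in> Arr V" "Dom V (\<tau> y) = FObj M y" "Cod V (\<tau> y) = FObj N y"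
    "c x \<in> Arr V" "Dom V (c x) = TUnit V" "Cod V (c x) = IHom V (FObj M x) (FObj N x)"
    "c y \<in> Arr V" "Dom V (c y) = TUnit V" "Cod V (c y) = IHom V (FObj M y) (FObj N y)"
    using \<tau>[OF x] \<tau>[OF y] c[OF x] c[OF y] by (auto simp: in_Hom)
  have [simp]: "FMap M x y \<in> Arr V" "Dom V (FMap M x y) = ?U" "Cod V (FMap M x y) = IHom V (FObj M x) (FObj M y)"
    "FMap N x y \<in> Arr V" "Dom V (FMap N x y) = ?U" "Cod V (FMap N x y) = IHom V (FObj N x) (FObj N y)"
    using enriched_functor.FMap_Hom[OF M x y] enriched_functor.FMap_Hom[OF N x y] by (auto simp: in_Hom)
  note [simp] = inverse_arrow(1-3)[OF LUnit_iso[of ?U]] inverse_arrow(1-3)[OF RUnit_iso[of ?U]]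
  have "?u ?l = ?u (EComp (self_enriched V) (FObj M x) (FObj M y) (FObj N y) \<cdot> (c y \<boxdot> FMap M x y))
      \<cdot> (inverse_arrow V (LUnit V ?U) \<boxdot> Ident V (FObj M x))"
    by (subst uncurry_Comp[symmetric]) simp_all
  also have "\<dots> = \<tau> y \<cdot> (LUnit V (FObj M y) \<cdot> (Ident V (TUnit V) \<boxdot> act M x y))
      \<cdot> Assoc V (TUnit V) ?U (FObj M x) \<cdot> (inverse_arrow V (LUnit V ?U) \<boxdot> Ident V (FObj M x))"
    by (simp add: uncurry_self_EComp u flip: act_def)
  also have "LUnit V (FObj M y) \<cdot> (Ident V (TUnit V) \<boxdot> act M x y)
      = act M x y \<cdot> LUnit V (?U \<boxtimes> FObj M x)"
    by (simp add: LUnit_nat)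
  finally have l: "?u ?l = \<tau> y \<cdot> act M x y"
    by (simp add: LUnit_tensor_inverse)
  have "?u ?r = ?u (EComp (self_enriched V) (FObj M x) (FObj N x) (FObj N y) \<cdot> (FMap N x y \<boxdot> c x))
      \<cdot> (inverse_arrow V (RUnit V ?U) \<boxdot> Ident V (FObj M x))"
    by (subst uncurry_Comp[symmetric]) simp_all
  also have "\<dots> = act N x y \<cdot> (Ident V ?U \<boxdot> \<tau> x)"
    by (simp add: uncurry_self_EComp u whisker_left_Comp triangle_inverse flip: act_def)
  finally have r: "?u ?r = act N x y \<cdot> (Ident V ?U \<boxdot> \<tau> x)" .
  show ?thesis
    unfolding l[symmetric] r[symmetric]
    by (intro iffI arg_cong[of ?l ?r ?u]) (assumption, erule uncurry_inject, simp_all)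
qed

lemma Mod_HomD:
  assumes "t \<in> Hom (Mod V C) M N"
  shows "enriched_functor V C (self_enriched V) M" "enriched_functor V C (self_enriched V) N"
    "equivariant M N (cmp t)" "Component t \<in> EObj C \<rightarrow>\<^sub>E Arr V"
    "\<And>x. x \<in> EObj C \<Longrightarrow> Component t x \<in> Hom V (TUnit V) (IHom V (FObj M x) (FObj N x))"
    "\<And>x. x \<in> EObj C \<Longrightarrow> uncurry_arrow V (FObj M x) (FObj N x) (Component t x) = cmp t x \<cdot> LUnit V (FObj M x)"
proof -
  have M: "Source t = M" and N: "Target t = N" and t: "enriched_natural V C (self_enriched V) t"
    using assms by (auto simp: in_Hom)
  note n = enriched_natural.Component_natural[OF t, unfolded M N]
  show MM [simp]: "enriched_functor V C (self_enriched V) M" "enriched_functor V C (self_enriched V) N"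
    and "Component t \<in> EObj C \<rightarrow>\<^sub>E Arr V"
    and c: "\<And>x. x \<in> EObj C \<Longrightarrow> Component t x \<in> Hom V (TUnit V) (IHom V (FObj M x) (FObj N x))"
    using enriched_natural.Source_functor[OF t] enriched_natural.Target_functor[OF t]
      enriched_natural.Component_Arr[OF t] enriched_natural.Component_Hom[OF t] M N by auto
  have u: "uncurry_arrow V (FObj M x) (FObj N x) (Component t x) = cmp t x \<cdot> LUnit V (FObj M x)"
    and h: "cmp t x \<in> Hom V (FObj M x) (FObj N x)" if "x \<in> EObj C" for x
    using c[OF that] that inverse_arrow[OF LUnit_iso, of "FObj M x"]
    by (auto simp: in_Hom cmp_def M N)
  then show "\<And>x. x \<in> EObj C \<Longrightarrow> uncurry_arrow V (FObj M x) (FObj N x) (Component t x) = cmp t x \<cdot> LUnit V (FObj M x)"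
    by blast
  show "equivariant M N (cmp t)"
    unfolding equivariant_def using h n natural_iff_equivariant[OF MM _ _ h c u] by blast
qed

lemma cmp_simps:
  assumes "t \<in> Hom (Mod V C) M N" "x \<in> EObj C"
  shows "cmp t x \<in> Arr V" "Dom V (cmp t x) = FObj M x" "Cod V (cmp t x) = FObj N x"
  using Mod_HomD(3)[OF assms(1)] assms(2) by (auto simp: equivariant_def in_Hom)

lemma cmp_equivariant:
  assumes "t \<in> Hom (Mod V C) M N" "x \<in> EObj C" "y \<in> EObj C"
  shows "cmp t y \<cdot> act M x y = act N x y \<cdot> (Ident V (EHom C x y) \<boxdot> cmp t x)"
  using Mod_HomD(3)[OF assms(1)] assms(2,3) by (auto simp: equivariant_def)

lemma family_nat_Hom:
  assumes M: "enriched_functor V C (self_enriched V) M" and N: "enriched_functor V C (self_enriched V) N"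
    and e: "equivariant M N \<tau>"
  shows "family_nat M N \<tau> \<in> Hom (Mod V C) M N"
    and cmp_family_nat: "\<And>x. x \<in> EObj C \<Longrightarrow> cmp (family_nat M N \<tau>) x = \<tau> x"
proof -
  let ?t = "family_nat M N \<tau>"
  have \<tau>: "\<tau> x \<in> Hom V (FObj M x) (FObj N x)" if "x \<in> EObj C" for x
    using e that by (auto simp: equivariant_def)
  have c: "Component ?t x \<in> Hom V (TUnit V) (IHom V (FObj M x) (FObj N x))"
    and u: "uncurry_arrow V (FObj M x) (FObj N x) (Component ?t x) = \<tau> x \<cdot> LUnit V (FObj M x)"
    if "x \<in> EObj C" for x
    using \<tau>[OF that] that M N by (auto simp: in_Hom family_nat_def)
  have "enriched_natural V C (self_enriched V) ?t"
  proof (rule enriched_natural.intro)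
    show "Component ?t \<in> EObj C \<rightarrow>\<^sub>E Arr V"
      using c by (auto simp: in_Hom) (auto simp: family_nat_def)
    show "Component ?t x \<in> Hom V (TUnit V) (EHom (self_enriched V) (FObj (Source ?t) x) (FObj (Target ?t) x))"
      if "x \<in> EObj C" for x
      using c[OF that] by (simp add: family_nat_def)
    fix x y assume "x \<in> EObj C" "y \<in> EObj C"
    then show "EComp (self_enriched V) (FObj (Source ?t) x) (FObj (Source ?t) y) (FObj (Target ?t) y)
            \<cdot> (Component ?t y \<boxdot> FMap (Source ?t) x y) \<cdot> inverse_arrow V (LUnit V (EHom C x y))
        = EComp (self_enriched V) (FObj (Source ?t) x) (FObj (Target ?t) x) (FObj (Target ?t) y)
            \<cdot> (FMap (Target ?t) x y \<boxdot> Component ?t x) \<cdot> inverse_arrow V (RUnit V (EHom C x y))"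
      using natural_iff_equivariant[OF M N _ _ \<tau> c u] e
      by (simp add: equivariant_def) (simp add: family_nat_def)
  qed (use M N in \<open>simp_all add: family_nat_def\<close>)
  then show h: "?t \<in> Hom (Mod V C) M N" by (simp add: in_Hom) (simp add: family_nat_def)
  show "cmp ?t x = \<tau> x" if "x \<in> EObj C" for x
  proof (rule iso_cancel_right[OF LUnit_iso])
    show "cmp ?t x \<cdot> LUnit V (FObj M x) = \<tau> x \<cdot> LUnit V (FObj M x)"
      using Mod_HomD(6)[OF h that] u[OF that] by simp
  qed (use M N cmp_simps[OF h that] \<tau>[OF that] that in \<open>simp_all add: in_Hom\<close>)
qed

text \<open>\<open>cmp\<close> determines the components at objects by transposition, and elsewhere
  components are undefined by the extensionality convention. Equations between module maps can thus
  be checked in \<open>V\<close>, one object at a time.\<close>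

lemma Mod_Hom_eqI:
  assumes s: "s \<in> Hom (Mod V C) M N" and t: "t \<in> Hom (Mod V C) M N"
    and eq: "\<And>x. x \<in> EObj C \<Longrightarrow> cmp s x = cmp t x"
  shows "s = t"
proof -
  have "Component s x = Component t x" if "x \<in> EObj C" for x
  proof (rule uncurry_inject)
    show "uncurry_arrow V (FObj M x) (FObj N x) (Component s x) = uncurry_arrow V (FObj M x) (FObj N x) (Component t x)"
      using Mod_HomD(6)[OF s that] Mod_HomD(6)[OF t that] eq[OF that] by simp
  qed (use Mod_HomD(5)[OF s that] Mod_HomD(5)[OF t that] Mod_HomD(1,2)[OF s] that in \<open>simp_all add: in_Hom\<close>)
  then have "Component s = Component t"
    using Mod_HomD(4)[OF s] Mod_HomD(4)[OF t] by (auto intro: PiE_ext)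
  then show ?thesis using s t by (cases s; cases t) (simp add: in_Hom)
qed

text \<open>The composite formed with \<open>EComp\<close> is recognised as the
  \<open>family_nat\<close> of the pointwise composites, because the components have equal
  transposes; closure and the formula for \<open>cmp\<close> are then read off from
  \<open>family_nat_Hom\<close>.\<close>

lemma Mod_Comp:
  assumes s: "s \<in> Hom (Mod V C) L M" and t: "t \<in> Hom (Mod V C) M N"
  shows "t \<cdot>\<^bsub>Mod V C\<^esub> s \<in> Hom (Mod V C) L N"
    and cmp_Comp: "\<And>x. x \<in> EObj C \<Longrightarrow> cmp (t \<cdot>\<^bsub>Mod V C\<^esub> s) x = cmp t x \<cdot> cmp s x"
proof -
  note [simp] = Mod_HomD(1,2)[OF s] Mod_HomD(1,2)[OF t] cmp_simps[OF s] cmp_simps[OF t]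
    inverse_arrow[OF LUnit_iso[of "TUnit V"]]
  have e: "equivariant L N (\<lambda>x. cmp t x \<cdot> cmp s x)"
    unfolding equivariant_def
  proof (intro conjI ballI)
    fix x y assume [simp]: "x \<in> EObj C" "y \<in> EObj C"
    have "(cmp t y \<cdot> cmp s y) \<cdot> act L x y = cmp t y \<cdot> act M x y \<cdot> (Ident V (EHom C x y) \<boxdot> cmp s x)"
      by (simp add: cmp_equivariant[OF s])
    also have "\<dots> = (act N x y \<cdot> (Ident V (EHom C x y) \<boxdot> cmp t x)) \<cdot> (Ident V (EHom C x y) \<boxdot> cmp s x)"
      by (rule Comp_reassoc[OF cmp_equivariant[OF t]]) simp_all
    finally show "(cmp t y \<cdot> cmp s y) \<cdot> act L x y = act N x y \<cdot> (Ident V (EHom C x y) \<boxdot> (cmp t x \<cdot> cmp s x))"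
      by (simp add: whisker_left_Comp)
  qed (auto simp: in_Hom)
  have "EComp (self_enriched V) (FObj L x) (FObj M x) (FObj N x) \<cdot> (Component t x \<boxdot> Component s x)
          \<cdot> inverse_arrow V (LUnit V (TUnit V))
      = curry_arrow V (TUnit V) (FObj L x) (FObj N x) ((cmp t x \<cdot> cmp s x) \<cdot> LUnit V (FObj L x))" (is "?l = ?r")
    if [simp]: "x \<in> EObj C" for x
  proof (rule uncurry_inject)
    have [simp]: "Component s x \<in> Arr V" "Dom V (Component s x) = TUnit V"
      "Cod V (Component s x) = IHom V (FObj L x) (FObj M x)"
      "Component t x \<in> Arr V" "Dom V (Component t x) = TUnit V"
      "Cod V (Component t x) = IHom V (FObj M x) (FObj N x)"
      using Mod_HomD(5)[OF s that] Mod_HomD(5)[OF t that] by (auto simp: in_Hom)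
    have "uncurry_arrow V (FObj L x) (FObj N x) ?l
        = uncurry_arrow V (FObj L x) (FObj N x) (EComp (self_enriched V) (FObj L x) (FObj M x) (FObj N x) \<cdot> (Component t x \<boxdot> Component s x))
          \<cdot> (inverse_arrow V (LUnit V (TUnit V)) \<boxdot> Ident V (FObj L x))"
      by (subst uncurry_Comp[symmetric]) simp_all
    also have "\<dots> = cmp t x \<cdot> (LUnit V (FObj M x) \<cdot> (Ident V (TUnit V) \<boxdot> (cmp s x \<cdot> LUnit V (FObj L x))))
        \<cdot> Assoc V (TUnit V) (TUnit V) (FObj L x) \<cdot> (inverse_arrow V (LUnit V (TUnit V)) \<boxdot> Ident V (FObj L x))"
      by (simp add: uncurry_self_EComp Mod_HomD(6)[OF s] Mod_HomD(6)[OF t])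
    also have "LUnit V (FObj M x) \<cdot> (Ident V (TUnit V) \<boxdot> (cmp s x \<cdot> LUnit V (FObj L x)))
        = (cmp s x \<cdot> LUnit V (FObj L x)) \<cdot> LUnit V (TUnit V \<boxtimes> FObj L x)"
      by (subst LUnit_nat) simp_all
    finally show "uncurry_arrow V (FObj L x) (FObj N x) ?l = uncurry_arrow V (FObj L x) (FObj N x) ?r"
      by (simp add: LUnit_tensor_inverse)
    show "?l \<in> Arr V" "?r \<in> Arr V" "Cod V ?l = IHom V (FObj L x) (FObj N x)"
      "Cod V ?r = IHom V (FObj L x) (FObj N x)" "Dom V ?l = Dom V ?r"
      "FObj L x \<in> Obj V" "FObj N x \<in> Obj V"
      by simp_all
  qed
  then have "t \<cdot>\<^bsub>Mod V C\<^esub> s = family_nat L N (\<lambda>x. cmp t x \<cdot> cmp s x)"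
    using s t by (simp add: Mod_def enriched_functor_category_def family_nat_def in_Hom
        cong: restrict_cong)
  then show "t \<cdot>\<^bsub>Mod V C\<^esub> s \<in> Hom (Mod V C) L N"
    "\<And>x. x \<in> EObj C \<Longrightarrow> cmp (t \<cdot>\<^bsub>Mod V C\<^esub> s) x = cmp t x \<cdot> cmp s x"
    using family_nat_Hom[OF _ _ e] by simp_all
qed

lemma Mod_Ident:
  assumes [simp]: "enriched_functor V C (self_enriched V) M"
  shows "Ident (Mod V C) M \<in> Hom (Mod V C) M M"
    and cmp_Ident: "\<And>x. x \<in> EObj C \<Longrightarrow> cmp (Ident (Mod V C) M) x = Ident V (FObj M x)"
proof -
  have e: "equivariant M M (\<lambda>x. Ident V (FObj M x))"
    by (auto simp: equivariant_def in_Hom)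
  have "EId (self_enriched V) (FObj M x)
      = curry_arrow V (TUnit V) (FObj M x) (FObj M x) (Ident V (FObj M x) \<cdot> LUnit V (FObj M x))"
    if "x \<in> EObj C" for x
    by (rule uncurry_inject[of "FObj M x" "FObj M x"]) (simp_all add: that)
  then have "Ident (Mod V C) M = family_nat M M (\<lambda>x. Ident V (FObj M x))"
    by (auto simp: Mod_def enriched_functor_category_def family_nat_def intro!: restrict_ext)
  then show "Ident (Mod V C) M \<in> Hom (Mod V C) M M"
    "\<And>x. x \<in> EObj C \<Longrightarrow> cmp (Ident (Mod V C) M) x = Ident V (FObj M x)"
    using family_nat_Hom[OF _ _ e] by simp_all
qed

lemma category_Mod: "category (Mod V C)"
proof
  show "Dom (Mod V C) f \<in> Obj (Mod V C)" "Cod (Mod V C) f \<in> Obj (Mod V C)" if "f \<in> Arr (Mod V C)" for f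
    using that by (auto simp: enriched_natural.Source_functor enriched_natural.Target_functor)
  show "Ident (Mod V C) x \<in> Hom (Mod V C) x x" if "x \<in> Obj (Mod V C)" for x
    using that by (simp add: Mod_Ident)
  show "g \<cdot>\<^bsub>Mod V C\<^esub> f \<in> Hom (Mod V C) x z" if "f \<in> Hom (Mod V C) x y" "g \<in> Hom (Mod V C) y z" for f g x y z
    using that by (rule Mod_Comp)
  show "Ident (Mod V C) y \<cdot>\<^bsub>Mod V C\<^esub> f = f" "f \<cdot>\<^bsub>Mod V C\<^esub> Ident (Mod V C) x = f"
    if f: "f \<in> Hom (Mod V C) x y" for f x y
  proof -
    note I = Mod_Ident(1)[OF Mod_HomD(1)[OF f]] Mod_Ident(1)[OF Mod_HomD(2)[OF f]]
    show "Ident (Mod V C) y \<cdot>\<^bsub>Mod V C\<^esub> f = f"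
      using Mod_HomD(2)[OF f] cmp_simps[OF f]
      by (intro Mod_Hom_eqI[OF Mod_Comp(1)[OF f I(2)] f]) (simp add: cmp_Comp[OF f I(2)] cmp_Ident)
    show "f \<cdot>\<^bsub>Mod V C\<^esub> Ident (Mod V C) x = f"
      using Mod_HomD(1)[OF f] cmp_simps[OF f]
      by (intro Mod_Hom_eqI[OF Mod_Comp(1)[OF I(1) f] f]) (simp add: cmp_Comp[OF I(1) f] cmp_Ident)
  qed
  show "(h \<cdot>\<^bsub>Mod V C\<^esub> g) \<cdot>\<^bsub>Mod V C\<^esub> f = h \<cdot>\<^bsub>Mod V C\<^esub> g \<cdot>\<^bsub>Mod V C\<^esub> f"
    if f: "f \<in> Hom (Mod V C) w x" and g: "g \<in> Hom (Mod V C) x y" and h: "h \<in> Hom (Mod V C) y z" for f g h w x y z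
  proof -
    note gf = Mod_Comp(1)[OF f g] and hg = Mod_Comp(1)[OF g h]
    show ?thesis
      by (rule Mod_Hom_eqI[OF Mod_Comp(1)[OF f hg] Mod_Comp(1)[OF gf h]])
        (simp add: cmp_Comp[OF f hg] cmp_Comp[OF g h] cmp_Comp[OF gf h] cmp_Comp[OF f g]
          cmp_simps[OF f] cmp_simps[OF g] cmp_simps[OF h])
  qed
qed

end

section \<open>The modules \<open>\<A>(\<C>(-,c),a)\<close>\<close>

context enriched_over_closed
begin

text \<open>Composition of the opposite enriched category, taking its arguments in diagrammatic
  order.\<close>

definition op_comp :: "'c \<Rightarrow> 'c \<Rightarrow> 'c \<Rightarrow> 'm" where
  "op_comp x y z = EComp C x y z \<cdot> Sym V (EHom C x y) (EHom C y z)"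

definition right_act :: "('c, 'o, 'm) efun \<Rightarrow> 'c \<Rightarrow> 'c \<Rightarrow> 'm" where
  "right_act M x y = act M x y \<cdot> Sym V (FObj M x) (EHom C x y)"

lemma op_comp_simps [simp]:
  assumes "x \<in> EObj C" "y \<in> EObj C" "z \<in> EObj C"
  shows "op_comp x y z \<in> Arr V" "Dom V (op_comp x y z) = EHom C x y \<boxtimes> EHom C y z"
    "Cod V (op_comp x y z) = EHom C x z"
  using assms by (simp_all add: op_comp_def)

text \<open>\<open>\<C>\<close> acts on its own hom objects from the left by composition, so this is
  the left-right equivalence with all four actions equal to instances of
  \<open>EComp\<close>.\<close>

lemma op_comp_assoc:
  assumes [simp]: "w \<in> EObj C" "x \<in> EObj C" "y \<in> EObj C" "z \<in> EObj C"
  shows "op_comp w y z \<cdot> (op_comp w x y \<boxdot> Ident V (EHom C y z))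
    = op_comp w x z \<cdot> (Ident V (EHom C w x) \<boxdot> op_comp x y z) \<cdot> Assoc V (EHom C w x) (EHom C x y) (EHom C y z)"
  unfolding op_comp_def
  by (subst left_assoc_iff_right_assoc[symmetric, where z = "EHom C w z"]) (simp_all add: EComp_Hom EComp_assoc)

lemma op_comp_EId_left:
  assumes [simp]: "x \<in> EObj C" "y \<in> EObj C"
  shows "op_comp x x y \<cdot> (EId C x \<boxdot> Ident V (EHom C x y)) = LUnit V (EHom C x y)"
proof -
  have "op_comp x x y \<cdot> (EId C x \<boxdot> Ident V (EHom C x y))
      = (EComp C x x y \<cdot> (Ident V (EHom C x y) \<boxdot> EId C x)) \<cdot> Sym V (TUnit V) (EHom C x y)"
    by (simp add: op_comp_def Sym_nat)
  then show ?thesis by (simp add: EId_right RUnit_Sym del: Comp_assoc_Arr)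
qed

lemma op_comp_EId_right:
  assumes [simp]: "x \<in> EObj C" "y \<in> EObj C"
  shows "op_comp x y y \<cdot> (Ident V (EHom C x y) \<boxdot> EId C y) = RUnit V (EHom C x y)"
proof -
  have "op_comp x y y \<cdot> (Ident V (EHom C x y) \<boxdot> EId C y)
      = (EComp C x y y \<cdot> (EId C y \<boxdot> Ident V (EHom C x y))) \<cdot> Sym V (EHom C x y) (TUnit V)"
    by (simp add: op_comp_def Sym_nat)
  then show ?thesis by (simp add: EId_left Sym_unit del: Comp_assoc_Arr)
qed

lemma right_act_simps [simp]:
  assumes "enriched_functor V C (self_enriched V) M" "x \<in> EObj C" "y \<in> EObj C"
  shows "right_act M x y \<in> Arr V" "Dom V (right_act M x y) = FObj M x \<boxtimes> EHom C x y"
    "Cod V (right_act M x y) = FObj M y"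
  using assms by (simp_all add: right_act_def)

lemma right_act_assoc:
  assumes M [simp]: "enriched_functor V C (self_enriched V) M"
    and [simp]: "x \<in> EObj C" "y \<in> EObj C" "z \<in> EObj C"
  shows "right_act M y z \<cdot> (right_act M x y \<boxdot> Ident V (EHom C y z))
    = right_act M x z \<cdot> (Ident V (FObj M x) \<boxdot> op_comp x y z) \<cdot> Assoc V (FObj M x) (EHom C x y) (EHom C y z)"
  using module_action[of M] unfolding op_comp_def right_act_def
  by (subst left_assoc_iff_right_assoc[symmetric]) (simp_all add: EComp_Hom in_Hom is_actionD)

lemma right_act_EId:
  assumes M [simp]: "enriched_functor V C (self_enriched V) M" and [simp]: "x \<in> EObj C"
  shows "right_act M x x \<cdot> (Ident V (FObj M x) \<boxdot> EId C x) = RUnit V (FObj M x)"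
proof -
  have "right_act M x x \<cdot> (Ident V (FObj M x) \<boxdot> EId C x)
      = (act M x x \<cdot> (EId C x \<boxdot> Ident V (FObj M x))) \<cdot> Sym V (FObj M x) (TUnit V)"
    by (simp add: right_act_def Sym_nat)
  also have "\<dots> = LUnit V (FObj M x) \<cdot> Sym V (FObj M x) (TUnit V)"
    using module_action[of M] by (simp add: is_actionD del: Comp_assoc_Arr)
  finally show ?thesis by (simp add: Sym_unit)
qed

lemma right_equivariant_iff:
  assumes [simp]: "enriched_functor V C (self_enriched V) M" "enriched_functor V C (self_enriched V) N"
    "x \<in> EObj C" "y \<in> EObj C" "f \<in> Arr V" "Dom V f = FObj M x" "Cod V f = FObj N x"
    "g \<in> Arr V" "Dom V g = FObj M y" "Cod V g = FObj N y"
  shows "g \<cdot> right_act M x y = right_act N x y \<cdot> (f \<boxdot> Ident V (EHom C x y))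
    \<longleftrightarrow> g \<cdot> act M x y = act N x y \<cdot> (Ident V (EHom C x y) \<boxdot> f)"
proof -
  let ?S = "Sym V (FObj M x) (EHom C x y)"
  have l: "g \<cdot> right_act M x y = (g \<cdot> act M x y) \<cdot> ?S"
    by (simp add: right_act_def)
  have r: "right_act N x y \<cdot> (f \<boxdot> Ident V (EHom C x y)) = (act N x y \<cdot> (Ident V (EHom C x y) \<boxdot> f)) \<cdot> ?S"
    by (simp add: right_act_def Sym_nat)
  show ?thesis
    unfolding l r by (intro iffI) (erule iso_cancel_right[OF Sym_iso, rotated 2], simp_all)
qed

lemma cmp_right_equivariant:
  assumes "t \<in> Hom (Mod V C) M N" "x \<in> EObj C" "y \<in> EObj C"
  shows "cmp t y \<cdot> right_act M x y = right_act N x y \<cdot> (cmp t x \<boxdot> Ident V (EHom C x y))"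
  using right_equivariant_iff[of M N x y "cmp t x" "cmp t y"] cmp_equivariant[OF assms]
    Mod_HomD(1,2)[OF assms(1)] cmp_simps[OF assms(1)] assms(2,3) by simp

text \<open>The inner of the two transposes in \<open>hom_module\<close>. The outer one is supplied
  by \<open>action_module\<close>, so that \<open>hom_module_eq\<close> only needs
  unfolding.\<close>

definition hom_act :: "'c \<Rightarrow> 'o \<Rightarrow> 'c \<Rightarrow> 'c \<Rightarrow> 'm" where
  "hom_act c a x y = (let U = EHom C x y; W = EHom C y c; H = IHom V (EHom C x c) a in
     curry_arrow V (U \<boxtimes> H) W a
       (Eval V (EHom C x c) a \<cdot> (Ident V H \<boxdot> EComp C x y c) \<cdot> (Ident V H \<boxdot> Sym V U W)
          \<cdot> Assoc V H U W \<cdot> (Sym V U H \<boxdot> Ident V W)))"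

section \<open>The module of inner homs into a fixed object, and maps into it\<close>

context
  fixes c a assumes c [simp]: "c \<in> EObj C" and a [simp]: "a \<in> Obj V"
begin

abbreviation "hom_obj x \<equiv> IHom V (EHom C x c) a"

definition hom_right_act :: "'c \<Rightarrow> 'c \<Rightarrow> 'm" where
  "hom_right_act x y = hom_act c a x y \<cdot> Sym V (hom_obj x) (EHom C x y)"

lemma hom_act_simps [simp]:
  assumes "x \<in> EObj C" "y \<in> EObj C"
  shows "hom_act c a x y \<in> Arr V" "Dom V (hom_act c a x y) = EHom C x y \<boxtimes> hom_obj x"
    "Cod V (hom_act c a x y) = hom_obj y"
  using assms by (simp_all add: hom_act_def Let_def)

lemma hom_right_act_simps [simp]:
  assumes "x \<in> EObj C" "y \<in> EObj C"
  shows "hom_right_act x y \<in> Arr V" "Dom V (hom_right_act x y) = hom_obj x \<boxtimes> EHom C x y"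
    "Cod V (hom_right_act x y) = hom_obj y"
  using assms by (simp_all add: hom_right_act_def)

text \<open>One symmetry of \<open>hom_act\<close> cancels against the one in
  \<open>hom_right_act\<close>, the other is absorbed by \<open>op_comp\<close>. What remains is
  plain precomposition: compose in \<open>\<C>\<close>, then evaluate.\<close>

lemma uncurry_hom_right_act:
  assumes [simp]: "x \<in> EObj C" "y \<in> EObj C"
  shows "uncurry_arrow V (EHom C y c) a (hom_right_act x y)
    = Eval V (EHom C x c) a \<cdot> (Ident V (hom_obj x) \<boxdot> op_comp x y c)
        \<cdot> Assoc V (hom_obj x) (EHom C x y) (EHom C y c)"
  by (simp add: hom_right_act_def uncurry_Comp)
     (simp add: hom_act_def Let_def op_comp_def whisker_left_Comp flip: whisker_right_Comp)

text \<open>Transposed, both sides evaluate at a composite of three arrows of \<open>\<C>\<close>,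
  bracketed differently; the pentagon and \<open>op_comp_assoc\<close> identify the
  bracketings.\<close>

lemma hom_right_act_assoc:
  assumes [simp]: "x \<in> EObj C" "y \<in> EObj C" "z \<in> EObj C"
  shows "hom_right_act y z \<cdot> (hom_right_act x y \<boxdot> Ident V (EHom C y z))
    = hom_right_act x z \<cdot> (Ident V (hom_obj x) \<boxdot> op_comp x y z)
        \<cdot> Assoc V (hom_obj x) (EHom C x y) (EHom C y z)" (is "?l = ?r")
proof (rule uncurry_inject)
  let ?U = "EHom C x y" and ?U' = "EHom C y z" and ?W = "EHom C z c" and ?H = "hom_obj x"
  let ?E = "Eval V (EHom C x c) a"
  have "uncurry_arrow V ?W a ?l = Eval V (EHom C y c) a \<cdot>
      ((Ident V (hom_obj y) \<boxdot> op_comp y z c) \<cdot> (hom_right_act x y \<boxdot> Ident V (?U' \<boxtimes> ?W)))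
      \<cdot> Assoc V (?H \<boxtimes> ?U) ?U' ?W"
    by (simp add: uncurry_Comp uncurry_hom_right_act Assoc_nat)
  also have "\<dots> = uncurry_arrow V (EHom C y c) a (hom_right_act x y) \<cdot> (Ident V (?H \<boxtimes> ?U) \<boxdot> op_comp y z c)
      \<cdot> Assoc V (?H \<boxtimes> ?U) ?U' ?W"
    by (subst whisker_exchange[where x = "?H \<boxtimes> ?U" and y' = "EHom C y c"]) (simp_all add: uncurry_arrow_def)
  also have "\<dots> = ?E \<cdot> (Ident V ?H \<boxdot> op_comp x y c) \<cdot> (Ident V ?H \<boxdot> (Ident V ?U \<boxdot> op_comp y z c))
      \<cdot> Assoc V ?H ?U (?U' \<boxtimes> ?W) \<cdot> Assoc V (?H \<boxtimes> ?U) ?U' ?W"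
    by (simp add: uncurry_hom_right_act Assoc_nat_Ident')
  also have "\<dots> = ?E \<cdot> (Ident V ?H \<boxdot> (op_comp x y c \<cdot> (Ident V ?U \<boxdot> op_comp y z c) \<cdot> Assoc V ?U ?U' ?W))
      \<cdot> Assoc V ?H (?U \<boxtimes> ?U') ?W \<cdot> (Assoc V ?H ?U ?U' \<boxdot> Ident V ?W)"
    by (simp add: pentagon whisker_left_Comp)
  also have "op_comp x y c \<cdot> (Ident V ?U \<boxdot> op_comp y z c) \<cdot> Assoc V ?U ?U' ?W
      = op_comp x z c \<cdot> (op_comp x y z \<boxdot> Ident V ?W)"
    by (simp add: op_comp_assoc)
  also have "?E \<cdot> (Ident V ?H \<boxdot> (op_comp x z c \<cdot> (op_comp x y z \<boxdot> Ident V ?W)))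
      \<cdot> Assoc V ?H (?U \<boxtimes> ?U') ?W \<cdot> (Assoc V ?H ?U ?U' \<boxdot> Ident V ?W) = uncurry_arrow V ?W a ?r"
    by (simp add: uncurry_Comp[where g = "hom_right_act x z"] uncurry_hom_right_act whisker_left_Comp
        whisker_right_Comp Assoc_nat')
  finally show "uncurry_arrow V ?W a ?l = uncurry_arrow V ?W a ?r" .
qed simp_all

lemma hom_right_act_EId:
  assumes [simp]: "x \<in> EObj C"
  shows "hom_right_act x x \<cdot> (Ident V (hom_obj x) \<boxdot> EId C x) = RUnit V (hom_obj x)" (is "?l = ?r")
proof (rule uncurry_inject)
  let ?W = "EHom C x c" and ?H = "hom_obj x"
  have "uncurry_arrow V ?W a ?l = Eval V ?W a \<cdot> (Ident V ?H \<boxdot> (op_comp x x c \<cdot> (EId C x \<boxdot> Ident V ?W)))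
      \<cdot> Assoc V ?H (TUnit V) ?W"
    by (simp add: uncurry_Comp uncurry_hom_right_act Assoc_nat whisker_left_Comp)
  also have "\<dots> = uncurry_arrow V ?W a ?r"
    by (simp add: op_comp_EId_left triangle uncurry_arrow_def)
  finally show "uncurry_arrow V ?W a ?l = uncurry_arrow V ?W a ?r" .
qed simp_all

lemma is_action_hom: "is_action hom_obj (hom_act c a)"
  unfolding is_action_def
proof (intro conjI ballI)
  fix x y z assume [simp]: "x \<in> EObj C" "y \<in> EObj C" "z \<in> EObj C"
  show "hom_act c a x z \<cdot> (EComp C x y z \<boxdot> Ident V (hom_obj x))
      = hom_act c a y z \<cdot> (Ident V (EHom C y z) \<boxdot> hom_act c a x y) \<cdot> Assoc V (EHom C y z) (EHom C x y) (hom_obj x)"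
    using hom_right_act_assoc[of x y z]
    by (subst left_assoc_iff_right_assoc[where y = "hom_obj y" and z = "hom_obj z" and t = "EHom C x z"])
      (simp_all add: in_Hom hom_right_act_def op_comp_def)
next
  fix x assume [simp]: "x \<in> EObj C"
  let ?H = "hom_obj x" and ?U = "EHom C x x"
  have "hom_act c a x x \<cdot> (EId C x \<boxdot> Ident V ?H) = hom_right_act x x \<cdot> Sym V ?U ?H \<cdot> (EId C x \<boxdot> Ident V ?H)"
    by (simp add: hom_right_act_def)
  also have "\<dots> = (hom_right_act x x \<cdot> (Ident V ?H \<boxdot> EId C x)) \<cdot> Sym V (TUnit V) ?H"
    by (simp add: Sym_nat)
  also have "\<dots> = LUnit V ?H" unfolding hom_right_act_EId[OF \<open>x \<in> EObj C\<close>] by (simp add: RUnit_Sym)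
  finally show "hom_act c a x x \<cdot> (EId C x \<boxdot> Ident V ?H) = LUnit V ?H" .
qed (simp_all add: in_Hom)

lemma hom_module_eq: "hom_module V C c a = action_module hom_obj (hom_act c a)"
  by (simp add: hom_module_def action_module_def hom_act_def Let_def cong: restrict_cong)

lemma hom_module_Mod [simp]: "enriched_functor V C (self_enriched V) (hom_module V C c a)"
  by (simp add: hom_module_eq action_module_Mod is_action_hom)

lemma FObj_hom_module [simp]: "x \<in> EObj C \<Longrightarrow> FObj (hom_module V C c a) x = hom_obj x"
  by (simp add: hom_module_eq)

lemma right_act_hom_module:
  "x \<in> EObj C \<Longrightarrow> y \<in> EObj C \<Longrightarrow> right_act (hom_module V C c a) x y = hom_right_act x y"
  by (simp add: hom_module_eq right_act_def hom_right_act_def is_action_hom)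

text \<open>The enriched Yoneda lemma in disguise: the arrow \<open>M c \<rightarrow> a\<close> of a map \<open>s\<close> is \<open>s\<close> at \<open>c\<close> evaluated at \<open>EId C c\<close>.\<close>

lemma hom_module_map:
  assumes M [simp]: "enriched_functor V C (self_enriched V) M" and g: "g \<in> Hom V (FObj M c) a"
  obtains t where "t \<in> Hom (Mod V C) M (hom_module V C c a)"
    "\<And>x. x \<in> EObj C \<Longrightarrow> uncurry_arrow V (EHom C x c) a (cmp t x) = g \<cdot> right_act M x c"
proof -
  have [simp]: "g \<in> Arr V" "Dom V g = FObj M c" "Cod V g = a" using g by (auto simp: in_Hom)
  \<comment> \<open>The transpose of acting \<open>M x \<otimes> \<C>(x,c) \<rightarrow> M c\<close>
    and then applying \<open>g\<close>. Its equivariance will reduce to associativity of the right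
    action of \<open>M\<close>.\<close>
  define \<tau> where "\<tau> x = curry_arrow V (FObj M x) (EHom C x c) a (g \<cdot> right_act M x c)" for x
  have [simp]: "\<tau> x \<in> Arr V" "Dom V (\<tau> x) = FObj M x" "Cod V (\<tau> x) = hom_obj x"
    "uncurry_arrow V (EHom C x c) a (\<tau> x) = g \<cdot> right_act M x c" if "x \<in> EObj C" for x
    using that by (simp_all add: \<tau>_def)
  have "equivariant M (hom_module V C c a) \<tau>"
    unfolding equivariant_def
  proof (intro conjI ballI)
    fix x y assume [simp]: "x \<in> EObj C" "y \<in> EObj C"
    let ?U = "EHom C x y" and ?W = "EHom C y c" and ?X = "FObj M x"
    have "\<tau> y \<cdot> right_act M x y = hom_right_act x y \<cdot> (\<tau> x \<boxdot> Ident V ?U)" (is "?l = ?r")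
    proof (rule uncurry_inject)
      have "uncurry_arrow V ?W a ?l = g \<cdot> right_act M y c \<cdot> (right_act M x y \<boxdot> Ident V ?W)"
        by (simp add: uncurry_Comp)
      also have "\<dots> = (g \<cdot> right_act M x c) \<cdot> (Ident V ?X \<boxdot> op_comp x y c) \<cdot> Assoc V ?X ?U ?W"
        by (simp add: right_act_assoc)
      \<comment> \<open>The defining equation of \<open>\<tau> x\<close> is used backwards, so that
        \<open>g\<close> disappears in favour of an evaluation.\<close>
      also have "\<dots> = Eval V (EHom C x c) a \<cdot> ((\<tau> x \<boxdot> Ident V (EHom C x c)) \<cdot> (Ident V ?X \<boxdot> op_comp x y c)) \<cdot> Assoc V ?X ?U ?W"
        by (simp flip: \<open>x \<in> EObj C \<Longrightarrow> uncurry_arrow V (EHom C x c) a (\<tau> x) = g \<cdot> right_act M x c\<close>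
             add: uncurry_arrow_def del: Comp_assoc_Arr) (simp add: uncurry_arrow_def)
      also have "(\<tau> x \<boxdot> Ident V (EHom C x c)) \<cdot> (Ident V ?X \<boxdot> op_comp x y c)
          = (Ident V (hom_obj x) \<boxdot> op_comp x y c) \<cdot> (\<tau> x \<boxdot> Ident V (?U \<boxtimes> ?W))"
        by (rule whisker_exchange[symmetric]) simp_all
      finally show "uncurry_arrow V ?W a ?l = uncurry_arrow V ?W a ?r"
        by (simp add: uncurry_Comp[where g = "hom_right_act x y"] uncurry_hom_right_act Assoc_nat)
    qed simp_all
    then show "\<tau> y \<cdot> act M x y = act (hom_module V C c a) x y \<cdot> (Ident V (EHom C x y) \<boxdot> \<tau> x)"
      by (subst right_equivariant_iff[symmetric]) (simp_all add: right_act_hom_module)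
  qed (simp_all add: in_Hom)
  from family_nat_Hom[OF M hom_module_Mod this] show thesis
    by (intro that[of "family_nat M (hom_module V C c a) \<tau>"]) simp_all
qed

text \<open>Every map into this module arises as in \<open>hom_module_map\<close>. Equivariance
  expresses the value of \<open>s\<close> at \<open>x\<close> on an arrow to \<open>c\<close>
  through its value at \<open>c\<close> on the identity, and that value is \<open>g\<close>.\<close>

lemma hom_module_map_transpose:
  assumes s: "s \<in> Hom (Mod V C) M (hom_module V C c a)"
  obtains g where "g \<in> Hom V (FObj M c) a"
    "\<And>x. x \<in> EObj C \<Longrightarrow> uncurry_arrow V (EHom C x c) a (cmp s x) = g \<cdot> right_act M x c"
proof -
  note M [simp] = Mod_HomD(1)[OF s]
  note [simp] = cmp_simps[OF s] inverse_arrow[OF RUnit_iso[of "FObj M c"]]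
  let ?C = "EHom C c c"
  define g where "g = uncurry_arrow V ?C a (cmp s c) \<cdot> (Ident V (FObj M c) \<boxdot> EId C c) \<cdot> inverse_arrow V (RUnit V (FObj M c))"
  have [simp]: "g \<in> Arr V" "Dom V g = FObj M c" "Cod V g = a"
    and g: "g \<cdot> RUnit V (FObj M c) = uncurry_arrow V ?C a (cmp s c) \<cdot> (Ident V (FObj M c) \<boxdot> EId C c)"
    by (simp_all add: g_def)
  have "uncurry_arrow V (EHom C x c) a (cmp s x) = g \<cdot> right_act M x c" (is "?l = ?r")
    if x [simp]: "x \<in> EObj C" for x
  proof (rule iso_cancel_right)
    let ?U = "EHom C x c" and ?X = "FObj M x"
    \<comment> \<open>The right unit constraint creates the tensor factor \<open>I\<close> into
      which \<open>EId C c\<close> is inserted; at the end the right unit law of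
      \<open>op_comp\<close> and \<open>RUnit_tensor\<close> turn it into the same constraint again,
      ready to be cancelled.\<close>
    have "?r \<cdot> RUnit V (?X \<boxtimes> ?U) = (g \<cdot> RUnit V (FObj M c)) \<cdot> (right_act M x c \<boxdot> Ident V (TUnit V))"
      by (simp add: RUnit_nat)
    also have "\<dots> = uncurry_arrow V ?C a (cmp s c) \<cdot> ((Ident V (FObj M c) \<boxdot> EId C c) \<cdot> (right_act M x c \<boxdot> Ident V (TUnit V)))"
      unfolding g by simp
    also have "(Ident V (FObj M c) \<boxdot> EId C c) \<cdot> (right_act M x c \<boxdot> Ident V (TUnit V))
        = (right_act M x c \<boxdot> Ident V ?C) \<cdot> (Ident V (?X \<boxtimes> ?U) \<boxdot> EId C c)"
      by (rule whisker_exchange) simp_all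
    also have "uncurry_arrow V ?C a (cmp s c) \<cdot> \<dots> = uncurry_arrow V ?C a (cmp s c \<cdot> right_act M x c) \<cdot> (Ident V (?X \<boxtimes> ?U) \<boxdot> EId C c)"
      by (simp add: uncurry_Comp)
    also have "cmp s c \<cdot> right_act M x c = hom_right_act x c \<cdot> (cmp s x \<boxdot> Ident V ?U)"
      using cmp_right_equivariant[OF s x c] by (simp add: right_act_hom_module)
    also have "uncurry_arrow V ?C a (hom_right_act x c \<cdot> (cmp s x \<boxdot> Ident V ?U)) \<cdot> (Ident V (?X \<boxtimes> ?U) \<boxdot> EId C c)
      = Eval V ?U a \<cdot> ((Ident V (hom_obj x) \<boxdot> op_comp x c c) \<cdot> (cmp s x \<boxdot> Ident V (?U \<boxtimes> ?C)))
          \<cdot> (Ident V ?X \<boxdot> (Ident V ?U \<boxdot> EId C c)) \<cdot> Assoc V ?X ?U (TUnit V)"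
      by (simp add: uncurry_Comp uncurry_hom_right_act Assoc_nat' Assoc_nat_Ident)
    also have "(Ident V (hom_obj x) \<boxdot> op_comp x c c) \<cdot> (cmp s x \<boxdot> Ident V (?U \<boxtimes> ?C))
        = (cmp s x \<boxdot> Ident V ?U) \<cdot> (Ident V ?X \<boxdot> op_comp x c c)"
      by (rule whisker_exchange) simp_all
    also have "Eval V ?U a \<cdot> \<dots> \<cdot> (Ident V ?X \<boxdot> (Ident V ?U \<boxdot> EId C c)) \<cdot> Assoc V ?X ?U (TUnit V)
        = ?l \<cdot> (Ident V ?X \<boxdot> (op_comp x c c \<cdot> (Ident V ?U \<boxdot> EId C c))) \<cdot> Assoc V ?X ?U (TUnit V)"
      by (simp add: uncurry_arrow_def whisker_left_Comp)
    also have "\<dots> = ?l \<cdot> RUnit V (?X \<boxtimes> ?U)"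
      by (simp add: op_comp_EId_right RUnit_tensor)
    finally show "?l \<cdot> RUnit V (?X \<boxtimes> ?U) = ?r \<cdot> RUnit V (?X \<boxtimes> ?U)" by (rule sym)
  qed (simp_all add: RUnit_iso)
  then show thesis by (intro that[of g]) (simp_all add: in_Hom)
qed

end

end

section \<open>Products, injective objects and kernels\<close>

lemma op_cat_simps [simp]:
  "Obj (op_cat C) = Obj C" "Hom (op_cat C) x y = Hom C y x" "g \<cdot>\<^bsub>op_cat C\<^esub> f = f \<cdot>\<^bsub>C\<^esub> g"
  by (auto simp: op_cat_def Hom_def)

lemma chosen_product:
  assumes "\<exists>P p. is_product C I X P p"
  shows "is_product C I X (Prod C I X) (Proj C I X)"
proof -
  have "case chosen_product C I X of (P, p) \<Rightarrow> is_product C I X P p"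
    unfolding chosen_product_def by (rule someI_ex) (use assms in auto)
  then show ?thesis by (simp add: case_prod_beta)
qed

lemma is_productD:
  assumes "is_product C I X P p"
  shows "P \<in> Obj C" "\<And>i. i \<in> I \<Longrightarrow> X i \<in> Obj C" "\<And>i. i \<in> I \<Longrightarrow> p i \<in> Hom C P (X i)"
    "\<And>Q q. Q \<in> Obj C \<Longrightarrow> (\<And>i. i \<in> I \<Longrightarrow> q i \<in> Hom C Q (X i)) \<Longrightarrow>
       \<exists>!h. h \<in> Hom C Q P \<and> (\<forall>i\<in>I. p i \<cdot>\<^bsub>C\<^esub> h = q i)"
  using assms by (auto simp: is_product_def)

lemma tuple_arrow:
  assumes "is_product C I X (Prod C I X) (Proj C I X)" "Q \<in> Obj C"
    "\<And>i. i \<in> I \<Longrightarrow> q i \<in> Hom C Q (X i)"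
  shows "tuple_arrow C I X Q q \<in> Hom C Q (Prod C I X)"
    "\<And>i. i \<in> I \<Longrightarrow> Proj C I X i \<cdot>\<^bsub>C\<^esub> tuple_arrow C I X Q q = q i"
  using theI'[OF is_productD(4)[OF assms]] by (auto simp: tuple_arrow_def)

section \<open>Injectivity, retracts, zero arrows and kernels in a category\<close>

context category
begin

lemma monicD:
  assumes "monic C f" "f \<cdot> g = f \<cdot> h" "g \<in> Arr C" "h \<in> Arr C" "Dom C g = Dom C h"
    "Cod C g = Dom C f" "Cod C h = Dom C f"
  shows "g = h"
  using assms by (auto simp: monic_def)

lemma product_jointly_monic:
  assumes "is_product C I X P p" "f \<in> Arr C" "g \<in> Arr C" "Dom C f = Dom C g" "Cod C f = P" "Cod C g = P"
    "\<And>i. i \<in> I \<Longrightarrow> p i \<cdot> f = p i \<cdot> g"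
  shows "f = g"
proof -
  note p = is_productD[OF assms(1)]
  have "\<exists>!h. h \<in> Hom C (Dom C f) P \<and> (\<forall>i\<in>I. p i \<cdot> h = p i \<cdot> f)"
    using assms(2-) p(1-3) by (intro p(4)) (auto simp: in_Hom)
  moreover have "f \<in> Hom C (Dom C f) P \<and> (\<forall>i\<in>I. p i \<cdot> f = p i \<cdot> f)"
    using assms(2-6) by (simp add: in_Hom)
  moreover have "g \<in> Hom C (Dom C f) P \<and> (\<forall>i\<in>I. p i \<cdot> g = p i \<cdot> f)"
    using assms(2-7) by (simp add: in_Hom)
  ultimately show ?thesis by blast
qed

lemma injective_product:
  assumes P: "is_product C I X P p" and X: "\<And>i. i \<in> I \<Longrightarrow> injective C (X i)"
  shows "injective C P"
  unfolding injective_def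
proof (intro conjI allI impI)
  note p = is_productD[OF P]
  show "P \<in> Obj C" by (rule p)
  fix f g assume fg: "monic C f \<and> g \<in> Hom C (Dom C f) P"
  then have f: "f \<in> Arr C" by (simp add: monic_def)
  have "\<exists>h\<in>Hom C (Cod C f) (X i). h \<cdot> f = p i \<cdot> g" if "i \<in> I" for i
  proof -
    have "p i \<cdot> g \<in> Hom C (Dom C f) (X i)"
      using fg p(3)[OF that] by (auto simp: in_Hom)
    then show ?thesis using X[OF that] fg unfolding injective_def by blast
  qed
  then obtain q where q: "\<And>i. i \<in> I \<Longrightarrow> q i \<in> Hom C (Cod C f) (X i)" "\<And>i. i \<in> I \<Longrightarrow> q i \<cdot> f = p i \<cdot> g"
    by metis
  have "\<exists>!h. h \<in> Hom C (Cod C f) P \<and> (\<forall>i\<in>I. p i \<cdot> h = q i)"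
    by (rule p(4)) (use q(1) f in simp_all)
  then obtain h where h: "h \<in> Hom C (Cod C f) P" "\<And>i. i \<in> I \<Longrightarrow> p i \<cdot> h = q i" by blast
  have "h \<cdot> f = g"
  proof (rule product_jointly_monic[OF P])
    fix i assume i: "i \<in> I"
    show "p i \<cdot> h \<cdot> f = p i \<cdot> g"
      using Comp_reassoc[OF h(2)[OF i], of f] q(2)[OF i] h(1) p(3)[OF i] f by (simp add: in_Hom)
  qed (use h f fg in \<open>auto simp: in_Hom\<close>)
  then show "\<exists>h\<in>Hom C (Cod C f) P. h \<cdot> f = g" using h(1) by blast
qed

lemma injective_retract:
  assumes y: "injective C y" and i: "i \<in> Hom C x y" and r: "r \<in> Hom C y x" and ri: "r \<cdot> i = Ident C x"
  shows "injective C x"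
  unfolding injective_def
proof (intro conjI allI impI)
  show "x \<in> Obj C" using i by (auto simp: in_Hom)
  fix f g assume fg: "monic C f \<and> g \<in> Hom C (Dom C f) x"
  then have "i \<cdot> g \<in> Hom C (Dom C f) y" using i by (auto simp: in_Hom)
  then obtain h where h: "h \<in> Hom C (Cod C f) y" "h \<cdot> f = i \<cdot> g"
    using y fg unfolding injective_def by blast
  have "(r \<cdot> h) \<cdot> f = r \<cdot> i \<cdot> g" using h r fg by (simp add: in_Hom monic_def)
  also have "\<dots> = g" using Comp_reassoc[OF ri, of g] i r fg by (auto simp: in_Hom)
  finally show "\<exists>h\<in>Hom C (Cod C f) x. h \<cdot> f = g"
    using h(1) r by (intro bexI[of _ "r \<cdot> h"]) (auto simp: in_Hom)
qed

text \<open>The retraction is the copairing of the identity of \<open>x\<close> with some arrow out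
  of the complement; \<open>ne\<close> provides that arrow, whichever it is.\<close>

lemma direct_summand_retract:
  assumes "direct_summand C x y" and ne: "\<And>z. z \<in> Obj C \<Longrightarrow> Hom C z x \<noteq> {}"
  obtains i r where "i \<in> Hom C x y" "r \<in> Hom C y x" "r \<cdot> i = Ident C x"
proof -
  let ?X = "\<lambda>z b. if b then x else z"
  obtain z \<iota> where "is_product (op_cat C) UNIV (?X z) y \<iota>"
    using assms(1) by (auto simp: direct_summand_def is_coproduct_def)
  note p = is_productD[OF this, simplified]
  have x: "x \<in> Obj C" and z: "z \<in> Obj C" using p(2)[of True] p(2)[of False] by auto
  obtain n where "n \<in> Hom C z x" using ne[OF z] by blast
  then have "\<And>b. (if b then Ident C x else n) \<in> Hom C (?X z b) x"
    using x by (auto simp: in_Hom)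
  then obtain r where "r \<in> Hom C y x" "\<And>b. r \<cdot> \<iota> b = (if b then Ident C x else n)"
    using p(4)[of x "\<lambda>b. if b then Ident C x else n"] x by auto
  then show thesis using p(3)[of True] by (intro that[of "\<iota> True" r]) simp_all
qed

lemma zero_arrowE:
  assumes "zero_arrow C f"
  obtains z g h where "zero_object C z" "z \<in> Obj C" "f \<in> Arr C" "g \<in> Arr C" "h \<in> Arr C"
    "Dom C g = Dom C f" "Cod C g = z" "Dom C h = z" "Cod C h = Cod C f" "f = h \<cdot> g"
proof -
  obtain z g h where *: "zero_object C z" "g \<in> Hom C (Dom C f) z" "h \<in> Hom C z (Cod C f)" "f = h \<cdot> g"
    using assms by (auto simp: zero_arrow_def)
  have g: "g \<in> Arr C" "Dom C g = Dom C f" "Cod C g = z"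
    and h: "h \<in> Arr C" "Dom C h = z" "Cod C h = Cod C f"
    using *(2,3) by (simp_all add: in_Hom)
  have "f \<in> Arr C" by (subst *(4)) (simp add: g h)
  moreover have "z \<in> Obj C" using *(1) by (simp add: zero_object_def)
  ultimately show thesis using *(1,4) g h by (intro that)
qed

lemma zero_arrowI:
  assumes "zero_object C z" "g \<in> Arr C" "h \<in> Arr C" "Cod C g = z" "Dom C h = z"
  shows "zero_arrow C (h \<cdot> g)"
  unfolding zero_arrow_def using assms by (intro exI[of _ z] exI[of _ g] exI[of _ h]) (simp add: in_Hom)

lemma zero_objectD:
  assumes "zero_object C z" "x \<in> Obj C"
  shows "\<exists>f\<in>Arr C. Dom C f = x \<and> Cod C f = z" "\<exists>f\<in>Arr C. Dom C f = z \<and> Cod C f = x"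
    "\<And>f g. f \<in> Arr C \<Longrightarrow> g \<in> Arr C \<Longrightarrow> Dom C f = x \<Longrightarrow> Dom C g = x \<Longrightarrow> Cod C f = z \<Longrightarrow> Cod C g = z \<Longrightarrow> f = g"
    "\<And>f g. f \<in> Arr C \<Longrightarrow> g \<in> Arr C \<Longrightarrow> Cod C f = x \<Longrightarrow> Cod C g = x \<Longrightarrow> Dom C f = z \<Longrightarrow> Dom C g = z \<Longrightarrow> f = g"
proof -
  have 1: "\<exists>!f. f \<in> Hom C x z" and 2: "\<exists>!f. f \<in> Hom C z x"
    using assms by (auto simp: zero_object_def)
  show "\<exists>f\<in>Arr C. Dom C f = x \<and> Cod C f = z" "\<exists>f\<in>Arr C. Dom C f = z \<and> Cod C f = x"
    using 1 2 unfolding in_Hom by blast+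
  show "f = g" if "f \<in> Arr C" "g \<in> Arr C" "Dom C f = x" "Dom C g = x" "Cod C f = z" "Cod C g = z" for f g
    using 1 that unfolding in_Hom by blast
  show "f = g" if "f \<in> Arr C" "g \<in> Arr C" "Cod C f = x" "Cod C g = x" "Dom C f = z" "Dom C g = z" for f g
    using 2 that unfolding in_Hom by blast
qed

lemma zero_arrow_exists:
  assumes "zero_object C z" "x \<in> Obj C" "y \<in> Obj C"
  shows "\<exists>f\<in>Hom C x y. zero_arrow C f"
proof -
  obtain g where g: "g \<in> Arr C" "Dom C g = x" "Cod C g = z"
    using zero_objectD(1)[OF assms(1,2)] by blast
  obtain h where h: "h \<in> Arr C" "Dom C h = z" "Cod C h = y"
    using zero_objectD(2)[OF assms(1,3)] by blast
  from g h show ?thesis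
    by (intro bexI[of _ "h \<cdot> g"] zero_arrowI[OF assms(1)]) (simp_all add: in_Hom)
qed

lemma zero_arrow_Comp_left:
  assumes "zero_arrow C f" "g \<in> Arr C" "Dom C g = Cod C f"
  shows "zero_arrow C (g \<cdot> f)"
proof -
  obtain z p q where f: "zero_object C z" "p \<in> Arr C" "q \<in> Arr C"
    "Dom C p = Dom C f" "Cod C p = z" "Dom C q = z" "Cod C q = Cod C f" "f = q \<cdot> p"
    using assms(1) by (rule zero_arrowE)
  have "zero_arrow C ((g \<cdot> q) \<cdot> p)" using f(1-7) assms(2,3) by (intro zero_arrowI) simp_all
  moreover have "(g \<cdot> q) \<cdot> p = g \<cdot> f" using f(1-7) assms(2,3) by (subst f(8)) simp
  ultimately show ?thesis by simp
qed

lemma zero_arrow_Comp_right: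
  assumes "zero_arrow C f" "g \<in> Arr C" "Cod C g = Dom C f"
  shows "zero_arrow C (f \<cdot> g)"
proof -
  obtain z p q where f: "zero_object C z" "p \<in> Arr C" "q \<in> Arr C"
    "Dom C p = Dom C f" "Cod C p = z" "Dom C q = z" "Cod C q = Cod C f" "f = q \<cdot> p"
    using assms(1) by (rule zero_arrowE)
  have "zero_arrow C (q \<cdot> (p \<cdot> g))" using f(1-7) assms(2,3) by (intro zero_arrowI) simp_all
  moreover have "q \<cdot> (p \<cdot> g) = f \<cdot> g" using f(1-7) assms(2,3) by (subst f(8)) simp
  ultimately show ?thesis by simp
qed

lemma zero_arrow_unique:
  assumes "zero_arrow C f" "zero_arrow C g" "Dom C f = Dom C g" "Cod C f = Cod C g"
  shows "f = g"
proof -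
  obtain z p q where f: "zero_object C z" "z \<in> Obj C" "p \<in> Arr C" "q \<in> Arr C"
    "Dom C p = Dom C f" "Cod C p = z" "Dom C q = z" "Cod C q = Cod C f" "f = q \<cdot> p" and fA: "f \<in> Arr C"
    using assms(1) by (rule zero_arrowE)
  obtain w r s where g: "zero_object C w" "w \<in> Obj C" "r \<in> Arr C" "s \<in> Arr C"
    "Dom C r = Dom C g" "Cod C r = w" "Dom C s = w" "Cod C s = Cod C g" "g = s \<cdot> r" and gA: "g \<in> Arr C"
    using assms(2) by (rule zero_arrowE)
  \<comment> \<open>The two arrows may factor through different zero objects; \<open>u\<close>
    compares these and turns one factorisation into the other.\<close>
  obtain u where u: "u \<in> Arr C" "Dom C u = z" "Cod C u = w"
    using zero_objectD(1)[OF g(1) f(2)] by blast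
  have 1: "u \<cdot> p = r"
    by (rule zero_objectD(3)[OF g(1) Dom_Obj[OF fA]]) (use f(1-8) g(1-8) u assms(3,4) in simp_all)
  have 2: "q = s \<cdot> u"
    by (rule zero_objectD(4)[OF f(1) Cod_Obj[OF fA]]) (use f(1-8) g(1-8) u assms(3,4) in simp_all)
  have "f = s \<cdot> u \<cdot> p" using f(1-8) g(1-8) u by (subst f(9)) (simp add: 2)
  then show ?thesis by (subst g(9)) (simp add: 1)
qed

lemma is_kernelD:
  assumes "is_kernel C k f"
  shows "k \<in> Arr C" "f \<in> Arr C" "Cod C k = Dom C f" "zero_arrow C (f \<cdot> k)"
    "\<And>g. g \<in> Arr C \<Longrightarrow> Cod C g = Dom C f \<Longrightarrow> zero_arrow C (f \<cdot> g)
       \<Longrightarrow> \<exists>h. h \<in> Arr C \<and> Dom C h = Dom C g \<and> Cod C h = Dom C k \<and> k \<cdot> h = g"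
    "monic C k"
proof -
  show 1: "k \<in> Arr C" "f \<in> Arr C" "Cod C k = Dom C f" "zero_arrow C (f \<cdot> k)"
    using assms by (auto simp: is_kernel_def)
  have U: "\<exists>!h. h \<in> Hom C (Dom C g) (Dom C k) \<and> k \<cdot> h = g"
    if "g \<in> Arr C" "Cod C g = Dom C f" "zero_arrow C (f \<cdot> g)" for g
    using assms that by (simp add: is_kernel_def)
  then show "\<exists>h. h \<in> Arr C \<and> Dom C h = Dom C g \<and> Cod C h = Dom C k \<and> k \<cdot> h = g"
    if "g \<in> Arr C" "Cod C g = Dom C f" "zero_arrow C (f \<cdot> g)" for g
    using that unfolding in_Hom by metis
  show "monic C k"
    unfolding monic_def
  proof (intro conjI ballI impI 1)
    fix g h assume A: "g \<in> Arr C" "h \<in> Arr C"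
      "Dom C g = Dom C h \<and> Cod C g = Dom C k \<and> Cod C h = Dom C k \<and> k \<cdot> g = k \<cdot> h"
    have "zero_arrow C (f \<cdot> k \<cdot> g)" using zero_arrow_Comp_right[OF 1(4), of g] A 1 by simp
    then have "\<exists>!j. j \<in> Hom C (Dom C g) (Dom C k) \<and> k \<cdot> j = k \<cdot> g"
      using U[of "k \<cdot> g"] A 1 by simp
    then show "g = h" using A by (auto simp: in_Hom)
  qed
qed

end

section \<open>Zero arrows and differences in hom groups\<close>

context preadditive
begin

lemma zero_in_Hom:
  assumes "x \<in> Obj C" "y \<in> Obj C"
  shows "zero x y \<in> Hom C x y"
proof -
  interpret G: comm_group "\<lparr>carrier = Hom C x y, mult = add, one = zero x y\<rparr>"
    using assms by (rule Hom_comm_group)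
  show ?thesis using G.one_closed by simp
qed

lemma add_in_Hom:
  assumes "f \<in> Hom C x y" "g \<in> Hom C x y"
  shows "add f g \<in> Hom C x y"
proof -
  have "x \<in> Obj C" "y \<in> Obj C" using assms by (auto simp: in_Hom)
  then interpret G: comm_group "\<lparr>carrier = Hom C x y, mult = add, one = zero x y\<rparr>" by (rule Hom_comm_group)
  show ?thesis using G.m_closed assms by simp
qed

text \<open>Cancellation in the hom group. It recognises a vanishing arrow without any
  subtraction.\<close>

lemma add_right_eq_self:
  assumes "f \<in> Hom C x y" "g \<in> Hom C x y" "add f g = g"
  shows "f = zero x y"
proof -
  have "x \<in> Obj C" "y \<in> Obj C" using assms by (auto simp: in_Hom)
  then interpret G: comm_group "\<lparr>carrier = Hom C x y, mult = add, one = zero x y\<rparr>" by (rule Hom_comm_group)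
  show ?thesis using G.r_cancel_one'[of g f] assms by auto
qed

lemma add_zero:
  assumes "f \<in> Hom C x y"
  shows "add (zero x y) f = f" "add f (zero x y) = f"
proof -
  have "x \<in> Obj C" "y \<in> Obj C" using assms by (auto simp: in_Hom)
  then interpret G: comm_group "\<lparr>carrier = Hom C x y, mult = add, one = zero x y\<rparr>" by (rule Hom_comm_group)
  show "add (zero x y) f = f" "add f (zero x y) = f" using G.l_one G.r_one assms by auto
qed

text \<open>The signature has no subtraction; a solution \<open>d\<close> of this equation plays the
  role of \<open>f - g\<close>.\<close>

lemma difference_exists:
  assumes "f \<in> Hom C x y" "g \<in> Hom C x y"
  shows "\<exists>d\<in>Hom C x y. add d g = f"
proof -
  have "x \<in> Obj C" "y \<in> Obj C" using assms by (auto simp: in_Hom)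
  then interpret G: comm_group "\<lparr>carrier = Hom C x y, mult = add, one = zero x y\<rparr>" by (rule Hom_comm_group)
  let ?i = "inv\<^bsub>\<lparr>carrier = Hom C x y, mult = add, one = zero x y\<rparr>\<^esub> g"
  have i: "?i \<in> Hom C x y" using G.inv_closed assms by simp
  have "add (add f ?i) g = f"
    using G.m_assoc[of f ?i g] G.l_inv[of g] G.r_one[of f] i assms by simp
  then show ?thesis using add_in_Hom[OF assms(1) i] by blast
qed

text \<open>Reconciles the two notions of zero: factoring through a zero object, as in the
  definition of kernels, and being neutral in the hom group. Composing with a neutral arrow into
  \<open>z\<close> gives one that is both, and zero arrows are unique.\<close>

lemma zero_arrow_iff:
  assumes z: "zero_object C z" and f: "f \<in> Hom C x y"
  shows "zero_arrow C f \<longleftrightarrow> f = zero x y"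
proof -
  have xy: "x \<in> Obj C" "y \<in> Obj C" using f by (auto simp: in_Hom)
  have zz: "z \<in> Obj C" using z by (simp add: zero_object_def)
  obtain g where g: "g \<in> Arr C" "Dom C g = z" "Cod C g = y" using zero_objectD(2)[OF z xy(2)] by blast
  have 0: "zero x z \<in> Hom C x z" by (rule zero_in_Hom[OF xy(1) zz])
  have "g \<cdot> add (zero x z) (zero x z) = add (g \<cdot> zero x z) (g \<cdot> zero x z)"
    using 0 g by (intro Comp_add_right) (auto simp: in_Hom)
  then have "g \<cdot> zero x z = zero x y"
    using 0 g add_zero[OF 0] by (intro add_right_eq_self[of _ _ _ "g \<cdot> zero x z"]) (auto simp: in_Hom)
  moreover have "zero_arrow C (g \<cdot> zero x z)" using 0 g by (intro zero_arrowI[OF z]) (auto simp: in_Hom)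
  ultimately have "zero_arrow C (zero x y)" by simp
  then show ?thesis
    using zero_arrow_unique[of f "zero x y"] f zero_in_Hom[OF xy] by (auto simp: in_Hom)
qed

end

section \<open>Monomorphisms and split sequences in an abelian category\<close>

context abelian_category
begin

text \<open>The difference of two arrows that \<open>f\<close> identifies factors through
  \<open>k\<close>, hence vanishes.\<close>

lemma zero_kernel_monic:
  assumes k: "is_kernel C k f" and 0: "zero_arrow C k"
  shows "monic C f"
  unfolding monic_def
proof (intro conjI ballI impI)
  note K = is_kernelD[OF k]
  show f: "f \<in> Arr C" by (rule K)
  fix g h assume A: "g \<in> Arr C" "h \<in> Arr C"
    "Dom C g = Dom C h \<and> Cod C g = Dom C f \<and> Cod C h = Dom C f \<and> f \<cdot> g = f \<cdot> h"
  obtain add zero where "preadditive C add zero" using additive by blast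
  then interpret preadditive C add zero .
  obtain z where z: "zero_object C z" using zero_object_exists by blast
  let ?x = "Dom C g" and ?y = "Dom C f"
  have g: "g \<in> Hom C ?x ?y" and h: "h \<in> Hom C ?x ?y" and fH: "f \<in> Hom C ?y (Cod C f)"
    using A f by (auto simp: in_Hom)
  obtain d where d: "d \<in> Hom C ?x ?y" "add d h = g" using difference_exists[OF g h] by blast
  have "f \<cdot> g = add (f \<cdot> d) (f \<cdot> h)" using Comp_add_right[OF d(1) h fH] d(2) by simp
  then have "f \<cdot> d = zero ?x (Cod C f)"
    using Comp_Hom[OF d(1) fH] Comp_Hom[OF h fH] A by (intro add_right_eq_self[of _ _ _ "f \<cdot> h"]) auto
  then have "zero_arrow C (f \<cdot> d)" using zero_arrow_iff[OF z Comp_Hom[OF d(1) fH]] by simp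
  then obtain j where j: "j \<in> Arr C" "Dom C j = ?x" "Cod C j = Dom C k" "k \<cdot> j = d"
    using K(5)[of d] d(1) by (auto simp: in_Hom)
  have "zero_arrow C d" using zero_arrow_Comp_right[OF 0, of j] j by simp
  then have "d = zero ?x ?y" using zero_arrow_iff[OF z d(1)] by simp
  then show "g = h" using d(2) add_zero[OF h] by simp
qed

text \<open>\<open>1 - m r\<close> is killed by \<open>r\<close>, so it factors as
  \<open>k s\<close>. Then \<open>s m = 0\<close>, \<open>s k = 1\<close> and
  \<open>k s + m r = 1\<close>, which makes \<open>p\<close> the direct sum of \<open>x\<close> and
  the kernel; the copairing is \<open>f r + g s\<close>. Existence and uniqueness are separate
  because uniqueness alone says that \<open>m\<close> and \<open>k\<close> are jointly epic.\<close>

lemma kernel_of_retraction: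
  assumes m: "m \<in> Hom C x p" and r: "r \<in> Hom C p x" and rm: "r \<cdot> m = Ident C x" and k: "is_kernel C k r"
  shows "\<And>q f g. f \<in> Hom C x q \<Longrightarrow> g \<in> Hom C (Dom C k) q \<Longrightarrow> \<exists>h\<in>Hom C p q. h \<cdot> m = f \<and> h \<cdot> k = g"
    and "\<And>h h'. h \<in> Arr C \<Longrightarrow> h' \<in> Arr C \<Longrightarrow> Dom C h = p \<Longrightarrow> Dom C h' = p \<Longrightarrow> Cod C h = Cod C h'
      \<Longrightarrow> h \<cdot> m = h' \<cdot> m \<Longrightarrow> h \<cdot> k = h' \<cdot> k \<Longrightarrow> h = h'"
proof -
  note K = is_kernelD[OF k]
  have [simp]: "m \<in> Arr C" "Dom C m = x" "Cod C m = p" "r \<in> Arr C" "Dom C r = p" "Cod C r = x"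
    "k \<in> Arr C" "Cod C k = p"
    using m r K by (auto simp: in_Hom)
  have [simp]: "x \<in> Obj C" "p \<in> Obj C" using Dom_Obj[of m] Dom_Obj[of r] by simp_all
  have kH: "k \<in> Hom C (Dom C k) p" by (simp add: in_Hom)
  obtain add zero where "preadditive C add zero" using additive by blast
  then interpret preadditive C add zero .
  obtain z where z: "zero_object C z" using zero_object_exists by blast
  have 1: "Ident C p \<in> Hom C p p" "m \<cdot> r \<in> Hom C p p" by (simp_all add: in_Hom)
  obtain e where e: "e \<in> Hom C p p" "add e (m \<cdot> r) = Ident C p" using difference_exists[OF 1] by blast
  have "r \<cdot> add e (m \<cdot> r) = add (r \<cdot> e) (r \<cdot> m \<cdot> r)" by (rule Comp_add_right[OF e(1) 1(2) r])
  then have "add (r \<cdot> e) r = r" using Comp_reassoc[OF rm, of r] e(2) by simp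
  then have "r \<cdot> e = zero p x" using add_right_eq_self[OF Comp_Hom[OF e(1) r] r] by simp
  then have "zero_arrow C (r \<cdot> e)" using zero_arrow_iff[OF z Comp_Hom[OF e(1) r]] by simp
  then obtain s where s: "s \<in> Arr C" "Dom C s = p" "Cod C s = Dom C k" "k \<cdot> s = e"
    using K(5)[of e] e(1) by (auto simp: in_Hom)
  note [simp] = s(1-3)
  have d: "add (k \<cdot> s) (m \<cdot> r) = Ident C p" using s(4) e(2) by simp
  have ks: "k \<cdot> s \<in> Hom C p p" by (simp add: in_Hom)
  have "add (k \<cdot> s) (m \<cdot> r) \<cdot> m = add ((k \<cdot> s) \<cdot> m) ((m \<cdot> r) \<cdot> m)" by (rule Comp_add_left[OF m ks 1(2)])
  then have "add (k \<cdot> s \<cdot> m) m = m" by (simp add: d rm)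
  then have "k \<cdot> s \<cdot> m = zero x p" by (intro add_right_eq_self[OF _ m]) (simp_all add: in_Hom)
  moreover have "k \<cdot> s \<cdot> m \<in> Hom C x p" by (simp add: in_Hom)
  ultimately have ksm: "zero_arrow C (k \<cdot> s \<cdot> m)" using zero_arrow_iff[OF z] by metis
  \<comment> \<open>A zero arrow to compare \<open>s \<cdot> m\<close> with: \<open>k\<close> sends
    both to zero, and \<open>k\<close> is monic.\<close>
  obtain n where n: "n \<in> Hom C x (Dom C k)" "zero_arrow C n" using zero_arrow_exists[OF z, of x "Dom C k"] by auto
  have nA: "n \<in> Arr C" "Dom C n = x" "Cod C n = Dom C k" using n(1) by (simp_all add: in_Hom)
  have "zero_arrow C (k \<cdot> n)" by (rule zero_arrow_Comp_left[OF n(2)]) (simp_all add: nA)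
  then have "k \<cdot> s \<cdot> m = k \<cdot> n" by (rule zero_arrow_unique[OF ksm]) (simp_all add: nA)
  then have "s \<cdot> m = n" by (rule monicD[OF K(6)]) (simp_all add: nA)
  then have sm: "zero_arrow C (s \<cdot> m)" using n(2) by simp
  have "zero_arrow C (m \<cdot> r \<cdot> k)" by (rule zero_arrow_Comp_left[OF K(4)]) simp_all
  then have mrk: "m \<cdot> r \<cdot> k = zero (Dom C k) p"
    using zero_arrow_iff[OF z, of "m \<cdot> r \<cdot> k" "Dom C k" p] by (simp add: in_Hom)
  have "k = add (k \<cdot> s) (m \<cdot> r) \<cdot> k" by (simp add: d)
  also have "\<dots> = add ((k \<cdot> s) \<cdot> k) ((m \<cdot> r) \<cdot> k)" by (rule Comp_add_left[OF kH ks 1(2)])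
  also have "\<dots> = k \<cdot> s \<cdot> k"
    using add_zero(2)[of "k \<cdot> s \<cdot> k" "Dom C k" p] by (simp add: mrk in_Hom)
  finally have "k \<cdot> s \<cdot> k = k \<cdot> Ident C (Dom C k)" by simp
  then have sk: "s \<cdot> k = Ident C (Dom C k)" by (rule monicD[OF K(6)]) simp_all
  show "\<exists>h\<in>Hom C p q. h \<cdot> m = f \<and> h \<cdot> k = g" if f: "f \<in> Hom C x q" and g: "g \<in> Hom C (Dom C k) q" for q f g
  proof (intro bexI conjI)
    have [simp]: "f \<in> Arr C" "Dom C f = x" "Cod C f = q" "g \<in> Arr C" "Dom C g = Dom C k" "Cod C g = q"
      using f g by (auto simp: in_Hom)
    have fr: "f \<cdot> r \<in> Hom C p q" and gs: "g \<cdot> s \<in> Hom C p q" by (simp_all add: in_Hom)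
    show "add (f \<cdot> r) (g \<cdot> s) \<in> Hom C p q" by (rule add_in_Hom[OF fr gs])
    have "zero_arrow C (g \<cdot> s \<cdot> m)" by (rule zero_arrow_Comp_left[OF sm]) simp_all
    then have "g \<cdot> s \<cdot> m = zero x q" using zero_arrow_iff[OF z, of "g \<cdot> s \<cdot> m" x q] by (simp add: in_Hom)
    then show "add (f \<cdot> r) (g \<cdot> s) \<cdot> m = f"
      using Comp_add_left[OF m fr gs] add_zero(2)[OF f] by (simp add: rm)
    have "zero_arrow C (f \<cdot> r \<cdot> k)" by (rule zero_arrow_Comp_left[OF K(4)]) simp_all
    then have "f \<cdot> r \<cdot> k = zero (Dom C k) q" using zero_arrow_iff[OF z, of "f \<cdot> r \<cdot> k" "Dom C k" q] by (simp add: in_Hom)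
    then show "add (f \<cdot> r) (g \<cdot> s) \<cdot> k = g"
      using Comp_add_left[OF kH fr gs] add_zero(1)[OF g] by (simp add: sk)
  qed
  show "h = h'" if [simp]: "h \<in> Arr C" "h' \<in> Arr C" "Dom C h = p" "Dom C h' = p" "Cod C h = Cod C h'"
    and eq: "h \<cdot> m = h' \<cdot> m" "h \<cdot> k = h' \<cdot> k" for h h'
  proof -
    have "h \<cdot> add (k \<cdot> s) (m \<cdot> r) = add (h \<cdot> k \<cdot> s) (h \<cdot> m \<cdot> r)"
      "h' \<cdot> add (k \<cdot> s) (m \<cdot> r) = add (h' \<cdot> k \<cdot> s) (h' \<cdot> m \<cdot> r)"
      by (rule Comp_add_right[OF ks 1(2), of _ "Cod C h'"]; simp add: in_Hom)+
    moreover have "h \<cdot> k \<cdot> s = h' \<cdot> k \<cdot> s" "h \<cdot> m \<cdot> r = h' \<cdot> m \<cdot> r"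
      using Comp_reassoc[OF eq(2), of s] Comp_reassoc[OF eq(1), of r] by simp_all
    ultimately show ?thesis unfolding d by simp
  qed
qed

end

text \<open>A product is a limit over a discrete category. Using the indices themselves as identity
  arrows keeps that category inside the type on which \<open>small\<close> is defined.\<close>

lemma (in category) small_product_exists:
  assumes comp: "small_complete small C" and I: "small I" and X: "\<And>i. i \<in> I \<Longrightarrow> X i \<in> Obj C"
  shows "\<exists>P p. is_product C I X P p"
proof -
  define J where "J = \<lparr>Obj = I, Arr = I, Dom = (\<lambda>i. i), Cod = (\<lambda>i. i), Ident = (\<lambda>i. i), Comp = (\<lambda>j i. i)\<rparr>"
  let ?F = "\<lambda>i. Ident C (X i)"
  have J: "Obj J = I" "Arr J = I" "Dom J i = i" "Cod J i = i" "Ident J i = i" "Comp J j i = i" for i j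
    by (simp_all add: J_def)
  have "category J" by standard (auto simp: in_Hom J)
  moreover have "is_functor J C X ?F" using X by (auto simp: is_functor_def in_Hom J)
  ultimately obtain P p where P: "is_limit J C X ?F P p"
    using comp I unfolding small_complete_def by (metis J(1,2))
  have c: "is_cone J C X ?F Q q \<longleftrightarrow> Q \<in> Obj C \<and> (\<forall>i\<in>I. q i \<in> Hom C Q (X i))" for Q q
    using X by (auto simp: is_cone_def J in_Hom)
  have "is_product C I X P p"
    using P X unfolding is_limit_def c is_product_def by (auto simp: J)
  then show ?thesis by blast
qed

section \<open>Pointwise products of modules\<close>

context symmetric_closed_monoidal_category
begin

text \<open>\<open>u \<otimes> -\<close> is a left adjoint: transposed, both arrows start at
  \<open>p\<close>, where \<open>epi\<close> compares them. The symmetry enters because the inner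
  hom is adjoint to tensoring on the other side. The index set may be empty, in which case
  \<open>epi\<close> says that parallel arrows out of \<open>p\<close> are equal.\<close>

lemma tensor_jointly_epic:
  assumes epi: "\<And>h h'. h \<in> Arr V \<Longrightarrow> h' \<in> Arr V \<Longrightarrow> Dom V h = p \<Longrightarrow> Dom V h' = p \<Longrightarrow> Cod V h = Cod V h'
      \<Longrightarrow> (\<And>j. j \<in> J \<Longrightarrow> h \<cdot> m j = h' \<cdot> m j) \<Longrightarrow> h = h'"
    and [simp]: "u \<in> Obj V" "p \<in> Obj V"
    and m [simp]: "\<And>j. j \<in> J \<Longrightarrow> m j \<in> Arr V" "\<And>j. j \<in> J \<Longrightarrow> Cod V (m j) = p"
    and [simp]: "f \<in> Arr V" "g \<in> Arr V" "Dom V f = u \<boxtimes> p" "Dom V g = u \<boxtimes> p" "Cod V f = Cod V g"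
    and eq: "\<And>j. j \<in> J \<Longrightarrow> f \<cdot> (Ident V u \<boxdot> m j) = g \<cdot> (Ident V u \<boxdot> m j)"
  shows "f = g"
proof -
  let ?c = "\<lambda>f. curry_arrow V p u (Cod V g) (f \<cdot> Sym V p u)"
  have "?c f \<cdot> m j = ?c g \<cdot> m j" if j: "j \<in> J" for j
  proof (rule uncurry_inject)
    have *: "uncurry_arrow V u (Cod V g) (?c h \<cdot> m j) = (h \<cdot> (Ident V u \<boxdot> m j)) \<cdot> Sym V (Dom V (m j)) u"
      if [simp]: "h \<in> Arr V" "Dom V h = u \<boxtimes> p" "Cod V h = Cod V g" for h
      using j by (simp add: uncurry_Comp Sym_nat)
    show "uncurry_arrow V u (Cod V g) (?c f \<cdot> m j) = uncurry_arrow V u (Cod V g) (?c g \<cdot> m j)"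
      by (subst (1 2) *) (simp_all only: eq[OF j], simp_all)
  qed (use j in simp_all)
  then have "?c f = ?c g" by (rule epi[rotated 5]) simp_all
  then have "uncurry_arrow V u (Cod V g) (?c f) = uncurry_arrow V u (Cod V g) (?c g)" by simp
  then have "f \<cdot> Sym V p u = g \<cdot> Sym V p u" by simp
  then show ?thesis by (rule iso_cancel_right[OF Sym_iso, rotated 2]) simp_all
qed

text \<open>Parallel arrows out of \<open>u \<otimes> z\<close> agree when \<open>z\<close> is a
  zero object, so the whiskered second factor of \<open>f\<close> is itself a zero arrow.\<close>

lemma zero_arrow_whisker_left:
  assumes f: "zero_arrow V f" and u [simp]: "u \<in> Obj V"
  shows "zero_arrow V (Ident V u \<boxdot> f)"
proof -
  obtain z g h where z: "zero_object V z" "z \<in> Obj V" and fA: "f \<in> Arr V"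
    and gh [simp]: "g \<in> Arr V" "h \<in> Arr V" "Cod V g = z" "Dom V h = z" and fgh: "f = h \<cdot> g"
    using f by (rule zero_arrowE) blast
  note [simp] = z(2)
  obtain n where n: "n \<in> Hom V (u \<boxtimes> z) (u \<boxtimes> Cod V h)" "zero_arrow V n"
    using zero_arrow_exists[OF z(1), of "u \<boxtimes> z" "u \<boxtimes> Cod V h"] by auto
  have "Ident V u \<boxdot> h = n"
  \<comment> \<open>Initiality of \<open>z\<close> is joint epicness of the empty family; the value
    given for \<open>m\<close> is a dummy.\<close>
  proof (rule tensor_jointly_epic[where J = "{}" and p = z and u = u and m = "\<lambda>_::unit. n"])
    show "k = k'" if "k \<in> Arr V" "k' \<in> Arr V" "Dom V k = z" "Dom V k' = z" "Cod V k = Cod V k'" for k k'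
      by (rule zero_objectD(4)[OF z(1) Cod_Obj[of k']]) (use that in simp_all)
  qed (use n in \<open>auto simp: in_Hom\<close>)
  then have "zero_arrow V (Ident V u \<boxdot> h)" using n(2) by simp
  then have "zero_arrow V ((Ident V u \<boxdot> h) \<cdot> (Ident V u \<boxdot> g))"
    by (rule zero_arrow_Comp_right) simp_all
  then show ?thesis by (simp add: fgh whisker_left_Comp)
qed

end

context enriched_over_closed
begin

text \<open>The laws hold after composing with each \<open>p j\<close>, because they hold in the
  modules \<open>M j\<close>, and the \<open>p j\<close> are jointly monic. It serves products, with
  the projections, and kernels, with the single inclusion.\<close>

lemma is_action_jointly_monic:
  assumes X [simp]: "\<And>x. x \<in> EObj C \<Longrightarrow> X x \<in> Obj V"
    and \<mu>: "\<And>x y. x \<in> EObj C \<Longrightarrow> y \<in> EObj C \<Longrightarrow> \<mu> x y \<in> Hom V (EHom C x y \<boxtimes> X x) (X y)"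
    and M: "\<And>j. j \<in> J \<Longrightarrow> enriched_functor V C (self_enriched V) (M j)"
    and p: "\<And>j x. j \<in> J \<Longrightarrow> x \<in> EObj C \<Longrightarrow> p j x \<in> Hom V (X x) (FObj (M j) x)"
    and eq: "\<And>j x y. j \<in> J \<Longrightarrow> x \<in> EObj C \<Longrightarrow> y \<in> EObj C \<Longrightarrow>
      p j y \<cdot> \<mu> x y = act (M j) x y \<cdot> (Ident V (EHom C x y) \<boxdot> p j x)"
    and mono: "\<And>x f g. x \<in> EObj C \<Longrightarrow> f \<in> Arr V \<Longrightarrow> g \<in> Arr V \<Longrightarrow> Dom V f = Dom V g \<Longrightarrow>
      Cod V f = X x \<Longrightarrow> Cod V g = X x \<Longrightarrow> (\<And>j. j \<in> J \<Longrightarrow> p j x \<cdot> f = p j x \<cdot> g) \<Longrightarrow> f = g"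
  shows "is_action X \<mu>"
proof -
  have m [simp]: "\<mu> x y \<in> Arr V" "Dom V (\<mu> x y) = EHom C x y \<boxtimes> X x" "Cod V (\<mu> x y) = X y"
    if "x \<in> EObj C" "y \<in> EObj C" for x y
    using \<mu>[OF that] by (auto simp: in_Hom)
  have p' [simp]: "p j x \<in> Arr V" "Dom V (p j x) = X x" "Cod V (p j x) = FObj (M j) x"
    if "j \<in> J" "x \<in> EObj C" for j x
    using p[OF that] by (auto simp: in_Hom)
  show ?thesis
    unfolding is_action_def
  proof (intro conjI ballI)
    fix x y z assume [simp]: "x \<in> EObj C" "y \<in> EObj C" "z \<in> EObj C"
    let ?A = "EHom C y z" and ?B = "EHom C x y"
    show "\<mu> x z \<cdot> (EComp C x y z \<boxdot> Ident V (X x)) = \<mu> y z \<cdot> (Ident V ?A \<boxdot> \<mu> x y) \<cdot> Assoc V ?A ?B (X x)"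
    proof (rule mono[of z])
      fix j assume j [simp]: "j \<in> J"
      note [simp] = M[OF j]
      have a: "act (M j) x z \<cdot> (EComp C x y z \<boxdot> Ident V (FObj (M j) x))
          = act (M j) y z \<cdot> (Ident V ?A \<boxdot> act (M j) x y) \<cdot> Assoc V ?A ?B (FObj (M j) x)"
        using module_action[of "M j"] by (simp add: is_actionD)
      have "p j z \<cdot> \<mu> x z \<cdot> (EComp C x y z \<boxdot> Ident V (X x))
          = (act (M j) x z \<cdot> (Ident V (EHom C x z) \<boxdot> p j x)) \<cdot> (EComp C x y z \<boxdot> Ident V (X x))"
        by (rule Comp_reassoc[OF eq]) simp_all
      also have "\<dots> = act (M j) x z \<cdot> ((Ident V (EHom C x z) \<boxdot> p j x) \<cdot> (EComp C x y z \<boxdot> Ident V (X x)))"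
        by simp
      also have "(Ident V (EHom C x z) \<boxdot> p j x) \<cdot> (EComp C x y z \<boxdot> Ident V (X x))
          = (EComp C x y z \<boxdot> Ident V (FObj (M j) x)) \<cdot> (Ident V (?A \<boxtimes> ?B) \<boxdot> p j x)"
        by (rule whisker_exchange) simp_all
      also have "act (M j) x z \<cdot> \<dots> = (act (M j) y z \<cdot> (Ident V ?A \<boxdot> act (M j) x y) \<cdot> Assoc V ?A ?B (FObj (M j) x))
          \<cdot> (Ident V (?A \<boxtimes> ?B) \<boxdot> p j x)"
        by (rule Comp_reassoc[OF a]) simp_all
      also have "\<dots> = act (M j) y z \<cdot> (Ident V ?A \<boxdot> (act (M j) x y \<cdot> (Ident V ?B \<boxdot> p j x))) \<cdot> Assoc V ?A ?B (X x)"
        by (simp add: Assoc_nat_Ident whisker_left_Comp)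
      also have "act (M j) x y \<cdot> (Ident V ?B \<boxdot> p j x) = p j y \<cdot> \<mu> x y"
        by (simp add: eq)
      also have "act (M j) y z \<cdot> (Ident V ?A \<boxdot> (p j y \<cdot> \<mu> x y)) \<cdot> Assoc V ?A ?B (X x)
        = (act (M j) y z \<cdot> (Ident V ?A \<boxdot> p j y)) \<cdot> (Ident V ?A \<boxdot> \<mu> x y) \<cdot> Assoc V ?A ?B (X x)"
        by (simp add: whisker_left_Comp)
      also have "\<dots> = (p j z \<cdot> \<mu> y z) \<cdot> (Ident V ?A \<boxdot> \<mu> x y) \<cdot> Assoc V ?A ?B (X x)"
        by (subst eq) simp_all
      finally show "p j z \<cdot> \<mu> x z \<cdot> (EComp C x y z \<boxdot> Ident V (X x))
        = p j z \<cdot> \<mu> y z \<cdot> (Ident V ?A \<boxdot> \<mu> x y) \<cdot> Assoc V ?A ?B (X x)"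
        by simp
    qed simp_all
  next
    fix x assume [simp]: "x \<in> EObj C"
    let ?U = "EHom C x x"
    show "\<mu> x x \<cdot> (EId C x \<boxdot> Ident V (X x)) = LUnit V (X x)"
    proof (rule mono[of x])
      fix j assume j [simp]: "j \<in> J"
      note [simp] = M[OF j]
      have a: "act (M j) x x \<cdot> (EId C x \<boxdot> Ident V (FObj (M j) x)) = LUnit V (FObj (M j) x)"
        using module_action[of "M j"] by (simp add: is_actionD)
      have "p j x \<cdot> \<mu> x x \<cdot> (EId C x \<boxdot> Ident V (X x))
          = (act (M j) x x \<cdot> (Ident V ?U \<boxdot> p j x)) \<cdot> (EId C x \<boxdot> Ident V (X x))"
        by (rule Comp_reassoc[OF eq]) simp_all
      also have "\<dots> = act (M j) x x \<cdot> ((Ident V ?U \<boxdot> p j x) \<cdot> (EId C x \<boxdot> Ident V (X x)))"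
        by simp
      also have "(Ident V ?U \<boxdot> p j x) \<cdot> (EId C x \<boxdot> Ident V (X x))
          = (EId C x \<boxdot> Ident V (FObj (M j) x)) \<cdot> (Ident V (TUnit V) \<boxdot> p j x)"
        by (rule whisker_exchange) simp_all
      also have "act (M j) x x \<cdot> \<dots> = LUnit V (FObj (M j) x) \<cdot> (Ident V (TUnit V) \<boxdot> p j x)"
        by (rule Comp_reassoc[OF a]) simp_all
      finally show "p j x \<cdot> \<mu> x x \<cdot> (EId C x \<boxdot> Ident V (X x)) = p j x \<cdot> LUnit V (X x)"
        by (simp add: LUnit_nat)
    qed simp_all
  qed (simp_all add: in_Hom)
qed

lemma is_product_product_module:
  assumes products: "\<And>X. (\<And>i. i \<in> I \<Longrightarrow> X i \<in> Obj V) \<Longrightarrow> \<exists>P p. is_product V I X P p"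
    and M [simp]: "\<And>i. i \<in> I \<Longrightarrow> enriched_functor V C (self_enriched V) (M i)"
  shows "\<exists>p. is_product (Mod V C) I M (product_module V C I M) p"
proof -
  let ?X = "\<lambda>x i. FObj (M i) x"
  let ?P = "\<lambda>x. Prod V I (?X x)" and ?p = "\<lambda>i x. Proj V I (?X x) i"
  have prod: "is_product V I (?X x) (?P x) (\<lambda>i. ?p i x)" if "x \<in> EObj C" for x
    using chosen_product[OF products[of "?X x"]] that by simp
  have P [simp]: "?P x \<in> Obj V" if "x \<in> EObj C" for x
    using is_productD(1)[OF prod[OF that]] .
  have p [simp]: "?p i x \<in> Arr V" "Dom V (?p i x) = ?P x" "Cod V (?p i x) = ?X x i" if "i \<in> I" "x \<in> EObj C" for i x
    using is_productD(3)[OF prod[OF that(2)] that(1)] by (auto simp: in_Hom)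
  define \<mu> where "\<mu> x y = tuple_arrow V I (?X y) (EHom C x y \<boxtimes> ?P x)
     (\<lambda>i. act (M i) x y \<cdot> (Ident V (EHom C x y) \<boxdot> ?p i x))" for x y
  have m: "\<mu> x y \<in> Hom V (EHom C x y \<boxtimes> ?P x) (?P y)"
    and pm: "\<And>i. i \<in> I \<Longrightarrow> ?p i y \<cdot> \<mu> x y = act (M i) x y \<cdot> (Ident V (EHom C x y) \<boxdot> ?p i x)"
    if [simp]: "x \<in> EObj C" "y \<in> EObj C" for x y
    unfolding \<mu>_def by (rule tuple_arrow[OF prod]; simp add: in_Hom)+
  have mA [simp]: "\<mu> x y \<in> Arr V" "Dom V (\<mu> x y) = EHom C x y \<boxtimes> ?P x" "Cod V (\<mu> x y) = ?P y"
    if "x \<in> EObj C" "y \<in> EObj C" for x y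
    using m[OF that] by (auto simp: in_Hom)
  have act: "is_action ?P \<mu>"
    by (rule is_action_jointly_monic[where J = I and M = M and p = ?p])
      (use m pm product_jointly_monic[OF prod] in \<open>auto simp: in_Hom\<close>)
  \<comment> \<open>\<open>act\<close> abbreviates exactly the uncurried action that
    \<open>product_module\<close> puts into the tuple, so the two constructions agree
    literally.\<close>
  have eq: "product_module V C I M = action_module ?P \<mu>"
    by (simp add: product_module_def action_module_def \<mu>_def act_def Let_def)
  have PM [simp]: "enriched_functor V C (self_enriched V) (product_module V C I M)"
    by (simp add: eq action_module_Mod act)
  have FP [simp]: "FObj (product_module V C I M) x = ?P x" if "x \<in> EObj C" for x
    using that by (simp add: eq)
  have aP [simp]: "act (product_module V C I M) x y = \<mu> x y" if "x \<in> EObj C" "y \<in> EObj C" for x y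
    using that by (simp add: eq act)
  have e: "equivariant (product_module V C I M) (M i) (?p i)" if "i \<in> I" for i
    using that by (simp add: equivariant_def in_Hom pm)
  let ?\<pi> = "\<lambda>i. family_nat (product_module V C I M) (M i) (?p i)"
  have \<pi>: "?\<pi> i \<in> Hom (Mod V C) (product_module V C I M) (M i)" and c\<pi>: "\<And>x. x \<in> EObj C \<Longrightarrow> cmp (?\<pi> i) x = ?p i x"
    if "i \<in> I" for i
    using family_nat_Hom[OF PM M[OF that] e[OF that]] by auto
  have "is_product (Mod V C) I M (product_module V C I M) ?\<pi>"
    unfolding is_product_def
  proof (intro conjI ballI allI impI)
    show "product_module V C I M \<in> Obj (Mod V C)" by simp
    show "M i \<in> Obj (Mod V C)" if "i \<in> I" for i using that by simp
    show "?\<pi> i \<in> Hom (Mod V C) (product_module V C I M) (M i)" if "i \<in> I" for i by (rule \<pi>[OF that])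
    fix Q q assume "Q \<in> Obj (Mod V C)" and "\<forall>i\<in>I. q i \<in> Hom (Mod V C) Q (M i)"
    then have Q [simp]: "enriched_functor V C (self_enriched V) Q"
      and q: "\<And>i. i \<in> I \<Longrightarrow> q i \<in> Hom (Mod V C) Q (M i)" by auto
    note [simp] = cmp_simps[OF q]
    define h where "h x = tuple_arrow V I (?X x) (FObj Q x) (\<lambda>i. cmp (q i) x)" for x
    have hH: "h x \<in> Hom V (FObj Q x) (?P x)" and ph: "\<And>i. i \<in> I \<Longrightarrow> ?p i x \<cdot> h x = cmp (q i) x"
      if [simp]: "x \<in> EObj C" for x
      unfolding h_def by (rule tuple_arrow[OF prod]; simp add: in_Hom)+
    have hA [simp]: "h x \<in> Arr V" "Dom V (h x) = FObj Q x" "Cod V (h x) = ?P x" if "x \<in> EObj C" for x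
      using hH[OF that] by (auto simp: in_Hom)
    have eh: "equivariant Q (product_module V C I M) h"
      unfolding equivariant_def
    proof (intro conjI ballI)
      fix x y assume [simp]: "x \<in> EObj C" "y \<in> EObj C"
      let ?U = "EHom C x y"
      have "h y \<cdot> act Q x y = \<mu> x y \<cdot> (Ident V ?U \<boxdot> h x)"
      proof (rule product_jointly_monic[OF prod[of y]])
        fix i assume i [simp]: "i \<in> I"
        have "?p i y \<cdot> h y \<cdot> act Q x y = cmp (q i) y \<cdot> act Q x y"
          by (rule Comp_reassoc[OF ph]) simp_all
        also have "\<dots> = act (M i) x y \<cdot> (Ident V ?U \<boxdot> (?p i x \<cdot> h x))"
          by (simp add: cmp_equivariant[OF q] ph)
        also have "\<dots> = (act (M i) x y \<cdot> (Ident V ?U \<boxdot> ?p i x)) \<cdot> (Ident V ?U \<boxdot> h x)"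
          by (simp add: whisker_left_Comp)
        also have "\<dots> = (?p i y \<cdot> \<mu> x y) \<cdot> (Ident V ?U \<boxdot> h x)"
          by (subst pm) simp_all
        finally show "?p i y \<cdot> h y \<cdot> act Q x y = ?p i y \<cdot> \<mu> x y \<cdot> (Ident V ?U \<boxdot> h x)" by simp
      qed simp_all
      then show "h y \<cdot> act Q x y = act (product_module V C I M) x y \<cdot> (Ident V ?U \<boxdot> h x)" by simp
    qed (simp add: in_Hom)
    show "\<exists>!h. h \<in> Hom (Mod V C) Q (product_module V C I M) \<and> (\<forall>i\<in>I. ?\<pi> i \<cdot>\<^bsub>Mod V C\<^esub> h = q i)"
    proof (intro ex1I conjI ballI)
      let ?h = "family_nat Q (product_module V C I M) h"
      note hh = family_nat_Hom[OF Q PM eh]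
      show "?h \<in> Hom (Mod V C) Q (product_module V C I M)" by (rule hh)
      show "?\<pi> i \<cdot>\<^bsub>Mod V C\<^esub> ?h = q i" if i: "i \<in> I" for i
        by (rule Mod_Hom_eqI[OF Mod_Comp(1)[OF hh(1) \<pi>[OF i]] q[OF i]])
          (simp add: cmp_Comp[OF hh(1) \<pi>[OF i]] hh(2) c\<pi>[OF i] ph[OF _ i])
      fix h' assume h': "h' \<in> Hom (Mod V C) Q (product_module V C I M) \<and> (\<forall>i\<in>I. ?\<pi> i \<cdot>\<^bsub>Mod V C\<^esub> h' = q i)"
      then have h'H: "h' \<in> Hom (Mod V C) Q (product_module V C I M)" by simp
      show "h' = ?h"
      proof (rule Mod_Hom_eqI[OF h'H hh(1)])
        fix x assume x [simp]: "x \<in> EObj C"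
        show "cmp h' x = cmp ?h x"
          unfolding hh(2)[OF x]
        proof (rule product_jointly_monic[OF prod[OF x]])
          show "?p i x \<cdot> cmp h' x = ?p i x \<cdot> h x" if i: "i \<in> I" for i
            using cmp_Comp[OF h'H \<pi>[OF i] x] h' i by (simp add: c\<pi> ph)
        qed (simp_all add: cmp_simps[OF h'H])
      qed
    qed
  qed
  then show ?thesis by blast
qed

end

section \<open>Injective modules\<close>

locale enriched_over_abelian = enriched_over_closed V C + abelian_category V
  for V :: "('o, 'm, 'z) precosmos_scheme" (structure) and C :: "('c, 'o, 'm) ecat"
begin

text \<open>Any family of zero arrows is equivariant, since both composites vanish. It is the
  comparison map for monomorphisms and witnesses that hom sets of modules are nonempty.\<close>

lemma zero_module_map:
  assumes [simp]: "enriched_functor V C (self_enriched V) M" "enriched_functor V C (self_enriched V) N"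
  shows "\<exists>t\<in>Hom (Mod V C) M N. \<forall>x\<in>EObj C. zero_arrow V (cmp t x)"
proof -
  obtain z where z: "zero_object V z" using zero_object_exists by blast
  have "\<exists>f. f \<in> Hom V (FObj M x) (FObj N x) \<and> zero_arrow V f" if "x \<in> EObj C" for x
    using zero_arrow_exists[OF z, of "FObj M x" "FObj N x"] that by auto
  then obtain \<tau> where \<tau>: "\<And>x. x \<in> EObj C \<Longrightarrow> \<tau> x \<in> Hom V (FObj M x) (FObj N x)"
    "\<And>x. x \<in> EObj C \<Longrightarrow> zero_arrow V (\<tau> x)"
    by metis
  have [simp]: "\<tau> x \<in> Arr V" "Dom V (\<tau> x) = FObj M x" "Cod V (\<tau> x) = FObj N x" if "x \<in> EObj C" for x
    using \<tau>(1)[OF that] by (auto simp: in_Hom)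
  have e: "equivariant M N \<tau>"
    unfolding equivariant_def
  proof (intro conjI ballI)
    fix x y assume [simp]: "x \<in> EObj C" "y \<in> EObj C"
    show "\<tau> y \<cdot> act M x y = act N x y \<cdot> (Ident V (EHom C x y) \<boxdot> \<tau> x)"
      by (rule zero_arrow_unique)
        (simp_all add: zero_arrow_Comp_right zero_arrow_Comp_left zero_arrow_whisker_left \<tau>)
  qed (simp add: \<tau>)
  show ?thesis
    using family_nat_Hom[OF assms e] \<tau>(2) by (intro bexI[of _ "family_nat M N \<tau>"]) simp_all
qed

text \<open>The action of \<open>M\<close> restricts to the pointwise kernels: by equivariance,
  \<open>t\<close> after acting on the kernel is the action of \<open>N\<close> after a whiskered
  zero arrow, hence zero.\<close>

lemma kernel_module:
  assumes t: "t \<in> Hom (Mod V C) M N"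
  obtains K k where "k \<in> Hom (Mod V C) K M" "\<And>x. x \<in> EObj C \<Longrightarrow> is_kernel V (cmp k x) (cmp t x)"
proof -
  note M [simp] = Mod_HomD(1,2)[OF t] and [simp] = cmp_simps[OF t]
  have "\<exists>k. is_kernel V k (cmp t x)" if "x \<in> EObj C" for x
    using kernel_exists that by simp
  then obtain \<kappa> where \<kappa>: "\<And>x. x \<in> EObj C \<Longrightarrow> is_kernel V (\<kappa> x) (cmp t x)" by metis
  note K = is_kernelD[OF \<kappa>]
  have [simp]: "\<kappa> x \<in> Arr V" "Cod V (\<kappa> x) = FObj M x" if "x \<in> EObj C" for x
    using K(1,3)[OF that] that by simp_all
  have "\<exists>h. h \<in> Arr V \<and> Dom V h = EHom C x y \<boxtimes> Dom V (\<kappa> x) \<and> Cod V h = Dom V (\<kappa> y) \<and>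
      \<kappa> y \<cdot> h = act M x y \<cdot> (Ident V (EHom C x y) \<boxdot> \<kappa> x)"
    if [simp]: "x \<in> EObj C" "y \<in> EObj C" for x y
  proof -
    let ?U = "EHom C x y"
    have "cmp t y \<cdot> act M x y \<cdot> (Ident V ?U \<boxdot> \<kappa> x) = (act N x y \<cdot> (Ident V ?U \<boxdot> cmp t x)) \<cdot> (Ident V ?U \<boxdot> \<kappa> x)"
      by (rule Comp_reassoc[OF cmp_equivariant[OF t]]) simp_all
    also have "\<dots> = act N x y \<cdot> (Ident V ?U \<boxdot> (cmp t x \<cdot> \<kappa> x))"
      by (simp add: whisker_left_Comp)
    finally have "zero_arrow V (cmp t y \<cdot> act M x y \<cdot> (Ident V ?U \<boxdot> \<kappa> x))"
      by (simp add: zero_arrow_Comp_left zero_arrow_whisker_left K(4))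
    then show ?thesis using K(5)[of y "act M x y \<cdot> (Ident V ?U \<boxdot> \<kappa> x)"] by simp
  qed
  then obtain \<mu> where \<mu>: "\<And>x y. x \<in> EObj C \<Longrightarrow> y \<in> EObj C \<Longrightarrow> \<mu> x y \<in> Arr V \<and>
      Dom V (\<mu> x y) = EHom C x y \<boxtimes> Dom V (\<kappa> x) \<and> Cod V (\<mu> x y) = Dom V (\<kappa> y) \<and>
      \<kappa> y \<cdot> \<mu> x y = act M x y \<cdot> (Ident V (EHom C x y) \<boxdot> \<kappa> x)"
    by metis
  let ?X = "\<lambda>x. Dom V (\<kappa> x)"
  have act: "is_action ?X \<mu>"
  \<comment> \<open>A kernel inclusion is a single monic arrow, hence the one-element index
    type.\<close>
  proof (rule is_action_jointly_monic[where J = "UNIV :: unit set" and M = "\<lambda>_. M" and p = "\<lambda>_. \<kappa>"])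
    show "f = g" if "x \<in> EObj C" "f \<in> Arr V" "g \<in> Arr V" "Dom V f = Dom V g" "Cod V f = ?X x" "Cod V g = ?X x"
      "\<And>j::unit. j \<in> UNIV \<Longrightarrow> \<kappa> x \<cdot> f = \<kappa> x \<cdot> g" for x f g
      by (rule monicD[OF K(6)[OF that(1)]]) (use that in simp_all)
  qed (use \<mu> in \<open>simp_all add: in_Hom\<close>)
  note KM = action_module_Mod[OF act]
  have e: "equivariant (action_module ?X \<mu>) M \<kappa>"
    using \<mu> by (simp add: equivariant_def in_Hom act)
  show thesis
    by (rule that[OF family_nat_Hom(1)[OF KM M(1) e]]) (simp add: family_nat_Hom(2)[OF KM M(1) e] \<kappa>)
qed

text \<open>The inclusion of the pointwise kernel and the zero map have the same composite with
  \<open>t\<close>, so they coincide; each component then has a zero kernel.\<close>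

lemma monic_Mod_pointwise:
  assumes m: "monic (Mod V C) t" and t: "t \<in> Hom (Mod V C) M N" and x: "x \<in> EObj C"
  shows "monic V (cmp t x)"
proof -
  interpret Md: category "Mod V C" by (rule category_Mod)
  obtain K k where k: "k \<in> Hom (Mod V C) K M" "\<And>x. x \<in> EObj C \<Longrightarrow> is_kernel V (cmp k x) (cmp t x)"
    using kernel_module[OF t] by blast
  note [simp] = cmp_simps[OF t] cmp_simps[OF k(1)]
  obtain z where z: "z \<in> Hom (Mod V C) K M" "\<And>x. x \<in> EObj C \<Longrightarrow> zero_arrow V (cmp z x)"
    using zero_module_map[OF Mod_HomD(1,2)[OF k(1)]] by blast
  note [simp] = cmp_simps[OF z(1)]
  have "t \<cdot>\<^bsub>Mod V C\<^esub> k = t \<cdot>\<^bsub>Mod V C\<^esub> z"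
  proof (rule Mod_Hom_eqI[OF Mod_Comp(1)[OF k(1) t] Mod_Comp(1)[OF z(1) t]])
    fix y assume y [simp]: "y \<in> EObj C"
    have "cmp t y \<cdot> cmp k y = cmp t y \<cdot> cmp z y"
      by (rule zero_arrow_unique) (simp_all add: is_kernelD(4)[OF k(2)] zero_arrow_Comp_left z(2))
    then show "cmp (t \<cdot>\<^bsub>Mod V C\<^esub> k) y = cmp (t \<cdot>\<^bsub>Mod V C\<^esub> z) y"
      by (simp add: cmp_Comp[OF k(1) t] cmp_Comp[OF z(1) t])
  qed
  then have "k = z" by (rule Md.monicD[OF m]) (use k(1) z(1) t in \<open>auto simp: in_Hom\<close>)
  then show ?thesis using zero_kernel_monic[OF k(2)[OF x]] z(2)[OF x] by simp
qed

lemma split_monic_direct_summand: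
  assumes m: "m \<in> Hom (Mod V C) M P" and r: "r \<in> Hom (Mod V C) P M" and rm: "r \<cdot>\<^bsub>Mod V C\<^esub> m = Ident (Mod V C) M"
  shows "direct_summand (Mod V C) M P"
proof -
  obtain K k where k: "k \<in> Hom (Mod V C) K P" "\<And>x. x \<in> EObj C \<Longrightarrow> is_kernel V (cmp k x) (cmp r x)"
    using kernel_module[OF r] by blast
  note [simp] = Mod_HomD(1,2)[OF m] Mod_HomD(1)[OF k(1)] cmp_simps[OF m] cmp_simps[OF r] cmp_simps[OF k(1)]
  have H: "cmp m x \<in> Hom V (FObj M x) (FObj P x)" "cmp r x \<in> Hom V (FObj P x) (FObj M x)"
    "cmp r x \<cdot> cmp m x = Ident V (FObj M x)" if x: "x \<in> EObj C" for x
    using cmp_Comp[OF m r x] x by (auto simp: in_Hom rm cmp_Ident)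
  note split_exists = kernel_of_retraction(1)[OF H k(2)] and split_unique = kernel_of_retraction(2)[OF H k(2)]
  let ?\<iota> = "\<lambda>b. if b then m else k"
  have "is_coproduct (Mod V C) UNIV (\<lambda>b. if b then M else K) P ?\<iota>"
    unfolding is_coproduct_def is_product_def op_cat_simps
  proof (intro conjI ballI allI impI)
    show "P \<in> Obj (Mod V C)" by simp
    show "(if b then M else K) \<in> Obj (Mod V C)" "?\<iota> b \<in> Hom (Mod V C) (if b then M else K) P" for b
      using m k(1) by simp_all
    fix Q q assume Q: "Q \<in> Obj (Mod V C)" and q: "\<forall>b\<in>UNIV. q b \<in> Hom (Mod V C) (if b then M else K) Q"
    then have [simp]: "enriched_functor V C (self_enriched V) Q" by simp
    have qT: "q True \<in> Hom (Mod V C) M Q" and qF: "q False \<in> Hom (Mod V C) K Q"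
      using q[rule_format, of True] q[rule_format, of False] by simp_all
    note [simp] = cmp_simps[OF qT] cmp_simps[OF qF]
    \<comment> \<open>The copairing is chosen separately at each object, without a formula, so its
      equivariance must come from its two defining equations.\<close>
    have "\<exists>h. h \<in> Hom V (FObj P x) (FObj Q x) \<and> h \<cdot> cmp m x = cmp (q True) x \<and> h \<cdot> cmp k x = cmp (q False) x"
      if x [simp]: "x \<in> EObj C" for x
      using split_exists[OF x x x x, of "cmp (q True) x" "FObj Q x" "cmp (q False) x"] by (auto simp: in_Hom)
    then obtain h where h: "\<And>x. x \<in> EObj C \<Longrightarrow> h x \<in> Hom V (FObj P x) (FObj Q x)"
      "\<And>x. x \<in> EObj C \<Longrightarrow> h x \<cdot> cmp m x = cmp (q True) x"
      "\<And>x. x \<in> EObj C \<Longrightarrow> h x \<cdot> cmp k x = cmp (q False) x"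
      by metis
    have hA [simp]: "h x \<in> Arr V" "Dom V (h x) = FObj P x" "Cod V (h x) = FObj Q x" if "x \<in> EObj C" for x
      using h(1)[OF that] by (auto simp: in_Hom)
    have sq: "(h y \<cdot> act P x y) \<cdot> (Ident V (EHom C x y) \<boxdot> cmp n x)
        = (act Q x y \<cdot> (Ident V (EHom C x y) \<boxdot> h x)) \<cdot> (Ident V (EHom C x y) \<boxdot> cmp n x)"
      if [simp]: "x \<in> EObj C" "y \<in> EObj C" and n: "n \<in> Hom (Mod V C) L P" and p: "p \<in> Hom (Mod V C) L Q"
        and hn: "\<And>x. x \<in> EObj C \<Longrightarrow> h x \<cdot> cmp n x = cmp p x" for x y n L p
    proof -
      note [simp] = cmp_simps[OF n] cmp_simps[OF p] Mod_HomD(1)[OF n]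
      have "(h y \<cdot> act P x y) \<cdot> (Ident V (EHom C x y) \<boxdot> cmp n x) = h y \<cdot> cmp n y \<cdot> act L x y"
        by (simp add: cmp_equivariant[OF n])
      also have "\<dots> = cmp p y \<cdot> act L x y"
        by (rule Comp_reassoc[OF hn]) simp_all
      also have "\<dots> = act Q x y \<cdot> (Ident V (EHom C x y) \<boxdot> (h x \<cdot> cmp n x))"
        by (simp add: cmp_equivariant[OF p] hn)
      finally show ?thesis by (simp add: whisker_left_Comp)
    qed
    have e: "equivariant P Q h"
      unfolding equivariant_def
    proof (intro conjI ballI)
      fix x y assume x [simp]: "x \<in> EObj C" and y [simp]: "y \<in> EObj C"
      show "h y \<cdot> act P x y = act Q x y \<cdot> (Ident V (EHom C x y) \<boxdot> h x)"
      \<comment> \<open>The components of \<open>m\<close> and \<open>k\<close> are jointly epic and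
        stay so after tensoring, so the square may be tested on them, where it is the equivariance
        of \<open>m\<close>, \<open>k\<close> and \<open>q\<close>.\<close>
      proof (rule tensor_jointly_epic[where J = UNIV and m = "\<lambda>b. cmp (?\<iota> b) x" and u = "EHom C x y" and p = "FObj P x"])
        show "f = f'" if "f \<in> Arr V" "f' \<in> Arr V" "Dom V f = FObj P x" "Dom V f' = FObj P x" "Cod V f = Cod V f'"
          "\<And>b. b \<in> UNIV \<Longrightarrow> f \<cdot> cmp (?\<iota> b) x = f' \<cdot> cmp (?\<iota> b) x" for f f'
          using that(6)[of True] that(6)[of False] by (intro split_unique[OF x x x x that(1-5)]) simp_all
        show "(h y \<cdot> act P x y) \<cdot> (Ident V (EHom C x y) \<boxdot> cmp (?\<iota> b) x)
          = (act Q x y \<cdot> (Ident V (EHom C x y) \<boxdot> h x)) \<cdot> (Ident V (EHom C x y) \<boxdot> cmp (?\<iota> b) x)" for b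
          using sq[OF x y m qT h(2)] sq[OF x y k(1) qF h(3)] by (cases b) simp_all
      qed simp_all
    qed (simp add: in_Hom)
    let ?h = "family_nat P Q h"
    have hh: "?h \<in> Hom (Mod V C) P Q" and ch: "\<And>x. x \<in> EObj C \<Longrightarrow> cmp ?h x = h x"
      using family_nat_Hom[OF _ _ e] by simp_all
    show "\<exists>!h. h \<in> Hom (Mod V C) P Q \<and> (\<forall>b\<in>UNIV. h \<cdot>\<^bsub>Mod V C\<^esub> ?\<iota> b = q b)"
    proof (intro ex1I conjI ballI)
      show "?h \<in> Hom (Mod V C) P Q" by (rule hh)
      have "?h \<cdot>\<^bsub>Mod V C\<^esub> m = q True"
        by (rule Mod_Hom_eqI[OF Mod_Comp(1)[OF m hh] qT]) (simp add: cmp_Comp[OF m hh] ch h(2))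
      moreover have "?h \<cdot>\<^bsub>Mod V C\<^esub> k = q False"
        by (rule Mod_Hom_eqI[OF Mod_Comp(1)[OF k(1) hh] qF]) (simp add: cmp_Comp[OF k(1) hh] ch h(3))
      ultimately show "?h \<cdot>\<^bsub>Mod V C\<^esub> ?\<iota> b = q b" for b by (cases b) simp_all
      fix g assume g: "g \<in> Hom (Mod V C) P Q \<and> (\<forall>b\<in>UNIV. g \<cdot>\<^bsub>Mod V C\<^esub> ?\<iota> b = q b)"
      then have gH: "g \<in> Hom (Mod V C) P Q" and gm: "g \<cdot>\<^bsub>Mod V C\<^esub> m = q True" and gk: "g \<cdot>\<^bsub>Mod V C\<^esub> k = q False"
        using bspec[of UNIV _ True] bspec[of UNIV _ False] by (auto split: if_splits)
      show "g = ?h"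
      proof (rule Mod_Hom_eqI[OF gH hh])
        fix x assume x [simp]: "x \<in> EObj C"
        show "cmp g x = cmp ?h x"
          unfolding ch[OF x]
          by (rule split_unique[OF x x x x])
            (simp_all add: cmp_simps[OF gH] h flip: cmp_Comp[OF m gH] cmp_Comp[OF k(1) gH] gm gk)
      qed
    qed
  qed
  then show ?thesis unfolding direct_summand_def by blast
qed

text \<open>By the Yoneda correspondence, extending \<open>s\<close> along \<open>f\<close> amounts
  to extending an arrow \<open>M c \<rightarrow> i\<close> along the component of \<open>f\<close>
  at \<open>c\<close>, which is monic in \<open>V\<close>.\<close>

lemma injective_hom_module:
  assumes c [simp]: "c \<in> EObj C" and i: "injective V i"
  shows "injective (Mod V C) (hom_module V C c i)"
  unfolding injective_def
proof (intro conjI allI impI)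
  have [simp]: "i \<in> Obj V" using i by (simp add: injective_def)
  show "hom_module V C c i \<in> Obj (Mod V C)" by simp
  fix f s assume fs: "monic (Mod V C) f \<and> s \<in> Hom (Mod V C) (Dom (Mod V C) f) (hom_module V C c i)"
  define M N where "M = Dom (Mod V C) f" and "N = Cod (Mod V C) f"
  have f: "f \<in> Hom (Mod V C) M N" and mono: "monic (Mod V C) f"
    using fs by (simp_all add: monic_def M_def N_def in_Hom)
  have s: "s \<in> Hom (Mod V C) M (hom_module V C c i)" using fs by (simp add: M_def)
  note [simp] = Mod_HomD(1,2)[OF f] cmp_simps[OF f] cmp_simps[OF s]
  obtain g where g: "g \<in> Hom V (FObj M c) i"
    "\<And>x. x \<in> EObj C \<Longrightarrow> uncurry_arrow V (EHom C x c) i (cmp s x) = g \<cdot> right_act M x c"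
    using hom_module_map_transpose[OF c _ s] by auto
  have "monic V (cmp f c)" by (rule monic_Mod_pointwise[OF mono f c])
  then obtain h where h: "h \<in> Hom V (FObj N c) i" "h \<cdot> cmp f c = g"
    using i g(1) unfolding injective_def by fastforce
  have [simp]: "h \<in> Arr V" "Dom V h = FObj N c" "Cod V h = i" using h(1) by (auto simp: in_Hom)
  obtain t where t: "t \<in> Hom (Mod V C) N (hom_module V C c i)"
    "\<And>x. x \<in> EObj C \<Longrightarrow> uncurry_arrow V (EHom C x c) i (cmp t x) = h \<cdot> right_act N x c"
    using hom_module_map[OF c _ _ h(1)] by auto
  note [simp] = cmp_simps[OF t(1)]
  have "t \<cdot>\<^bsub>Mod V C\<^esub> f = s"
  proof (rule Mod_Hom_eqI[OF Mod_Comp(1)[OF f t(1)] s])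
    fix x assume x [simp]: "x \<in> EObj C"
    have "cmp t x \<cdot> cmp f x = cmp s x"
    proof (rule uncurry_inject)
      have "uncurry_arrow V (EHom C x c) i (cmp t x \<cdot> cmp f x) = (h \<cdot> right_act N x c) \<cdot> (cmp f x \<boxdot> Ident V (EHom C x c))"
        by (simp add: uncurry_Comp t(2))
      also have "\<dots> = h \<cdot> cmp f c \<cdot> right_act M x c"
        by (simp add: cmp_right_equivariant[OF f])
      also have "\<dots> = g \<cdot> right_act M x c" by (rule Comp_reassoc[OF h(2)]) simp_all
      finally show "uncurry_arrow V (EHom C x c) i (cmp t x \<cdot> cmp f x) = uncurry_arrow V (EHom C x c) i (cmp s x)"
        by (simp add: g(2))
    qed simp_all
    then show "cmp (t \<cdot>\<^bsub>Mod V C\<^esub> f) x = cmp s x" by (simp add: cmp_Comp[OF f t(1)])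
  qed
  then show "\<exists>h\<in>Hom (Mod V C) (Cod (Mod V C) f) (hom_module V C c i). h \<cdot>\<^bsub>Mod V C\<^esub> f = s"
    using t(1) unfolding N_def by blast
qed

section \<open>Cofree modules on families of injective objects\<close>

context
  assumes products: "\<And>X. (\<And>c. c \<in> EObj C \<Longrightarrow> X c \<in> Obj V) \<Longrightarrow> \<exists>P p. is_product V (EObj C) X P p"
begin

lemma is_product_CoFr:
  assumes "\<And>c. c \<in> EObj C \<Longrightarrow> a c \<in> Obj V"
  shows "\<exists>p. is_product (Mod V C) (EObj C) (\<lambda>c. hom_module V C c (a c)) (CoFr V C a) p"
  unfolding CoFr_def using assms by (intro is_product_product_module products) simp_all

lemma injective_CoFr:
  assumes "\<And>c. c \<in> EObj C \<Longrightarrow> injective V (i c)"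
  shows "injective (Mod V C) (CoFr V C i)"
proof -
  interpret Md: category "Mod V C" by (rule category_Mod)
  have "\<And>c. c \<in> EObj C \<Longrightarrow> i c \<in> Obj V" using assms by (simp add: injective_def)
  then obtain p where "is_product (Mod V C) (EObj C) (\<lambda>c. hom_module V C c (i c)) (CoFr V C i) p"
    using is_product_CoFr by blast
  then show ?thesis by (rule Md.injective_product) (simp add: injective_hom_module assms)
qed

text \<open>The unit of the adjunction between \<open>Forg\<close> and \<open>CoFr\<close>, composed with \<open>CoFr\<close> of the monomorphisms \<open>j\<close>.\<close>

lemma monic_into_CoFr:
  assumes M [simp]: "enriched_functor V C (self_enriched V) M"
    and j: "\<And>c. c \<in> EObj C \<Longrightarrow> j c \<in> Hom V (FObj M c) (i c)"
    and mono: "\<And>c. c \<in> EObj C \<Longrightarrow> monic V (j c)"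
  shows "\<exists>m\<in>Hom (Mod V C) M (CoFr V C i). monic (Mod V C) m"
proof -
  interpret Md: category "Mod V C" by (rule category_Mod)
  have jA [simp]: "j c \<in> Arr V" "Dom V (j c) = FObj M c" "Cod V (j c) = i c" if "c \<in> EObj C" for c
    using j[OF that] by (auto simp: in_Hom)
  have i [simp]: "i c \<in> Obj V" if "c \<in> EObj C" for c using Cod_Obj[of "j c"] that by simp
  obtain p where p: "is_product (Mod V C) (EObj C) (\<lambda>c. hom_module V C c (i c)) (CoFr V C i) p"
    using is_product_CoFr[of i] by auto
  note P = is_productD[OF p]
  have "\<exists>t. t \<in> Hom (Mod V C) M (hom_module V C c (i c)) \<and>
      (\<forall>x\<in>EObj C. uncurry_arrow V (EHom C x c) (i c) (cmp t x) = j c \<cdot> right_act M x c)" if c: "c \<in> EObj C" for c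
    using hom_module_map[OF c i[OF c] M j[OF c]] by metis
  then obtain t where t: "\<And>c. c \<in> EObj C \<Longrightarrow> t c \<in> Hom (Mod V C) M (hom_module V C c (i c))"
    "\<And>c x. c \<in> EObj C \<Longrightarrow> x \<in> EObj C \<Longrightarrow> uncurry_arrow V (EHom C x c) (i c) (cmp (t c) x) = j c \<cdot> right_act M x c"
    by metis
  have "\<exists>!m. m \<in> Hom (Mod V C) M (CoFr V C i) \<and> (\<forall>c\<in>EObj C. p c \<cdot>\<^bsub>Mod V C\<^esub> m = t c)"
    by (rule P(4)) (simp_all add: t(1))
  then obtain m where m: "m \<in> Hom (Mod V C) M (CoFr V C i)" "\<And>c. c \<in> EObj C \<Longrightarrow> p c \<cdot>\<^bsub>Mod V C\<^esub> m = t c"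
    by blast
  have "monic (Mod V C) m"
    unfolding monic_def
  proof (intro conjI ballI impI)
    show "m \<in> Arr (Mod V C)" using m(1) by (simp only: in_Hom)
    fix f g assume "f \<in> Arr (Mod V C)" "g \<in> Arr (Mod V C)"
      and fg: "Dom (Mod V C) f = Dom (Mod V C) g \<and> Cod (Mod V C) f = Dom (Mod V C) m \<and>
        Cod (Mod V C) g = Dom (Mod V C) m \<and> m \<cdot>\<^bsub>Mod V C\<^esub> f = m \<cdot>\<^bsub>Mod V C\<^esub> g"
    then obtain L where f: "f \<in> Hom (Mod V C) L M" and g: "g \<in> Hom (Mod V C) L M"
      using m(1) by (auto simp: in_Hom)
    have mfg: "m \<cdot>\<^bsub>Mod V C\<^esub> f = m \<cdot>\<^bsub>Mod V C\<^esub> g" using fg by blast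
    show "f = g"
    proof (rule Mod_Hom_eqI[OF f g])
      fix c assume c [simp]: "c \<in> EObj C"
      note [simp] = Mod_HomD(1)[OF f]
      note tc = t(1)[OF c]
      have eq: "t c \<cdot>\<^bsub>Mod V C\<^esub> f = t c \<cdot>\<^bsub>Mod V C\<^esub> g"
        using Md.Comp_assoc[OF f m(1) P(3)[OF c]] Md.Comp_assoc[OF g m(1) P(3)[OF c]] mfg
        by (simp add: m(2))
      \<comment> \<open>Evaluating the \<open>c\<close>-th coordinate of \<open>m\<close> at the
        identity of \<open>c\<close> recovers \<open>j c\<close>. Hence \<open>m\<close> can only
        identify maps that \<open>j c\<close> already identifies at \<open>c\<close>.\<close>
      have u: "uncurry_arrow V (EHom C c c) (i c) (cmp (t c \<cdot>\<^bsub>Mod V C\<^esub> h) c) \<cdot> (Ident V (FObj L c) \<boxdot> EId C c)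
          = (j c \<cdot> cmp h c) \<cdot> RUnit V (FObj L c)" if h: "h \<in> Hom (Mod V C) L M" for h
      proof -
        note [simp] = cmp_simps[OF h] cmp_simps[OF tc]
        have "uncurry_arrow V (EHom C c c) (i c) (cmp (t c \<cdot>\<^bsub>Mod V C\<^esub> h) c)
            = (j c \<cdot> right_act M c c) \<cdot> (cmp h c \<boxdot> Ident V (EHom C c c))"
          by (simp add: cmp_Comp[OF h tc] uncurry_Comp t(2))
        also have "\<dots> = j c \<cdot> cmp h c \<cdot> right_act L c c"
          by (simp add: cmp_right_equivariant[OF h])
        finally show ?thesis by (simp add: right_act_EId)
      qed
      have "j c \<cdot> cmp f c = j c \<cdot> cmp g c"
        by (rule iso_cancel_right[OF RUnit_iso, of "FObj L c"])
          (use u[OF f] u[OF g] eq cmp_simps[OF f] cmp_simps[OF g] in simp_all)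
      then show "cmp f c = cmp g c"
        by (rule monicD[OF mono[OF c]]) (simp_all add: cmp_simps[OF f] cmp_simps[OF g])
    qed
  qed
  then show ?thesis using m(1) by blast
qed

end

end

theorem proposition3p7:
  fixes small :: "'s set \<Rightarrow> bool"
    and A :: "('o, 'm) precosmos"
    and C :: "('s, 'o, 'm) ecat"
  assumes "smallness small"
    and "abelian_cosmos A small"
    and "enriched_category A C"
    and "small (EObj C)"
    and "enough_injectives A"
  shows "enough_injectives (Mod A C) \<and>
    (\<forall>M\<in>Obj (Mod A C). injective (Mod A C) M \<longleftrightarrow>
      (\<exists>i. (\<forall>c\<in>EObj C. injective A (i c)) \<and> direct_summand (Mod A C) M (CoFr A C i)))"
proof -
  interpret A: abelian_cosmos A small by fact
  interpret C: enriched_category A C by fact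
  interpret enriched_over_abelian A C ..
  interpret Md: category "Mod A C" by (rule category_Mod)
  \<comment> \<open>The objects of \<open>C\<close> have the type on which \<open>small\<close> is
    defined, so families indexed by them have products by completeness.\<close>
  have products: "\<exists>P p. is_product A (EObj C) X P p" if "\<And>c. c \<in> EObj C \<Longrightarrow> X c \<in> Obj A" for X
    using A.small_product_exists[OF A.complete \<open>small (EObj C)\<close> that] .
  have embed: "\<exists>i. (\<forall>c\<in>EObj C. injective A (i c)) \<and> (\<exists>m\<in>Hom (Mod A C) M (CoFr A C i). monic (Mod A C) m)"
    if M: "M \<in> Obj (Mod A C)" for M
  proof -
    have "\<forall>c. c \<in> EObj C \<longrightarrow> (\<exists>i f. injective A i \<and> f \<in> Hom A (FObj M c) i \<and> monic A f)"
      using M assms(5) unfolding enough_injectives_def by simp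
    then obtain i j where "\<And>c. c \<in> EObj C \<Longrightarrow> injective A (i c) \<and> j c \<in> Hom A (FObj M c) (i c) \<and> monic A (j c)"
      by metis
    then show ?thesis using monic_into_CoFr[OF products, of M j i] M by auto
  qed
  show ?thesis
  proof (intro conjI ballI iffI)
    show "enough_injectives (Mod A C)"
      unfolding enough_injectives_def using embed injective_CoFr[OF products] by blast
    fix M assume M: "M \<in> Obj (Mod A C)"
    {
      assume inj: "injective (Mod A C) M"
      obtain i m where i: "\<forall>c\<in>EObj C. injective A (i c)" and m: "m \<in> Hom (Mod A C) M (CoFr A C i)" "monic (Mod A C) m"
        using embed[OF M] by blast
      have "Dom (Mod A C) m = M" "Cod (Mod A C) m = CoFr A C i" using m(1) by (simp_all only: in_Hom)
      \<comment> \<open>The retraction extends the identity of \<open>M\<close> along the embedding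
        \<open>m\<close>.\<close>
      then obtain r where r: "r \<in> Hom (Mod A C) (CoFr A C i) M" "r \<cdot>\<^bsub>Mod A C\<^esub> m = Ident (Mod A C) M"
        using inj m(2) Md.Ident_Hom[OF M] unfolding injective_def by metis
      show "\<exists>i. (\<forall>c\<in>EObj C. injective A (i c)) \<and> direct_summand (Mod A C) M (CoFr A C i)"
        using i split_monic_direct_summand[OF m(1) r] by blast
    next
      assume "\<exists>i. (\<forall>c\<in>EObj C. injective A (i c)) \<and> direct_summand (Mod A C) M (CoFr A C i)"
      then obtain i where i: "\<forall>c\<in>EObj C. injective A (i c)" and ds: "direct_summand (Mod A C) M (CoFr A C i)"
        by blast
      \<comment> \<open>A zero map supplies the arrow out of the complement needed to build the
        retraction.\<close>
      have "Hom (Mod A C) Z M \<noteq> {}" if "Z \<in> Obj (Mod A C)" for Z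
        using zero_module_map[of Z M] that M by auto
      then obtain s r where "s \<in> Hom (Mod A C) M (CoFr A C i)" "r \<in> Hom (Mod A C) (CoFr A C i) M"
        "r \<cdot>\<^bsub>Mod A C\<^esub> s = Ident (Mod A C) M"
        using Md.direct_summand_retract[OF ds] by metis
      then show "injective (Mod A C) M"
        using Md.injective_retract injective_CoFr[OF products] i by blast
    }
  qed
qed

end
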